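(* Let $d\ge1$ be an integer and $\sigma>0$. Assume that $\overline{\rho}=(\overline{\rho}^n)_{n\ge0}$ is a solution to $\overline{\rho}^{n+1}=T[\overline{\rho}^n]$, $n\ge0$, in $\mathcal{P}(\mathbb{R}^d)$, normalized so that $\int_{\mathbb{R}^d}x\,\overline{\rho}^n(x)\,dx=0$ for all $n\ge0$. Then for each fixed integer $K\ge2$ we have, for all $n\ge0$, $$\mathrm{D}_{\mathrm{KL}}(\overline{\rho}^{n+1}\,\|\,\overline{\rho}_\infty)\leq\frac1K\,\mathrm{D}_{\mathrm{KL}}(\overline{\rho}^n\,\|\,\overline{\rho}_\infty).$$ In particular, for each $K\ge2$, $\mathrm{D}_{\mathrm{KL}}(\overline{\rho}^n\,\|\,\overline{\rho}_\infty)\to0$ as $n\to\infty$.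
   Context: Let $\mathcal{P}(\mathbb{R}^d)$ be the set of probability measures on $\mathbb{R}^d$ (written as densities) and $\mathbb{I}_d$ the $d\times d$ identity matrix. The operator $T:\mathcal{P}(\mathbb{R}^d)\to\mathcal{P}(\mathbb{R}^d)$ is $T[\rho]=\phi*S_K[C_K[\rho]]$, where $\phi$ is the density of the Gaussian law $\mathcal{N}(0,\sigma^2\mathbb{I}_d)$, $C_K[\rho]=\rho*\cdots*\rho$ ($K$ times), and $S_K[\rho](x)=K^d\rho(Kx)$ for $x\in\mathbb{R}^d$. Equivalently, $T[\rho]$ is the law of $\frac1K\sum_{j=1}^K Y_j+W$ with $Y_1,\dots,Y_K$ i.i.d. of law $\rho$ and $W\sim\mathcal{N}(0,\sigma^2\mathbb{I}_d)$ independent of them. The map $T$ preserves the mean. $\overline{\rho}_\infty$ is the law $\mathcal{N}(0,\sigma_\infty^2\mathbb{I}_d)$, with density $\overline{\rho}_\infty(x)=(2\pi\sigma_\infty^2)^{-d/2}e^{-|x|^2/(2\sigma_\infty^2)}$, where $\sigma_\infty^2=\frac{K}{K-1}\sigma^2$. For $g,h\in\mathcal{P}(\mathbb{R}^d)$, the relative entropy from $h$ to $g$ is $\mathrm{D}_{\mathrm{KL}}(g\|h)=\int_{\mathbb{R}^d}g(x)\log g(x)\,dx-\int_{\mathbb{R}^d}g(x)\log h(x)\,dx$.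
   Formalization: The convergence to 0 is stated under the condition that the relative entropy is finite for some n; without it the claim fails, e.g. for a centred initial density with infinite second moment, whose relative entropy is infinite for all n. The contraction inequality is unrestricted. *)

theory Defs
  imports "HOL-Probability.Probability"
begin

text \<open>
  Elements of \<open>P(R^d)\<close> are Borel probability measures on \<^typ>\<open>real ^ 'n\<close>, with \<open>d = CARD('n)\<close>.
  They need not have a density; those that do are of the form \<open>density lborel f\<close>, and the lemmas
  \<open>scaling_density\<close> and \<open>rel_entropy_density\<close> give the corresponding formulas for densities.
\<close>

definition prob_measure_on_Rn :: "(real ^ 'n) measure \<Rightarrow> bool" where
  "prob_measure_on_Rn M \<longleftrightarrow> prob_space M \<and> sets M = sets borel"

definition gaussian :: "real \<Rightarrow> (real ^ 'n) measure" where
  "gaussian v = density lborel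
     (\<lambda>x. ennreal ((2 * pi * v) powr (- real CARD('n) / 2) * exp (- (norm x)\<^sup>2 / (2 * v))))"

text \<open>\<open>conv_power K M\<close> is the \<open>K\<close>-fold convolution \<open>M \<star> \<dots> \<star> M\<close>; it is only meant for \<open>K \<ge> 1\<close>.\<close>

definition conv_power :: "nat \<Rightarrow> (real ^ 'n) measure \<Rightarrow> (real ^ 'n) measure" where
  "conv_power K M = ((\<lambda>N. M \<star> N) ^^ (K - 1)) M"

text \<open>The law of \<open>X / K\<close> for \<open>X\<close> of law \<open>M\<close>; its density is \<open>x \<mapsto> K\<^sup>d f (K x)\<close> if \<open>M\<close> has density \<open>f\<close>.\<close>

definition scaling :: "nat \<Rightarrow> (real ^ 'n) measure \<Rightarrow> (real ^ 'n) measure" where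
  "scaling K M = distr M borel (\<lambda>x. x /\<^sub>R real K)"

definition T_op :: "real \<Rightarrow> nat \<Rightarrow> (real ^ 'n) measure \<Rightarrow> (real ^ 'n) measure" where
  "T_op \<sigma> K M = (gaussian (\<sigma>\<^sup>2) \<star> scaling K (conv_power K M))"

definition rho_inf :: "real \<Rightarrow> nat \<Rightarrow> (real ^ 'n) measure" where
  "rho_inf \<sigma> K = gaussian (real K / (real K - 1) * \<sigma>\<^sup>2)"

text \<open>
  The Lebesgue integral with values in the extended reals. If both parts are infinite, it is
  \<open>\<infinity>\<close> by the convention \<open>\<infinity> - \<infinity> = \<infinity>\<close> of \<^typ>\<open>ereal\<close>.
\<close>

definition ext_integral :: "'a measure \<Rightarrow> ('a \<Rightarrow> real) \<Rightarrow> ereal" where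
  "ext_integral M f =
     enn2ereal (\<integral>\<^sup>+x. ennreal (f x) \<partial>M) - enn2ereal (\<integral>\<^sup>+x. ennreal (- f x) \<partial>M)"

text \<open>
  Relative entropy from \<open>N\<close> to \<open>M\<close>, through the Lebesgue densities \<open>g\<close> of \<open>M\<close> and \<open>h\<close> of \<open>N\<close>, where
  \<open>N\<close> is supposed to have one. It is \<open>\<infinity>\<close> unless \<open>M\<close> is absolutely continuous with respect to
  \<open>N\<close>; that condition also gives \<open>h > 0\<close> almost everywhere on \<open>{g > 0}\<close>, so that the value
  \<open>ln 0 = 0\<close> is harmless. If \<open>M\<close> has a finite first moment and \<open>N\<close> is Gaussian, the integral of
  \<open>g ln g\<close> is not \<open>-\<infinity>\<close> and that of \<open>g ln h\<close> is not \<open>\<infinity>\<close>, so the difference is meaningful.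
\<close>

definition rel_entropy :: "(real ^ 'n) measure \<Rightarrow> (real ^ 'n) measure \<Rightarrow> ereal" where
  "rel_entropy M N =
     (if absolutely_continuous lborel N \<and> absolutely_continuous N M then
        (let g = (\<lambda>x. enn2real (RN_deriv lborel M x));
             h = (\<lambda>x. enn2real (RN_deriv lborel N x))
         in ext_integral lborel (\<lambda>x. g x * ln (g x)) - ext_integral lborel (\<lambda>x. g x * ln (h x)))
      else \<infinity>)"

lemma scaling_density:
  fixes f :: "real ^ 'n \<Rightarrow> real"
  assumes f[measurable]: "f \<in> borel_measurable borel" and nonneg: "\<And>x. 0 \<le> f x" and K: "K \<ge> 1"
  shows "scaling K (density lborel (\<lambda>x. ennreal (f x))) =
    density lborel (\<lambda>x. ennreal (real K ^ CARD('n) * f (real K *\<^sub>R x)))"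
proof (rule measure_eqI)
  show "sets (scaling K (density lborel (\<lambda>x. ennreal (f x)))) =
    sets (density lborel (\<lambda>x. ennreal (real K ^ CARD('n) * f (real K *\<^sub>R x))))"
    by (simp add: scaling_def)
next
  fix A :: "(real ^ 'n) set"
  assume "A \<in> sets (scaling K (density lborel (\<lambda>x. ennreal (f x))))"
  then have A[measurable]: "A \<in> sets borel" by (simp add: scaling_def)
  have K0: "real K \<noteq> 0" "real K > 0" using K by auto
  have "emeasure (scaling K (density lborel (\<lambda>x. ennreal (f x)))) A =
      (\<integral>\<^sup>+x. indicator A x \<partial>scaling K (density lborel (\<lambda>x. ennreal (f x))))"
    by (simp add: scaling_def)
  also have "\<dots> = (\<integral>\<^sup>+x. ennreal (f x) * indicator A (x /\<^sub>R real K) \<partial>lborel)"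
    by (simp add: scaling_def nn_integral_distr nn_integral_density del: nn_integral_indicator)
  also have "\<dots> = (\<integral>\<^sup>+x. ennreal (real K ^ CARD('n)) * (ennreal (f (real K *\<^sub>R x)) * indicator A x) \<partial>lborel)"
    using K0
    by (subst lborel_affine[of "real K" 0, OF K0(1)])
       (simp add: nn_integral_density nn_integral_distr)
  also have "\<dots> = emeasure (density lborel (\<lambda>x. ennreal (real K ^ CARD('n) * f (real K *\<^sub>R x)))) A"
    by (simp add: emeasure_density ennreal_mult' nonneg mult_ac)
  finally show "emeasure (scaling K (density lborel (\<lambda>x. ennreal (f x)))) A =
    emeasure (density lborel (\<lambda>x. ennreal (real K ^ CARD('n) * f (real K *\<^sub>R x)))) A" .
qed

lemma ext_integral_cong_AE:
  assumes "AE x in M. f x = g x"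
  shows "ext_integral M f = ext_integral M g"
proof -
  have "(\<integral>\<^sup>+x. ennreal (f x) \<partial>M) = (\<integral>\<^sup>+x. ennreal (g x) \<partial>M)"
    "(\<integral>\<^sup>+x. ennreal (- f x) \<partial>M) = (\<integral>\<^sup>+x. ennreal (- g x) \<partial>M)"
    using assms by (auto intro!: nn_integral_cong_AE)
  then show ?thesis by (simp add: ext_integral_def)
qed

lemma rel_entropy_density:
  fixes g h :: "real ^ 'n \<Rightarrow> real"
  assumes [measurable]: "g \<in> borel_measurable borel" "h \<in> borel_measurable borel"
    and nonneg: "\<And>x. 0 \<le> g x" and pos: "\<And>x. 0 < h x"
  shows "rel_entropy (density lborel (\<lambda>x. ennreal (g x))) (density lborel (\<lambda>x. ennreal (h x))) =
    ext_integral lborel (\<lambda>x. g x * ln (g x)) - ext_integral lborel (\<lambda>x. g x * ln (h x))"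
proof -
  let ?M = "density lborel (\<lambda>x. ennreal (g x))" and ?N = "density lborel (\<lambda>x. ennreal (h x))"
  have "absolutely_continuous lborel ?N"
    by (rule absolutely_continuousI_density) simp
  moreover have "absolutely_continuous ?N ?M"
    unfolding absolutely_continuous_def using pos
    by (auto simp: null_sets_density_iff not_le elim!: eventually_mono)
       (metis ennreal_eq_0_iff not_le)
  moreover have G: "AE x in lborel. g x = enn2real (RN_deriv lborel ?M x)"
  proof -
    have "AE x in lborel. ennreal (g x) = RN_deriv lborel ?M x"
      by (rule sigma_finite_measure.RN_deriv_unique) (auto simp: sigma_finite_lborel)
    then show ?thesis by eventually_elim (metis enn2real_ennreal nonneg)
  qed
  moreover have H: "AE x in lborel. h x = enn2real (RN_deriv lborel ?N x)"
  proof -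
    have "AE x in lborel. ennreal (h x) = RN_deriv lborel ?N x"
      by (rule sigma_finite_measure.RN_deriv_unique) (auto simp: sigma_finite_lborel)
    then show ?thesis by eventually_elim (metis enn2real_ennreal pos less_imp_le)
  qed
  moreover have "ext_integral lborel
      (\<lambda>x. enn2real (RN_deriv lborel ?M x) * ln (enn2real (RN_deriv lborel ?M x))) =
      ext_integral lborel (\<lambda>x. g x * ln (g x))"
    using G by (intro ext_integral_cong_AE) (auto elim!: eventually_mono)
  moreover have "ext_integral lborel
      (\<lambda>x. enn2real (RN_deriv lborel ?M x) * ln (enn2real (RN_deriv lborel ?N x))) =
      ext_integral lborel (\<lambda>x. g x * ln (h x))"
  proof (rule ext_integral_cong_AE)
    show "AE x in lborel. enn2real (RN_deriv lborel ?M x) * ln (enn2real (RN_deriv lborel ?N x)) =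
        g x * ln (h x)"
      using G H by eventually_elim simp
  qed
  ultimately show ?thesis
    by (simp add: rel_entropy_def Let_def)
qed

end

theory Submission
  imports Defs "HOL-Real_Asymp.Real_Asymp"
begin

text \<open>
  Let \<open>G = N(0, v I)\<close> and let \<open>X\<close>, \<open>Y\<close> be independent centred random vectors. The whole proof rests on
  the inequality of Shannon and Stam, in its form for relative entropies: if \<open>a\<^sup>2 + b\<^sup>2 = 1\<close>, then
  \<open>D(a X + b Y | G) \<le> a\<^sup>2 D(X | G) + b\<^sup>2 D(Y | G)\<close> (\<open>rel_entropy_combination_le\<close>).
  Applied repeatedly to i.i.d. variables \<open>Y\<^sub>j\<close> of law \<open>\<rho>\<close>, it shows that the normalised sum
  \<open>S = (Y\<^sub>1 + \<dots> + Y\<^sub>K) / sqrt K\<close> has at most the entropy of \<open>\<rho>\<close>. Since \<open>\<sigma>\<^sup>2\<close> is \<open>(K - 1) / K\<close> times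
  the variance of the equilibrium, \<open>T[\<rho>]\<close> is the law of \<open>sqrt ((K - 1) / K) Z + S / sqrt K\<close> with \<open>Z\<close> in
  equilibrium and independent of \<open>S\<close>. Here \<open>Z\<close> contributes no entropy, and \<open>S\<close> enters with weight \<open>1 / K\<close>.

  The inequality itself is proved in dual form. By the variational principle of Gibbs,
  \<open>D(a X + b Y | G)\<close> is the supremum over bounded \<open>f\<close> of \<open>E f(a X + b Y) - ln \<integral> exp f dG\<close>. Hence it suffices
  to show, when \<open>X\<close> and \<open>Y\<close> have densities \<open>p\<close> and \<open>q\<close> with respect to \<open>G\<close>,
  \<open>E f(a X + b Y) \<le> ln \<integral> exp f dG + a\<^sup>2 \<integral> p ln p dG + b\<^sup>2 \<integral> q ln q dG + (a b / v) E (X \<bullet> Y)\<close>.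
  The last term vanishes for centred laws.

  On the line this is an argument with transport maps. Let \<open>T\<close> and \<open>U\<close> be the increasing maps that
  carry the Gaussian law to the laws of \<open>X\<close> and \<open>Y\<close>, and let \<open>u\<close>, \<open>w\<close> be independent Gaussian variables, so
  that \<open>a X + b Y\<close> has the law of \<open>S = a T(u) + b U(w)\<close>. Rotate the plane so that \<open>x = a u + b w\<close> becomes the
  first coordinate. With the second coordinate fixed, \<open>S\<close> is an increasing function of \<open>x\<close> with derivative
  \<open>a\<^sup>2 T'(u) + b\<^sup>2 U'(w)\<close>, which is at least \<open>T'(u)\<close> to the power \<open>a\<^sup>2\<close> times \<open>U'(w)\<close> to the power \<open>b\<^sup>2\<close>.
  Substituting \<open>S\<close> for \<open>x\<close> and applying Jensen's inequality gives the claim: the integrals of \<open>ln T'\<close> and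
  \<open>ln U'\<close> are minus the entropies up to second moments, and these cancel (\<open>gaussian_dual_bound_continuous\<close>).

  The dual inequality is inherited by product spaces: condition on the first coordinates, use it for
  the conditional laws of the second ones, and add the marginal inequality by the chain rule for
  entropy (\<open>entropy_stable_pair\<close>). Conditional laws are not centred, which is the reason for
  the term with \<open>X \<bullet> Y\<close>. Induction on the number of coordinates leads from the line to Euclidean space.
  Densities are first continuous, then measurable, between positive bounds; arbitrary densities
  of finite entropy are reached by truncation (\<open>dual_bound_limit\<close>).
\<close>

section \<open>Substitution, rotation and monotone transport\<close>

text \<open>
  The rule for compact intervals is applied to \<open>[-n, n]\<close>; the two limits of \<open>g\<close> ensure that the image
  intervals exhaust the line as well.
\<close>

lemma nn_integral_substitution_UNIV:
  fixes f :: "real \<Rightarrow> ennreal"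
  assumes f[measurable]: "f \<in> borel_measurable borel"
    and deriv: "\<And>x. (g has_real_derivative g' x) (at x)"
    and cont: "continuous_on UNIV g'" and nonneg: "\<And>x. 0 \<le> g' x"
    and top: "filterlim g at_top at_top" and bot: "filterlim g at_bot at_bot"
  shows "(\<integral>\<^sup>+x. f (g x) * g' x \<partial>lborel) = (\<integral>\<^sup>+x. f x \<partial>lborel)"
proof -
  have [measurable]: "g' \<in> borel_measurable borel" "g \<in> borel_measurable borel"
    using cont DERIV_continuous_on[of UNIV g g'] deriv by (auto intro!: borel_measurable_continuous_onI)
  have gm: "mono g"
    using DERIV_nonneg_imp_nondecreasing[of _ _ g] deriv nonneg by (metis monoI)
  let ?I = "\<lambda>n::nat. {- real n .. real n}"
  let ?J = "\<lambda>n::nat. {g (- real n) .. g (real n)}"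
  have fin: "\<exists>n::nat. x \<in> ?I n" for x
  proof -
    obtain n :: nat where "\<bar>x\<bar> \<le> real n" using real_arch_simple by blast
    then show ?thesis by (intro exI[of _ n]) (simp add: abs_le_iff)
  qed
  have fin': "\<exists>n::nat. x \<in> ?J n" for x
  proof -
    obtain N1 N2 where N: "\<And>y. y \<ge> N1 \<Longrightarrow> g y \<ge> x" "\<And>y. y \<le> N2 \<Longrightarrow> g y \<le> x"
      using top bot unfolding filterlim_at_top filterlim_at_bot eventually_at_top_linorder eventually_at_bot_linorder
      by metis
    obtain n :: nat where "max N1 (- N2) \<le> real n" using real_arch_simple by blast
    then have "g (real n) \<ge> x" "g (- real n) \<le> x" using N by auto
    then show ?thesis by auto
  qed
  have lim: "(\<integral>\<^sup>+x. h x \<partial>lborel) = (SUP n. \<integral>\<^sup>+x. h x * indicator (A n) x \<partial>lborel)"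
    if h: "h \<in> borel_measurable borel" and A: "\<And>n. A n \<in> sets borel" "incseq A" and U: "\<And>x. \<exists>n. x \<in> A n"
    for h :: "real \<Rightarrow> ennreal" and A :: "nat \<Rightarrow> real set"
  proof -
    have "(\<integral>\<^sup>+x. h x \<partial>lborel) = (\<integral>\<^sup>+x. (SUP n. h x * indicator (A n) x) \<partial>lborel)"
    proof (rule nn_integral_cong)
      fix x
      obtain n where "x \<in> A n" using U by blast
      then have "h x * indicator (A n) x = h x" by simp
      then show "h x = (SUP n. h x * indicator (A n) x)"
        by (intro antisym SUP_least) (auto intro!: SUP_upper2[of n] split: split_indicator)
    qed
    also have "\<dots> = (SUP n. \<integral>\<^sup>+x. h x * indicator (A n) x \<partial>lborel)"
      using A h
      by (intro nn_integral_monotone_convergence_SUP)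
         (auto simp: incseq_def le_fun_def split: split_indicator)
    finally show ?thesis .
  qed
  have "(\<integral>\<^sup>+x. f x \<partial>lborel) = (SUP n. \<integral>\<^sup>+x. f x * indicator (?J n) x \<partial>lborel)"
    using fin' gm by (intro lim) (auto simp: incseq_def mono_def intro: order_trans)
  also have "\<dots> = (SUP n. \<integral>\<^sup>+x. f (g x) * g' x * indicator (?I n) x \<partial>lborel)"
  proof (intro SUP_cong refl)
    fix n :: nat
    show "(\<integral>\<^sup>+x. f x * indicator (?J n) x \<partial>lborel) = (\<integral>\<^sup>+x. f (g x) * g' x * indicator (?I n) x \<partial>lborel)"
    \<comment> \<open>For \<open>n = 0\<close> the intervals are single points, which the rule for intervals does not cover.\<close>
    proof (cases "n = 0")
      case True
      have z: "AE x in lborel. x \<noteq> (c::real)" for c by (simp add: AE_lborel_singleton)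
      have "(\<integral>\<^sup>+x. f x * indicator (?J n) x \<partial>lborel) = (\<integral>\<^sup>+x. 0 \<partial>(lborel::real measure))"
        using z[of "g 0"] by (intro nn_integral_cong_AE) (auto simp: True indicator_def intro: eventually_mono)
      moreover have "(\<integral>\<^sup>+x. f (g x) * g' x * indicator (?I n) x \<partial>lborel) = (\<integral>\<^sup>+x. 0 \<partial>(lborel::real measure))"
        using z[of 0] by (intro nn_integral_cong_AE) (auto simp: True indicator_def intro: eventually_mono)
      ultimately show ?thesis by simp
    next
      case False
      then show ?thesis
        using deriv nonneg cont
        by (intro nn_integral_substitution_aux f) (auto intro: continuous_on_subset)
    qed
  qed
  also have "\<dots> = (\<integral>\<^sup>+x. f (g x) * g' x \<partial>lborel)"
    using fin by (intro lim[symmetric]) (auto simp: incseq_def)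
  finally show ?thesis ..
qed

text \<open>
  A rotation is a composition of two shears, and each shear is an affine substitution in one variable
  with the other one fixed. Their scaling factors are \<open>1 / a\<close> and \<open>a\<close>.
\<close>

lemma nn_integral_rotate:
  fixes h :: "real \<times> real \<Rightarrow> ennreal"
  assumes [measurable]: "h \<in> borel_measurable (borel \<Otimes>\<^sub>M borel)" and a: "a > 0" and ab: "a\<^sup>2 + b\<^sup>2 = 1"
  shows "(\<integral>\<^sup>+x. \<integral>\<^sup>+y. h (a * x - b * y, b * x + a * y) \<partial>lborel \<partial>lborel) = (\<integral>\<^sup>+x. \<integral>\<^sup>+y. h (x, y) \<partial>lborel \<partial>lborel)"
proof -
  have "(\<integral>\<^sup>+x. \<integral>\<^sup>+y. h (x, y) \<partial>lborel \<partial>lborel)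
     = (\<integral>\<^sup>+x. ennreal (1/a) * (\<integral>\<^sup>+y. h (x, (b/a) * x + (1/a) * y) \<partial>lborel) \<partial>lborel)"
  proof (rule nn_integral_cong)
    fix x :: real
    show "(\<integral>\<^sup>+y. h (x, y) \<partial>lborel) = ennreal (1/a) * (\<integral>\<^sup>+y. h (x, (b/a) * x + (1/a) * y) \<partial>lborel)"
      using a by (subst nn_integral_real_affine[where c="1/a" and t="(b/a) * x"]) auto
  qed
  also have "\<dots> = ennreal (1/a) * (\<integral>\<^sup>+x. \<integral>\<^sup>+y. h (x, (b/a) * x + (1/a) * y) \<partial>lborel \<partial>lborel)"
    by (rule nn_integral_cmult) measurable
  also have "\<dots> = ennreal (1/a) * (\<integral>\<^sup>+y. \<integral>\<^sup>+x. h (x, (b/a) * x + (1/a) * y) \<partial>lborel \<partial>lborel)"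
    by (intro arg_cong2[where f="(*)"] refl lborel_pair.Fubini'[symmetric]) measurable
  also have "\<dots> = ennreal (1/a) * (\<integral>\<^sup>+y. ennreal a * (\<integral>\<^sup>+x. h (a * x - b * y, b * x + a * y) \<partial>lborel) \<partial>lborel)"
  proof (intro arg_cong2[where f="(*)"] refl nn_integral_cong)
    fix y :: real
    have *: "b * (a * x - b * y) / a + y / a = b * x + a * y" for x
    proof -
      have "b * (a * x - b * y) / a + y / a = b * x + (1 - b\<^sup>2) * y / a"
        using a by (simp add: field_simps power2_eq_square)
      also have "1 - b\<^sup>2 = a * a" using ab by (simp add: power2_eq_square)
      finally show ?thesis using a by simp
    qed
    show "(\<integral>\<^sup>+x. h (x, (b/a) * x + (1/a) * y) \<partial>lborel) = ennreal a * (\<integral>\<^sup>+x. h (a * x - b * y, b * x + a * y) \<partial>lborel)"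
      using a by (subst nn_integral_real_affine[where c=a and t="- (b * y)"]) (auto simp: *)
  qed
  also have "\<dots> = (ennreal (1/a) * ennreal a) * (\<integral>\<^sup>+y. \<integral>\<^sup>+x. h (a * x - b * y, b * x + a * y) \<partial>lborel \<partial>lborel)"
    unfolding mult.assoc by (subst nn_integral_cmult) auto
  also have "ennreal (1/a) * ennreal a = 1"
    using a by (simp flip: ennreal_mult)
  also have "(\<integral>\<^sup>+y. \<integral>\<^sup>+x. h (a * x - b * y, b * x + a * y) \<partial>lborel \<partial>lborel)
     = (\<integral>\<^sup>+x. \<integral>\<^sup>+y. h (a * x - b * y, b * x + a * y) \<partial>lborel \<partial>lborel)"
    by (rule lborel_pair.Fubini'[symmetric]) measurable
  finally show ?thesis by simp
qed

text \<open>
  Near \<open>x\<close> the distribution function differs by a constant from an indefinite integral over a bounded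
  interval, and the fundamental theorem of calculus applies to that.
\<close>

lemma cdf_density_deriv:
  fixes g :: "real \<Rightarrow> real"
  assumes cont: "continuous_on UNIV g" and nonneg: "\<And>x. 0 \<le> g x"
    and prob: "prob_space (density lborel g)"
  shows "(cdf (density lborel g) has_real_derivative g x) (at x)"
proof -
  let ?M = "density lborel g"
  interpret M: real_distribution ?M
    using prob by (simp add: real_distribution_def real_distribution_axioms_def)
  have [measurable]: "g \<in> borel_measurable borel" using cont by (rule borel_measurable_continuous_onI)
  have diff: "cdf ?M y = cdf ?M (x - 1) + integral {x - 1..y} g" if y: "y \<in> {x - 1<..x + 1}" for y
  proof -
    have int: "set_integrable lborel {x - 1..y} g"
      using cont by (intro borel_integrable_atLeastAtMost') (auto intro: continuous_on_subset)
    have "cdf ?M y - cdf ?M (x - 1) = measure ?M {x - 1<..y}"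
      using y by (intro M.cdf_diff_eq) auto
    also have "\<dots> = (\<integral>z. indicator {x - 1<..y} z \<partial>?M)" by simp
    also have "\<dots> = (\<integral>z. g z * indicator {x - 1<..y} z \<partial>lborel)"
      by (subst integral_density) (auto simp: nonneg)
    also have "\<dots> = (\<integral>z. indicator {x - 1..y} z * g z \<partial>lborel)"
      using AE_lborel_singleton[of "x - 1"]
      by (intro integral_cong_AE) (auto simp: indicator_def elim!: eventually_mono)
    also have "\<dots> = integral {x - 1..y} g"
      using set_borel_integral_eq_integral(2)[OF int] by (simp add: set_lebesgue_integral_def)
    finally show ?thesis by simp
  qed
  have "((\<lambda>y. integral {x - 1..y} g) has_real_derivative g x) (at x within {x - 1..x + 1})"
    using cont by (intro integral_has_real_derivative) (auto intro: continuous_on_subset)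
  then have "((\<lambda>y. integral {x - 1..y} g) has_real_derivative g x) (at x)"
    by (subst (asm) at_within_interior) auto
  then have "((\<lambda>y. cdf ?M (x - 1) + integral {x - 1..y} g) has_real_derivative g x) (at x)"
    by (auto intro!: derivative_eq_intros)
  then show ?thesis
    by (rule has_field_derivative_transform_within_open[where S="{x - 1<..<x + 1}"])
       (auto simp: diff)
qed

text \<open>
  With \<open>F\<close> and \<open>G\<close> distribution functions, \<open>T\<close> is the inverse of \<open>F\<close> composed with \<open>G\<close>: the increasing map
  that carries the law of \<open>G\<close> to the law of \<open>F\<close>.
\<close>

lemma monotone_transport:
  fixes F G :: "real \<Rightarrow> real"
  assumes F: "\<And>x. (F has_real_derivative f x) (at x)" "\<And>x. 0 < f x"
    and G: "\<And>x. (G has_real_derivative g x) (at x)" "\<And>x. 0 < g x"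
    and lims: "(F \<longlongrightarrow> 1) at_top" "(F \<longlongrightarrow> 0) at_bot" "(G \<longlongrightarrow> 1) at_top" "(G \<longlongrightarrow> 0) at_bot"
  obtains T where "\<And>x. (T has_real_derivative g x / f (T x)) (at x)"
    "filterlim T at_top at_top" "filterlim T at_bot at_bot"
proof -
  have mono: "H x < H y" if "\<And>x. (H has_real_derivative h x) (at x)" "\<And>x. 0 < h x" "x < y"
    for H h :: "real \<Rightarrow> real" and x y
    using DERIV_pos_imp_increasing[OF that(3), of H] that(1,2) by blast
  have mono_le: "H x \<le> H y" if "\<And>x. (H has_real_derivative h x) (at x)" "\<And>x. 0 < h x" "x \<le> y"
    for H h :: "real \<Rightarrow> real" and x y
    using mono[OF that(1,2), of x y] that(3) by (cases "x = y") auto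
  have range: "0 < H x \<and> H x < 1" if H: "\<And>x. (H has_real_derivative h x) (at x)" "\<And>x. 0 < h x"
     "(H \<longlongrightarrow> 1) at_top" "(H \<longlongrightarrow> 0) at_bot" for H h :: "real \<Rightarrow> real" and x
  proof -
    have "H (x + 1) \<le> 1"
      by (rule tendsto_lowerbound[OF H(3)]) 
         (auto intro!: eventually_at_top_linorderI[of "x + 1"] intro: mono_le[OF H(1,2)])
    moreover have "H (x - 1) \<ge> 0"
      by (rule tendsto_upperbound[OF H(4)]) 
         (auto intro!: eventually_at_bot_linorderI[of "x - 1"] intro: mono_le[OF H(1,2)])
    moreover have "H (x - 1) < H x" "H x < H (x + 1)" by (auto intro: mono[OF H(1,2)])
    ultimately show ?thesis by linarith
  qed
  note rF = range[OF F lims(1,2)] and rG = range[OF G lims(3,4)]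
  have F_less: "F x < F y \<longleftrightarrow> x < y" for x y
    using mono[OF F] by (metis linorder_neqE not_less_iff_gr_or_eq)
  have G_less: "G x < G y \<longleftrightarrow> x < y" for x y
    using mono[OF G] by (metis linorder_neqE not_less_iff_gr_or_eq)
  have contF: "isCont F x" for x using F(1) DERIV_isCont by blast
  have ex: "\<exists>x. F x = y" if y: "0 < y" "y < 1" for y
  proof -
    have "\<forall>\<^sub>F x in at_top. F x > y" "\<forall>\<^sub>F x in at_bot. F x < y"
      using order_tendstoD[OF lims(1)] order_tendstoD[OF lims(2)] y by auto
    then obtain u l where "F u > y" "F l < y"
      using eventually_happens' trivial_limit_at_top_linorder trivial_limit_at_bot_linorder by metis
    moreover then have "l < u" using F_less by (meson less_trans)
    ultimately show ?thesis
      using IVT[of F l y u] contF by (metis less_imp_le)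
  qed
  define R where "R y = (SOME x. F x = y)" for y
  have FR: "F (R y) = y" if "0 < y" "y < 1" for y
    unfolding R_def using ex[OF that] by (rule someI_ex)
  have RF: "R (F x) = x" for x
    using FR[of "F x"] rF F_less by (metis linorder_neqE less_irrefl)
  have contR: "isCont R (F x)" for x
    by (rule isCont_inverse_function[where d=1]) (auto simp: RF contF)
  have derivR: "(R has_real_derivative inverse (f (R y))) (at y)" if y: "0 < y" "y < 1" for y
  proof (rule DERIV_inverse_function[where a=0 and b=1])
    show "isCont R y" using contR[of "R y"] FR[OF y] by simp
    show "f (R y) \<noteq> 0" using F(2)[of "R y"] by simp
  qed (use y FR F in auto)
  define T where "T x = R (G x)" for x
  have FT: "F (T x) = G x" for x using FR rG by (simp add: T_def)
  have "(T has_real_derivative g x / f (T x)) (at x)" for x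
    using DERIV_chain2[OF derivR G(1), of x] rG[of x] by (simp add: T_def[abs_def] field_simps)
  moreover have "filterlim T at_top at_top"
    unfolding filterlim_at_top
  proof
    fix Z
    have "\<forall>\<^sub>F x in at_top. G x > F Z" using order_tendstoD(1)[OF lims(3)] rF[of Z] by auto
    then show "\<forall>\<^sub>F x in at_top. T x \<ge> Z"
      by eventually_elim (simp add: FT[symmetric] F_less)
  qed
  moreover have "filterlim T at_bot at_bot"
    unfolding filterlim_at_bot
  proof
    fix Z
    have "\<forall>\<^sub>F x in at_bot. G x < F Z" using order_tendstoD(2)[OF lims(4)] rF[of Z] by auto
    then show "\<forall>\<^sub>F x in at_bot. T x \<le> Z"
      by eventually_elim (simp add: FT[symmetric] F_less)
  qed
  ultimately show ?thesis using that by blast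
qed

section \<open>Dual inequality and Gaussian transport\<close>

lemma (in pair_sigma_finite) integral_pair_mult:
  fixes f :: "'a \<Rightarrow> real" and g :: "'b \<Rightarrow> real"
  assumes f: "integrable M1 f" and g: "integrable M2 g"
  shows "integrable (M1 \<Otimes>\<^sub>M M2) (\<lambda>z. f (fst z) * g (snd z))"
    "(\<integral>z. f (fst z) * g (snd z) \<partial>(M1 \<Otimes>\<^sub>M M2)) = (\<integral>x. f x \<partial>M1) * (\<integral>y. g y \<partial>M2)"
proof -
  have [measurable]: "f \<in> borel_measurable M1" "g \<in> borel_measurable M2"
    using f g by auto
  show int: "integrable (M1 \<Otimes>\<^sub>M M2) (\<lambda>z. f (fst z) * g (snd z))"
    using f g by (intro Fubini_integrable) (auto simp: abs_mult)
  show "(\<integral>z. f (fst z) * g (snd z) \<partial>(M1 \<Otimes>\<^sub>M M2)) = (\<integral>x. f x \<partial>M1) * (\<integral>y. g y \<partial>M2)"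
    using integral_fst'[OF int] by (simp add: mult.commute)
qed

lemma integrable_bounded_mult:
  fixes f g :: "'a \<Rightarrow> real"
  assumes "integrable M f" "g \<in> borel_measurable M" "\<And>x. x \<in> space M \<Longrightarrow> \<bar>g x\<bar> \<le> B"
  shows "integrable M (\<lambda>x. f x * g x)" "integrable M (\<lambda>x. g x * f x)"
proof -
  have [measurable]: "f \<in> borel_measurable M" "g \<in> borel_measurable M" using assms by auto
  show "integrable M (\<lambda>x. f x * g x)"
  proof (rule Bochner_Integration.integrable_bound)
    show "integrable M (\<lambda>x. f x * B)" using assms(1) by simp
    have "norm (f x * g x) \<le> norm (f x * B)" if "x \<in> space M" for x
    proof -
      have "\<bar>g x\<bar> \<le> \<bar>B\<bar>" using assms(3)[OF that] by linarith
      then show ?thesis by (simp add: abs_mult mult_left_mono)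
    qed
    then show "AE x in M. norm (f x * g x) \<le> norm (f x * B)" by (rule AE_I2)
  qed simp
  then show "integrable M (\<lambda>x. g x * f x)" by (simp add: mult.commute)
qed

text \<open>
  Jensen's inequality for the exponential, from the tangent bound \<open>1 + t \<le> exp t\<close> at \<open>t = w - ln E\<close>.
  The assumption is an upper bound on a nonnegative integral, which is what a change of variables yields;
  it also makes \<open>exp w\<close> integrable.
\<close>

lemma integral_le_ln_integral_exp:
  fixes w :: "'a \<Rightarrow> real"
  assumes "prob_space M" and w: "integrable M w"
    and E: "(\<integral>\<^sup>+x. ennreal (exp (w x)) \<partial>M) \<le> ennreal E" and E0: "0 < E"
  shows "(\<integral>x. w x \<partial>M) \<le> ln E"
proof -
  interpret prob_space M by fact
  have [measurable]: "w \<in> borel_measurable M" using w by auto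
  have int: "integrable M (\<lambda>x. exp (w x))"
    by (rule integrableI_bounded) (use E in \<open>auto simp: le_less_trans\<close>)
  have "(\<integral>x. exp (w x) \<partial>M) \<le> E"
    using E E0 nn_integral_eq_integral[OF int] by (simp add: ennreal_le_iff2)
  moreover have "(\<integral>x. w x \<partial>M) \<le> (\<integral>x. exp (w x) / E + (ln E - 1) \<partial>M)"
  proof (rule integral_mono)
    fix x
    have "1 + (w x - ln E) \<le> exp (w x - ln E)" by (rule exp_ge_add_one_self)
    also have "\<dots> = exp (w x) / E" using E0 by (simp add: exp_diff)
    finally show "w x \<le> exp (w x) / E + (ln E - 1)" by simp
  qed (use w int in auto)
  moreover have "(\<integral>x. exp (w x) / E + (ln E - 1) \<partial>M) = (\<integral>x. exp (w x) \<partial>M) / E + (ln E - 1)"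
    using int by (simp add: prob_space)
  moreover have "(\<integral>x. exp (w x) \<partial>M) / E \<le> 1"
    using calculation(1) E0 by (simp add: divide_le_eq)
  ultimately show ?thesis by linarith
qed

text \<open>
  Between positive bounds every integral in the dual inequality converges, and marginal and conditional
  densities stay between positive bounds.
\<close>

definition bounded_density :: "'a measure \<Rightarrow> ('a \<Rightarrow> real) \<Rightarrow> bool" where
  "bounded_density \<gamma> p \<longleftrightarrow> p \<in> borel_measurable \<gamma> \<and>
     (\<exists>l u. 0 < l \<and> (\<forall>x\<in>space \<gamma>. l \<le> p x \<and> p x \<le> u)) \<and> (\<integral>x. p x \<partial>\<gamma>) = 1"

lemma (in prob_space) bounded_density_normalise:
  fixes R :: "'a \<Rightarrow> real"
  assumes [measurable]: "R \<in> borel_measurable M" and l: "0 < l" and R: "\<And>x. x \<in> space M \<Longrightarrow> l \<le> R x" "\<And>x. x \<in> space M \<Longrightarrow> R x \<le> u"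
  shows "0 < (\<integral>x. R x \<partial>M)" "bounded_density M (\<lambda>x. R x / (\<integral>x. R x \<partial>M))"
proof -
  have "integrable M R"
  proof (rule integrable_const_bound[where B=u])
    have "norm (R x) \<le> u" if "x \<in> space M" for x using R[OF that] l by simp
    then show "AE x in M. norm (R x) \<le> u" by (rule AE_I2)
  qed simp
  then have "l \<le> (\<integral>x. R x \<partial>M)" using R by (intro integral_ge_const AE_I2)
  then show Z: "0 < (\<integral>x. R x \<partial>M)" using l by linarith
  show "bounded_density M (\<lambda>x. R x / (\<integral>x. R x \<partial>M))"
    unfolding bounded_density_def
  proof (intro conjI exI ballI)
    show "0 < l / (\<integral>x. R x \<partial>M)" using Z l by simp
    show "l / (\<integral>x. R x \<partial>M) \<le> R x / (\<integral>x. R x \<partial>M)" "R x / (\<integral>x. R x \<partial>M) \<le> u / (\<integral>x. R x \<partial>M)" if "x \<in> space M" for x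
      using Z R that by (auto intro!: divide_right_mono)
  qed (use Z in auto)
qed

text \<open>
  The dual inequality for \<open>m(X, Y)\<close>, where \<open>X\<close> and \<open>Y\<close> are independent with densities \<open>p\<close> and \<open>q\<close> with
  respect to \<open>\<gamma>\<close>. In the applications \<open>m(x, y) = a x + b y\<close>, the weight \<open>t\<close> is \<open>a\<^sup>2\<close>, and
  \<open>c(x, y) = (a b / v) (x \<bullet> y)\<close>. The maps \<open>m\<close> and \<open>c\<close> are parameters so that products of such
  structures can be formed.
\<close>

definition dual_bound ::
  "'a measure \<Rightarrow> ('a \<times> 'a \<Rightarrow> 'a) \<Rightarrow> ('a \<times> 'a \<Rightarrow> real) \<Rightarrow> real \<Rightarrow> ('a \<Rightarrow> real) \<Rightarrow> ('a \<Rightarrow> real) \<Rightarrow> ('a \<Rightarrow> real) \<Rightarrow> bool"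
  where "dual_bound \<gamma> m c t f p q \<longleftrightarrow>
    (\<integral>z. f (m z) * (p (fst z) * q (snd z)) \<partial>(\<gamma> \<Otimes>\<^sub>M \<gamma>)) \<le>
      ln (\<integral>x. exp (f x) \<partial>\<gamma>) + t * (\<integral>x. p x * ln (p x) \<partial>\<gamma>) + (1 - t) * (\<integral>x. q x * ln (q x) \<partial>\<gamma>)
      + (\<integral>z. c z * (p (fst z) * q (snd z)) \<partial>(\<gamma> \<Otimes>\<^sub>M \<gamma>))"

abbreviation normal_law :: "real \<Rightarrow> real measure" where
  "normal_law s \<equiv> density lborel (normal_density 0 s)"

lemma normal_density_ratio:
  "normal_density 0 s z = exp ((y\<^sup>2 - z\<^sup>2) / (2 * s\<^sup>2)) * normal_density 0 s y"
proof -
  have "- z\<^sup>2 / (2 * s\<^sup>2) = (y\<^sup>2 - z\<^sup>2) / (2 * s\<^sup>2) + - y\<^sup>2 / (2 * s\<^sup>2)"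
    by (simp add: diff_divide_distrib)
  then have "exp (- z\<^sup>2 / (2 * s\<^sup>2)) = exp ((y\<^sup>2 - z\<^sup>2) / (2 * s\<^sup>2)) * exp (- y\<^sup>2 / (2 * s\<^sup>2))"
    by (simp only: exp_add)
  then show ?thesis by (simp add: normal_density_def)
qed

text \<open>
  The derivative of the transport map is the quotient of the density at \<open>z\<close> by the target density at
  \<open>T z\<close>. Written with one exponential, its logarithm is a quadratic expression minus \<open>ln (p (T z))\<close>.
\<close>

lemma gaussian_transport:
  assumes s: "0 < s" and p: "bounded_density (normal_law s) p" and cont: "continuous_on UNIV p"
  obtains T where "\<And>z. (T has_real_derivative exp (((T z)\<^sup>2 - z\<^sup>2) / (2 * s\<^sup>2)) / p (T z)) (at z)"
    "filterlim T at_top at_top" "filterlim T at_bot at_bot"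
    "distr (normal_law s) borel T = density (normal_law s) p"
proof -
  let ?\<phi> = "normal_density 0 s"
  have \<phi>0: "0 < ?\<phi> x" for x using s by (rule normal_density_pos)
  have \<phi>cont: "continuous_on A ?\<phi>" for A
    unfolding normal_density_def[abs_def] using s by (intro continuous_intros) auto
  obtain l u where lu: "0 < l" "\<And>x. l \<le> p x" "\<And>x. p x \<le> u" and [measurable]: "p \<in> borel_measurable borel"
    and p1: "(\<integral>x. p x \<partial>normal_law s) = 1"
    using p by (auto simp: bounded_density_def)
  have p0: "0 < p x" for x using lu(1) lu(2)[of x] by linarith
  have pp: "prob_space (density lborel (\<lambda>x. p x * ?\<phi> x))"
  proof
    have "integrable (normal_law s) p" using p1 by (metis not_integrable_integral_eq zero_neq_one)
    then have "(\<integral>\<^sup>+x. ennreal (p x) \<partial>normal_law s) = 1"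
      using p0 p1 by (subst nn_integral_eq_integral) (auto intro: less_imp_le)
    then show "emeasure (density lborel (\<lambda>x. p x * ?\<phi> x)) (space (density lborel (\<lambda>x. p x * ?\<phi> x))) = 1"
      using p0 by (simp add: emeasure_density nn_integral_density ennreal_mult'' mult.commute)
  qed
  interpret N: real_distribution "normal_law s"
    using prob_space_normal_density[OF s] by (simp add: real_distribution_def real_distribution_axioms_def)
  interpret P: real_distribution "density lborel (\<lambda>x. p x * ?\<phi> x)"
    using pp by (auto simp add: real_distribution_def real_distribution_axioms_def)
  have derivs: "(cdf (density lborel (\<lambda>x. p x * ?\<phi> x)) has_real_derivative p x * ?\<phi> x) (at x)"
    "(cdf (normal_law s) has_real_derivative ?\<phi> x) (at x)" "0 < p x * ?\<phi> x" for x
    using p0 \<phi>0 pp cont \<phi>cont N.prob_space_axioms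
    by (auto intro!: cdf_density_deriv continuous_intros less_imp_le)
  obtain T where T: "\<And>z. (T has_real_derivative ?\<phi> z / (p (T z) * ?\<phi> (T z))) (at z)"
    "filterlim T at_top at_top" "filterlim T at_bot at_bot"
    by (rule monotone_transport[OF derivs(1,3,2) \<phi>0 P.cdf_lim_at_top_prob P.cdf_lim_at_bot
          N.cdf_lim_at_top_prob N.cdf_lim_at_bot]) (rule that)
  have contT: "continuous_on UNIV T" using T(1) by (intro continuous_at_imp_continuous_on ballI DERIV_isCont)
  have [measurable]: "T \<in> borel_measurable borel" using contT by (rule borel_measurable_continuous_onI)
  have ratio: "?\<phi> z / (p (T z) * ?\<phi> (T z)) = exp (((T z)\<^sup>2 - z\<^sup>2) / (2 * s\<^sup>2)) / p (T z)" for z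
    using \<phi>0[of "T z"] by (subst normal_density_ratio[of s z "T z"]) simp
  have "distr (normal_law s) borel T = density (normal_law s) p"
  proof (rule measure_eqI)
    fix A assume "A \<in> sets (distr (normal_law s) borel T)"
    then have [measurable]: "A \<in> sets borel" by simp
    have "emeasure (density (normal_law s) p) A = (\<integral>\<^sup>+x. ennreal (p x * ?\<phi> x) * indicator A x \<partial>lborel)"
      using p0 by (simp add: emeasure_density nn_integral_density ennreal_mult'' mult_ac)
    also have "\<dots> = (\<integral>\<^sup>+x. (ennreal (p (T x) * ?\<phi> (T x)) * indicator A (T x)) * ennreal (?\<phi> x / (p (T x) * ?\<phi> (T x))) \<partial>lborel)"
    proof (rule nn_integral_substitution_UNIV[symmetric])
      show "continuous_on UNIV (\<lambda>x. ?\<phi> x / (p (T x) * ?\<phi> (T x)))"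
        using p0 \<phi>0 by (intro continuous_intros \<phi>cont continuous_on_compose2[OF cont contT] 
            continuous_on_compose2[OF \<phi>cont[of UNIV] contT]) (auto simp: less_imp_neq[symmetric])
      show "0 \<le> ?\<phi> x / (p (T x) * ?\<phi> (T x))" for x
        using p0[of "T x"] by (simp add: less_imp_le)
    qed (use T in auto)
    also have "\<dots> = (\<integral>\<^sup>+x. ennreal (?\<phi> x) * indicator A (T x) \<partial>lborel)"
    proof (rule nn_integral_cong)
      fix x
      have "ennreal (p (T x) * ?\<phi> (T x)) * ennreal (?\<phi> x / (p (T x) * ?\<phi> (T x))) = ennreal (?\<phi> x)"
        using p0[of "T x"] \<phi>0[of "T x"] \<phi>0[of x] by (simp flip: ennreal_mult)
      then show "(ennreal (p (T x) * ?\<phi> (T x)) * indicator A (T x)) * ennreal (?\<phi> x / (p (T x) * ?\<phi> (T x)))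
          = ennreal (?\<phi> x) * indicator A (T x)"
        by (metis mult.assoc mult.commute)
    qed
    also have "\<dots> = (\<integral>\<^sup>+x. indicator A x \<partial>distr (normal_law s) borel T)"
      by (simp add: nn_integral_distr nn_integral_density del: nn_integral_indicator)
    finally show "emeasure (distr (normal_law s) borel T) A = emeasure (density (normal_law s) p) A"
      by simp
  qed simp
  with T show thesis by (intro that[of T]) (simp_all only: ratio)
qed

section \<open>The inequality on the line\<close>

lemma exp_weighted_le:
  fixes x y t :: real
  assumes "0 \<le> t" "t \<le> 1"
  shows "exp (t * x + (1 - t) * y) \<le> t * exp x + (1 - t) * exp y"
  using convex_onD[OF exp_convex, of "1 - t" x y] assms by simp

text \<open>
  The transport argument on the line. Continuity of \<open>p\<close> and \<open>q\<close> makes the transport maps continuously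
  differentiable, so that the change of variables in the rotated coordinate is elementary.
\<close>

lemma gaussian_dual_bound_continuous:
  fixes p q f :: "real \<Rightarrow> real"
  assumes s: "0 < s" and a: "0 < a" and b: "0 < b" and ab: "a\<^sup>2 + b\<^sup>2 = 1"
    and p: "bounded_density (normal_law s) p" "continuous_on UNIV p"
    and q: "bounded_density (normal_law s) q" "continuous_on UNIV q"
    and f[measurable]: "f \<in> borel_measurable borel" and fB: "\<And>x. \<bar>f x\<bar> \<le> B"
  shows "dual_bound (normal_law s) (\<lambda>z. a * fst z + b * snd z)
    (\<lambda>z. a * b / s\<^sup>2 * (fst z * snd z)) (a\<^sup>2) f p q"
proof -
  let ?N = "normal_law s" and ?\<phi> = "normal_density 0 s"
  let ?NN = "?N \<Otimes>\<^sub>M ?N"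
  interpret N: prob_space ?N using s by (rule prob_space_normal_density)
  interpret NN: pair_prob_space ?N ?N ..
  obtain l u where lu: "0 < l" "\<And>x. l \<le> p x" "\<And>x. p x \<le> u" and [measurable]: "p \<in> borel_measurable borel"
    and p1: "(\<integral>x. p x \<partial>?N) = 1"
    using p by (auto simp: bounded_density_def)
  obtain l' u' where lu': "0 < l'" "\<And>x. l' \<le> q x" "\<And>x. q x \<le> u'" and [measurable]: "q \<in> borel_measurable borel"
    and q1: "(\<integral>x. q x \<partial>?N) = 1"
    using q by (auto simp: bounded_density_def)
  have p0: "0 < p x" and q0: "0 < q x" for x using lu(1) lu(2)[of x] lu'(1) lu'(2)[of x] by linarith+
  obtain T where T: "\<And>z. (T has_real_derivative exp (((T z)\<^sup>2 - z\<^sup>2) / (2 * s\<^sup>2)) / p (T z)) (at z)"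
    "filterlim T at_top at_top" "filterlim T at_bot at_bot" and Td: "distr ?N borel T = density ?N p"
    by (rule gaussian_transport[OF s p]) (rule that)
  obtain U where U: "\<And>z. (U has_real_derivative exp (((U z)\<^sup>2 - z\<^sup>2) / (2 * s\<^sup>2)) / q (U z)) (at z)"
    "filterlim U at_top at_top" "filterlim U at_bot at_bot" and Ud: "distr ?N borel U = density ?N q"
    by (rule gaussian_transport[OF s q]) (rule that)
  have contT: "continuous_on UNIV T" and contU: "continuous_on UNIV U"
    using T(1) U(1) by (auto intro!: continuous_at_imp_continuous_on DERIV_isCont)
  have [measurable]: "T \<in> borel_measurable borel" "U \<in> borel_measurable borel"
    using contT contU by (auto intro: borel_measurable_continuous_onI)
  define T' where "T' z = exp (((T z)\<^sup>2 - z\<^sup>2) / (2 * s\<^sup>2)) / p (T z)" for z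
  define U' where "U' z = exp (((U z)\<^sup>2 - z\<^sup>2) / (2 * s\<^sup>2)) / q (U z)" for z
  have [measurable]: "T' \<in> borel_measurable borel" "U' \<in> borel_measurable borel"
    by (simp_all add: T'_def[abs_def] U'_def[abs_def])
  have T'0: "0 < T' z" and U'0: "0 < U' z" for z using p0 q0 by (simp_all add: T'_def U'_def)
  have contT': "continuous_on UNIV T'" and contU': "continuous_on UNIV U'"
    unfolding T'_def U'_def using s p0 q0
    by (auto intro!: continuous_intros contT contU continuous_on_compose2[OF p(2) contT] 
      continuous_on_compose2[OF q(2) contU] simp: less_imp_neq[symmetric])

  have sfq: "sigma_finite_measure (density ?N q)"
    using N.prob_space_distr[of U borel] unfolding Ud[symmetric] by (auto simp: prob_space_imp_sigma_finite)
  have "density ?NN (\<lambda>z. ennreal (p (fst z) * q (snd z))) = density ?N p \<Otimes>\<^sub>M density ?N q"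
  proof -
    have "density ?N p \<Otimes>\<^sub>M density ?N q = density ?NN (\<lambda>(x, y). ennreal (p x) * ennreal (q y))"
      using sfq by (intro pair_measure_density N.sigma_finite_measure_axioms) auto
    also have "(\<lambda>(x, y). ennreal (p x) * ennreal (q y)) = (\<lambda>z. ennreal (p (fst z) * q (snd z)))"
      using p0 q0 by (auto simp: ennreal_mult less_imp_le)
    finally show ?thesis ..
  qed
  also have "\<dots> = distr ?NN (borel \<Otimes>\<^sub>M borel) (\<lambda>z. (T (fst z), U (snd z)))"
  proof -
    have "distr ?N borel T \<Otimes>\<^sub>M distr ?N borel U = distr ?NN (borel \<Otimes>\<^sub>M borel) (\<lambda>(x, y). (T x, U y))"
      using sfq by (intro pair_measure_distr) (auto simp: Ud)
    also have "(\<lambda>(x, y). (T x, U y)) = (\<lambda>z. (T (fst z), U (snd z)))" by auto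
    finally show ?thesis by (simp only: Td Ud)
  qed
  finally have image: "density ?NN (\<lambda>z. ennreal (p (fst z) * q (snd z))) = distr ?NN (borel \<Otimes>\<^sub>M borel) (\<lambda>z. (T (fst z), U (snd z)))" .
  have tr_int: "(\<integral>z. g z * (p (fst z) * q (snd z)) \<partial>?NN) = (\<integral>z. g (T (fst z), U (snd z)) \<partial>?NN)"
    and tr_iff: "integrable ?NN (\<lambda>z. g z * (p (fst z) * q (snd z))) \<longleftrightarrow> integrable ?NN (\<lambda>z. g (T (fst z), U (snd z)))"
    if [measurable]: "g \<in> borel_measurable (borel \<Otimes>\<^sub>M borel)" for g :: "real \<times> real \<Rightarrow> real"
  proof -
    have "(\<integral>z. g z \<partial>density ?NN (\<lambda>z. ennreal (p (fst z) * q (snd z)))) = (\<integral>z. (p (fst z) * q (snd z)) * g z \<partial>?NN)"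
      using p0 q0 by (subst integral_density) (auto simp: less_imp_le)
    moreover have "integrable (density ?NN (\<lambda>z. ennreal (p (fst z) * q (snd z)))) g \<longleftrightarrow> integrable ?NN (\<lambda>z. (p (fst z) * q (snd z)) * g z)"
      using p0 q0 by (subst integrable_density) (auto simp: less_imp_le)
    ultimately show "(\<integral>z. g z * (p (fst z) * q (snd z)) \<partial>?NN) = (\<integral>z. g (T (fst z), U (snd z)) \<partial>?NN)"
      "integrable ?NN (\<lambda>z. g z * (p (fst z) * q (snd z))) \<longleftrightarrow> integrable ?NN (\<lambda>z. g (T (fst z), U (snd z)))"
      unfolding image by (simp_all add: integral_distr integrable_distr_eq mult.commute)
  qed
  have trT: "(\<integral>x. g (T x) \<partial>?N) = (\<integral>x. p x * g x \<partial>?N)" if [measurable]: "g \<in> borel_measurable borel" for g :: "real \<Rightarrow> real"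
  proof -
    have "(\<integral>x. g (T x) \<partial>?N) = (\<integral>x. g x \<partial>distr ?N borel T)" by (simp add: integral_distr)
    also have "\<dots> = (\<integral>x. p x * g x \<partial>?N)" using p0 unfolding Td by (subst integral_density) (auto simp: less_imp_le)
    finally show ?thesis .
  qed
  have trU: "(\<integral>x. g (U x) \<partial>?N) = (\<integral>x. q x * g x \<partial>?N)" if [measurable]: "g \<in> borel_measurable borel" for g :: "real \<Rightarrow> real"
  proof -
    have "(\<integral>x. g (U x) \<partial>?N) = (\<integral>x. g x \<partial>distr ?N borel U)" by (simp add: integral_distr)
    also have "\<dots> = (\<integral>x. q x * g x \<partial>?N)" using q0 unfolding Ud by (subst integral_density) (auto simp: less_imp_le)
    finally show ?thesis .
  qed

  define S where "S z = a * T (fst z) + b * U (snd z)" for z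
  have [measurable]: "S \<in> borel_measurable (borel \<Otimes>\<^sub>M borel)" unfolding S_def[abs_def] by measurable
  \<comment> \<open>The mean of \<open>w\<close> is the mean of \<open>f\<close> minus the correlation and entropy terms of the claim, so the claim is
    Jensen's inequality for \<open>w\<close> once the integral of \<open>exp w\<close> is bounded by that of \<open>exp f\<close>.\<close>
  define w where "w z = f (S z) + a * b / s\<^sup>2 * (fst z * snd z - T (fst z) * U (snd z))
     - a\<^sup>2 * ln (p (T (fst z))) - b\<^sup>2 * ln (q (U (snd z)))" for z
  have [measurable]: "w \<in> borel_measurable (borel \<Otimes>\<^sub>M borel)" unfolding w_def[abs_def] by measurable

  have intx: "integrable ?N (\<lambda>x. x)" and intx0: "(\<integral>x. x \<partial>?N) = 0"
    using integrable_normal_moment_nz_1[of s 0] integral_normal_moment_nz_1[of s 0] s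
    by (simp_all add: integrable_density integral_density)
  note xy = NN.integral_pair_mult[OF intx intx]
  have lnp: "\<bar>ln (p x)\<bar> \<le> \<bar>ln l\<bar> + \<bar>ln u\<bar>" and lnq: "\<bar>ln (q x)\<bar> \<le> \<bar>ln l'\<bar> + \<bar>ln u'\<bar>" for x
  proof -
    have "ln l \<le> ln (p x)" "ln (p x) \<le> ln u" using lu(2,3)[of x] lu(1) p0[of x] by auto
    then show "\<bar>ln (p x)\<bar> \<le> \<bar>ln l\<bar> + \<bar>ln u\<bar>" by linarith
    have "ln l' \<le> ln (q x)" "ln (q x) \<le> ln u'" using lu'(2,3)[of x] lu'(1) q0[of x] by auto
    then show "\<bar>ln (q x)\<bar> \<le> \<bar>ln l'\<bar> + \<bar>ln u'\<bar>" by linarith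
  qed
  have "integrable ?NN (\<lambda>z. (fst z * snd z) * (p (fst z) * q (snd z)))"
  proof (rule integrable_bounded_mult(1)[OF xy(1)])
    show "\<bar>p (fst z) * q (snd z)\<bar> \<le> u * u'" for z
      using p0[of "fst z"] q0[of "snd z"] lu(3)[of "fst z"] lu'(3)[of "snd z"]
      by (simp add: abs_mult mult_mono)
  qed simp
  then have intTU: "integrable ?NN (\<lambda>z. T (fst z) * U (snd z))"
    using tr_iff[of "\<lambda>z. fst z * snd z"] by simp
  have intf: "integrable ?NN (\<lambda>z. f (S z))"
    using fB by (intro NN.P.integrable_const_bound[where B=B]) auto
  have intlp: "integrable ?N (\<lambda>x. ln (p (T x)))" and intlq: "integrable ?N (\<lambda>x. ln (q (U x)))"
    by (rule N.integrable_const_bound[where B="\<bar>ln l\<bar> + \<bar>ln u\<bar>"], use lnp in auto)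
       (rule N.integrable_const_bound[where B="\<bar>ln l'\<bar> + \<bar>ln u'\<bar>"], use lnq in auto)
  have intlp2: "integrable ?NN (\<lambda>z. ln (p (T (fst z))))" "(\<integral>z. ln (p (T (fst z))) \<partial>?NN) = (\<integral>x. p x * ln (p x) \<partial>?N)"
    using NN.integral_pair_mult[OF intlp, of "\<lambda>_. 1"] trT[of "\<lambda>x. ln (p x)"] using N.prob_space by simp_all
  have intlq2: "integrable ?NN (\<lambda>z. ln (q (U (snd z))))" "(\<integral>z. ln (q (U (snd z))) \<partial>?NN) = (\<integral>x. q x * ln (q x) \<partial>?N)"
    using NN.integral_pair_mult[OF _ intlq, of "\<lambda>_. 1"] trU[of "\<lambda>x. ln (q x)"] using N.prob_space by simp_all
  have intw: "integrable ?NN w"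
    unfolding w_def[abs_def] using xy(1) intTU intf intlp2 intlq2 by auto
  have Ew: "(\<integral>z. w z \<partial>?NN) = (\<integral>z. f (a * fst z + b * snd z) * (p (fst z) * q (snd z)) \<partial>?NN)
     - (\<integral>z. a * b / s\<^sup>2 * (fst z * snd z) * (p (fst z) * q (snd z)) \<partial>?NN)
     - a\<^sup>2 * (\<integral>x. p x * ln (p x) \<partial>?N) - b\<^sup>2 * (\<integral>x. q x * ln (q x) \<partial>?N)"
  proof -
    have "(\<integral>z. w z \<partial>?NN) = (\<integral>z. f (S z) \<partial>?NN) + a * b / s\<^sup>2 * ((\<integral>z. fst z * snd z \<partial>?NN) - (\<integral>z. T (fst z) * U (snd z) \<partial>?NN))
      - a\<^sup>2 * (\<integral>x. p x * ln (p x) \<partial>?N) - b\<^sup>2 * (\<integral>x. q x * ln (q x) \<partial>?N)"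
      unfolding w_def using xy(1) intTU intf intlp2 intlq2 by simp
    also have "(\<integral>z. fst z * snd z \<partial>?NN) = 0" using xy(2) intx0 by simp
    also have "(\<integral>z. f (S z) \<partial>?NN) = (\<integral>z. f (a * fst z + b * snd z) * (p (fst z) * q (snd z)) \<partial>?NN)"
      by (subst tr_int) (auto simp: S_def)
    also have "a * b / s\<^sup>2 * (0 - (\<integral>z. T (fst z) * U (snd z) \<partial>?NN)) = - (\<integral>z. a * b / s\<^sup>2 * (fst z * snd z) * (p (fst z) * q (snd z)) \<partial>?NN)"
      by (subst tr_int) auto
    finally show ?thesis by simp
  qed

  \<comment> \<open>The second factor is the quotient of the Gaussian density at \<open>S\<close> by that at \<open>a * fst z + b * snd z\<close>, and the third
    one is the derivative of \<open>S\<close> in the direction \<open>(a, b)\<close>.\<close>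
  define H where "H z = exp (f (S z)) * exp (((a * fst z + b * snd z)\<^sup>2 - (S z)\<^sup>2) / (2 * s\<^sup>2)) * (a\<^sup>2 * T' (fst z) + b\<^sup>2 * U' (snd z))" for z
  have H0: "0 \<le> H z" for z using T'0 U'0 by (simp add: H_def less_imp_le)
  have [measurable]: "H \<in> borel_measurable (borel \<Otimes>\<^sub>M borel)" unfolding H_def[abs_def] by measurable
  have wH: "exp (w z) \<le> H z" for z
  proof -
    define X where "X = ((T (fst z))\<^sup>2 - (fst z)\<^sup>2) / (2 * s\<^sup>2) - ln (p (T (fst z)))"
    define Y where "Y = ((U (snd z))\<^sup>2 - (snd z)\<^sup>2) / (2 * s\<^sup>2) - ln (q (U (snd z)))"
    have b2: "b\<^sup>2 = 1 - a\<^sup>2" using ab by simp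
    \<comment> \<open>The squares cancel except for the mixed products, so the transport maps need first moments only.\<close>
    have quad: "a * b / s\<^sup>2 * (fst z * snd z - T (fst z) * U (snd z)) =
        ((a * fst z + b * snd z)\<^sup>2 - (S z)\<^sup>2) / (2 * s\<^sup>2) 
        + a\<^sup>2 * (((T (fst z))\<^sup>2 - (fst z)\<^sup>2) / (2 * s\<^sup>2)) + b\<^sup>2 * (((U (snd z))\<^sup>2 - (snd z)\<^sup>2) / (2 * s\<^sup>2))"
      using s by (simp add: S_def field_simps power2_eq_square)
    have "w z = f (S z) + ((a * fst z + b * snd z)\<^sup>2 - (S z)\<^sup>2) / (2 * s\<^sup>2) + (a\<^sup>2 * X + b\<^sup>2 * Y)"
      unfolding w_def quad X_def Y_def by (simp add: algebra_simps)
    then have "exp (w z) = exp (f (S z)) * exp (((a * fst z + b * snd z)\<^sup>2 - (S z)\<^sup>2) / (2 * s\<^sup>2)) * exp (a\<^sup>2 * X + b\<^sup>2 * Y)"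
      by (simp only: exp_add)
    moreover have "exp (a\<^sup>2 * X + b\<^sup>2 * Y) \<le> a\<^sup>2 * T' (fst z) + b\<^sup>2 * U' (snd z)"
    proof -
      have "a\<^sup>2 \<le> 1" using ab zero_le_power2[of b] by linarith
      moreover have "exp X = T' (fst z)" "exp Y = U' (snd z)"
        using p0 q0 by (simp_all add: X_def T'_def Y_def U'_def exp_diff)
      ultimately show ?thesis using exp_weighted_le[of "a\<^sup>2" X Y] by (simp add: b2)
    qed
    ultimately show ?thesis by (simp add: H_def mult_left_mono)
  qed
  have intef: "integrable ?N (\<lambda>x. exp (f x))"
    using fB by (intro N.integrable_const_bound[where B="exp B"]) (auto intro: order_trans[OF abs_ge_self])
  \<comment> \<open>In rotated coordinates, with the second one fixed, \<open>S\<close> is a monotone change of variables.\<close>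
  have inner: "(\<integral>\<^sup>+x. ennreal (H (a * x - b * y, b * x + a * y) * (?\<phi> (a * x - b * y) * ?\<phi> (b * x + a * y))) \<partial>lborel)
      = ennreal (?\<phi> y) * ennreal (\<integral>x. exp (f x) \<partial>?N)" for y
  proof -
    define R where "R x = S (a * x - b * y, b * x + a * y)" for x
    define R' where "R' x = a\<^sup>2 * T' (a * x - b * y) + b\<^sup>2 * U' (b * x + a * y)" for x
    have R': "(R has_real_derivative R' x) (at x)" for x
    proof -
      have 1: "((\<lambda>x. T (a * x - b * y)) has_real_derivative T' (a * x - b * y) * a) (at x)"
        unfolding T'_def by (rule DERIV_chain2[where f=T, OF T(1)]) (auto intro!: derivative_eq_intros)
      have 2: "((\<lambda>x. U (b * x + a * y)) has_real_derivative U' (b * x + a * y) * b) (at x)"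
        unfolding U'_def by (rule DERIV_chain2[where f=U, OF U(1)]) (auto intro!: derivative_eq_intros)
      show ?thesis unfolding R_def[abs_def] S_def R'_def
        using DERIV_add[OF DERIV_cmult[OF 1, of a] DERIV_cmult[OF 2, of b]]
        by (simp add: power2_eq_square mult_ac)
    qed
    have R'0: "0 \<le> R' x" for x using T'0 U'0 by (simp add: R'_def less_imp_le)
    have R'cont: "continuous_on UNIV R'"
      unfolding R'_def by (auto intro!: continuous_intros continuous_on_compose2[OF contT'] continuous_on_compose2[OF contU'])
    have lin1: "filterlim (\<lambda>x. a * x - b * y) at_top at_top" "filterlim (\<lambda>x. b * x + a * y) at_top at_top"
       "filterlim (\<lambda>x. a * x - b * y) at_bot at_bot" "filterlim (\<lambda>x. b * x + a * y) at_bot at_bot"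
      using a b by real_asymp+
    have Rtop: "filterlim R at_top at_top"
      unfolding R_def S_def fst_conv snd_conv
      by (intro filterlim_at_top_add_at_top filterlim_tendsto_pos_mult_at_top[OF tendsto_const] a b
           filterlim_compose[OF T(2)] filterlim_compose[OF U(2)] lin1)
    have Rbot: "filterlim R at_bot at_bot"
    proof -
      have "filterlim (\<lambda>x. a * - T (a * x - b * y) + b * - U (b * x + a * y)) at_top at_bot"
        by (intro filterlim_at_top_add_at_top filterlim_tendsto_pos_mult_at_top[OF tendsto_const] a b
           filterlim_compose[OF filterlim_uminus_at_top_at_bot] filterlim_compose[OF T(3)] filterlim_compose[OF U(3)] lin1)
      then show ?thesis
        by (subst filterlim_uminus_at_bot) (simp add: R_def S_def)
    qed
    have "ennreal (H (a * x - b * y, b * x + a * y) * (?\<phi> (a * x - b * y) * ?\<phi> (b * x + a * y)))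
       = ennreal (?\<phi> y) * (ennreal (exp (f (R x)) * ?\<phi> (R x)) * ennreal (R' x))" for x
    proof -
      have z1: "a * (a * x - b * y) + b * (b * x + a * y) = x"
      proof -
        have "a * (a * x - b * y) + b * (b * x + a * y) = (a\<^sup>2 + b\<^sup>2) * x" by (simp add: algebra_simps power2_eq_square)
        then show ?thesis using ab by simp
      qed
      have "(a * x - b * y)\<^sup>2 + (b * x + a * y)\<^sup>2 = (a\<^sup>2 + b\<^sup>2) * (x\<^sup>2 + y\<^sup>2)"
        by (simp add: algebra_simps power2_eq_square)
      then have sq: "(a * x - b * y)\<^sup>2 + (b * x + a * y)\<^sup>2 = x\<^sup>2 + y\<^sup>2" using ab by simp
      have expsq: "exp (-u\<^sup>2/(2 * s\<^sup>2)) * exp (-v\<^sup>2/(2 * s\<^sup>2)) = exp (- (u\<^sup>2 + v\<^sup>2)/(2 * s\<^sup>2))" for u v :: real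
        by (simp flip: exp_add add: diff_divide_distrib add_divide_distrib)
      have rot: "?\<phi> (a * x - b * y) * ?\<phi> (b * x + a * y) = ?\<phi> x * ?\<phi> y"
      proof -
        have "?\<phi> u * ?\<phi> v = (1 / sqrt (2 * pi * s\<^sup>2))\<^sup>2 * (exp (-u\<^sup>2/(2 * s\<^sup>2)) * exp (-v\<^sup>2/(2 * s\<^sup>2)))" for u v
          by (simp add: normal_density_def power2_eq_square)
        then show ?thesis by (simp only: expsq sq)
      qed
      have *: "?\<phi> (R x) = exp ((x\<^sup>2 - (R x)\<^sup>2) / (2 * s\<^sup>2)) * ?\<phi> x"
        by (rule normal_density_ratio)
      have "H (a * x - b * y, b * x + a * y) = exp (f (R x)) * exp ((x\<^sup>2 - (R x)\<^sup>2) / (2 * s\<^sup>2)) * R' x"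
        by (simp only: H_def R_def[symmetric] R'_def fst_conv snd_conv z1)
      then have "H (a * x - b * y, b * x + a * y) * (?\<phi> (a * x - b * y) * ?\<phi> (b * x + a * y))
         = ?\<phi> y * ((exp (f (R x)) * ?\<phi> (R x)) * R' x)"
        unfolding rot * by (simp only: mult_ac)
      then show ?thesis using R'0[of x] by (simp add: ennreal_mult)
    qed
    then have "(\<integral>\<^sup>+x. ennreal (H (a * x - b * y, b * x + a * y) * (?\<phi> (a * x - b * y) * ?\<phi> (b * x + a * y))) \<partial>lborel)
      = (\<integral>\<^sup>+x. ennreal (?\<phi> y) * (ennreal (exp (f (R x)) * ?\<phi> (R x)) * ennreal (R' x)) \<partial>lborel)"
      by simp
    also have "\<dots> = ennreal (?\<phi> y) * (\<integral>\<^sup>+x. ennreal (exp (f (R x)) * ?\<phi> (R x)) * ennreal (R' x) \<partial>lborel)"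
    proof (rule nn_integral_cmult)
      have [measurable]: "R \<in> borel_measurable borel" "R' \<in> borel_measurable borel"
        unfolding R_def[abs_def] R'_def[abs_def] by measurable
      show "(\<lambda>x. ennreal (exp (f (R x)) * ?\<phi> (R x)) * ennreal (R' x)) \<in> borel_measurable lborel" by measurable
    qed
    also have "(\<integral>\<^sup>+x. ennreal (exp (f (R x)) * ?\<phi> (R x)) * ennreal (R' x) \<partial>lborel) = (\<integral>\<^sup>+x. ennreal (exp (f x) * ?\<phi> x) \<partial>lborel)"
      using R' R'0 R'cont Rtop Rbot by (intro nn_integral_substitution_UNIV) auto
    also have "\<dots> = (\<integral>\<^sup>+x. ennreal (exp (f x)) \<partial>?N)"
      by (simp add: nn_integral_density ennreal_mult mult.commute)
    also have "\<dots> = ennreal (\<integral>x. exp (f x) \<partial>?N)"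
      using intef by (intro nn_integral_eq_integral) auto
    finally show ?thesis .
  qed
  have "(\<integral>\<^sup>+z. ennreal (exp (w z)) \<partial>?NN) \<le> (\<integral>\<^sup>+z. ennreal (H z) \<partial>?NN)"
    using wH by (intro nn_integral_mono) (auto simp: ennreal_leI)
  also have "\<dots> = (\<integral>\<^sup>+x. \<integral>\<^sup>+y. ennreal (H (x, y)) \<partial>?N \<partial>?N)"
    by (simp add: N.nn_integral_fst[symmetric])
  also have "\<dots> = (\<integral>\<^sup>+x. \<integral>\<^sup>+y. ennreal (H (x, y) * (?\<phi> x * ?\<phi> y)) \<partial>lborel \<partial>lborel)"
    using H0 by (simp add: nn_integral_density ennreal_mult mult_ac flip: nn_integral_cmult)
  also have "\<dots> = (\<integral>\<^sup>+x. \<integral>\<^sup>+y. ennreal (H (a * x - b * y, b * x + a * y) * (?\<phi> (a * x - b * y) * ?\<phi> (b * x + a * y))) \<partial>lborel \<partial>lborel)"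
    using nn_integral_rotate[of "\<lambda>z. ennreal (H z * (?\<phi> (fst z) * ?\<phi> (snd z)))" a b] a ab by simp
  also have "\<dots> = (\<integral>\<^sup>+y. \<integral>\<^sup>+x. ennreal (H (a * x - b * y, b * x + a * y) * (?\<phi> (a * x - b * y) * ?\<phi> (b * x + a * y))) \<partial>lborel \<partial>lborel)"
    by (rule lborel_pair.Fubini'[symmetric]) measurable
  also have "\<dots> = (\<integral>\<^sup>+y. ennreal (?\<phi> y) * ennreal (\<integral>x. exp (f x) \<partial>?N) \<partial>lborel)"
    by (simp only: inner)
  also have "\<dots> = (\<integral>\<^sup>+y. ennreal (\<integral>x. exp (f x) \<partial>?N) \<partial>?N)"
    by (subst nn_integral_density) auto
  also have "\<dots> = ennreal (\<integral>x. exp (f x) \<partial>?N)"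
    using N.emeasure_space_1 by simp
  finally have Z: "(\<integral>\<^sup>+z. ennreal (exp (w z)) \<partial>?NN) \<le> ennreal (\<integral>x. exp (f x) \<partial>?N)" .
  have "exp (- B) \<le> (\<integral>x. exp (f x) \<partial>?N)"
    using fB by (intro N.integral_ge_const intef) (auto simp: abs_le_iff minus_le_iff)
  then have "0 < (\<integral>x. exp (f x) \<partial>?N)" using exp_gt_zero[of "- B"] by linarith
  from integral_le_ln_integral_exp[OF NN.P.prob_space_axioms intw Z this]
  have "(\<integral>z. w z \<partial>?NN) \<le> ln (\<integral>x. exp (f x) \<partial>?N)" .
  moreover have "b\<^sup>2 = 1 - a\<^sup>2" using ab by simp
  ultimately show ?thesis
    unfolding dual_bound_def Ew by (simp add: algebra_simps)
qed

section \<open>Approximation of densities\<close>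

text \<open>
  At \<open>x = 0\<close> the value \<open>0 * ln 0 = 0\<close> is the limit from the right, hence the sequence has to be positive.
\<close>

lemma tendsto_x_ln_x:
  fixes X :: "nat \<Rightarrow> real"
  assumes "X \<longlonglongrightarrow> x" "\<And>n. 0 < X n"
  shows "(\<lambda>n. X n * ln (X n)) \<longlonglongrightarrow> x * ln x"
proof (cases "x = 0")
  case True
  have "((\<lambda>x. x * ln x) \<longlongrightarrow> 0) (at_right (0::real))" by real_asymp
  moreover have "filterlim X (at_right 0) sequentially"
    using assms True by (intro tendsto_imp_filterlim_at_right) auto
  ultimately have "(\<lambda>n. X n * ln (X n)) \<longlonglongrightarrow> 0" by (rule filterlim_compose)
  then show ?thesis using True by simp
next
  case False
  then have "0 < x" using LIMSEQ_le_const[OF assms(1), of 0] assms(2) by (force intro: less_imp_le)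
  then show ?thesis using assms(1) by (intro tendsto_intros) auto
qed

lemma normalised_entropy:
  fixes p :: "'a \<Rightarrow> real"
  assumes "integrable \<gamma> p" "integrable \<gamma> (\<lambda>x. p x * ln (p x))" "\<And>x. x \<in> space \<gamma> \<Longrightarrow> 0 < p x" 
    and Z: "0 < (\<integral>x. p x \<partial>\<gamma>)"
  shows "(\<integral>x. (p x / (\<integral>x. p x \<partial>\<gamma>)) * ln (p x / (\<integral>x. p x \<partial>\<gamma>)) \<partial>\<gamma>) =
    (\<integral>x. p x * ln (p x) \<partial>\<gamma>) / (\<integral>x. p x \<partial>\<gamma>) - ln (\<integral>x. p x \<partial>\<gamma>)"
proof -
  let ?Z = "\<integral>x. p x \<partial>\<gamma>"
  have "(\<integral>x. (p x / ?Z) * ln (p x / ?Z) \<partial>\<gamma>) = (\<integral>x. (p x * ln (p x)) / ?Z - p x * (ln ?Z / ?Z) \<partial>\<gamma>)"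
  proof (rule Bochner_Integration.integral_cong)
    fix x assume "x \<in> space \<gamma>"
    then have "ln (p x / ?Z) = ln (p x) - ln ?Z" using assms(3)[of x] Z by (simp add: ln_div)
    then show "(p x / ?Z) * ln (p x / ?Z) = (p x * ln (p x)) / ?Z - p x * (ln ?Z / ?Z)"
      by (simp add: diff_divide_distrib right_diff_distrib)
  qed simp
  also have "\<dots> = (\<integral>x. p x * ln (p x) \<partial>\<gamma>) / ?Z - ?Z * (ln ?Z / ?Z)"
    using assms(1,2) by simp
  finally show ?thesis using Z by simp
qed

text \<open>
  Dominated convergence in every term. Only the normalised approximants are densities: truncating or
  clamping a density changes its mass, which is harmless as the masses tend to \<open>1\<close>. The constant \<open>C\<close>
  gives the common dominating functions.
\<close>

lemma dual_bound_limit: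
  fixes p q f :: "'a \<Rightarrow> real" and P Q :: "nat \<Rightarrow> 'a \<Rightarrow> real"
  assumes "prob_space \<gamma>"
    and m[measurable]: "m \<in> measurable (\<gamma> \<Otimes>\<^sub>M \<gamma>) \<gamma>"
    and f[measurable]: "f \<in> borel_measurable \<gamma>" and fB: "\<And>x. x \<in> space \<gamma> \<Longrightarrow> \<bar>f x\<bar> \<le> B"
    and p: "integrable \<gamma> p" "integrable \<gamma> (\<lambda>x. p x * ln (p x))" "\<And>x. x \<in> space \<gamma> \<Longrightarrow> 0 \<le> p x" "(\<integral>x. p x \<partial>\<gamma>) = 1"
    and q: "integrable \<gamma> q" "integrable \<gamma> (\<lambda>x. q x * ln (q x))" "\<And>x. x \<in> space \<gamma> \<Longrightarrow> 0 \<le> q x" "(\<integral>x. q x \<partial>\<gamma>) = 1"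
    and c: "integrable (\<gamma> \<Otimes>\<^sub>M \<gamma>) (\<lambda>z. c z * ((p (fst z) + C) * (q (snd z) + C)))" and c_meas[measurable]: "c \<in> borel_measurable (\<gamma> \<Otimes>\<^sub>M \<gamma>)"
    and P[measurable]: "\<And>n. P n \<in> borel_measurable \<gamma>" and Q[measurable]: "\<And>n. Q n \<in> borel_measurable \<gamma>"
    and Pl: "\<And>n. 0 < l n" "\<And>n x. x \<in> space \<gamma> \<Longrightarrow> l n \<le> P n x" and Ql: "\<And>n x. x \<in> space \<gamma> \<Longrightarrow> l n \<le> Q n x"
    and PC: "\<And>n x. x \<in> space \<gamma> \<Longrightarrow> P n x \<le> p x + C" "\<And>n x. x \<in> space \<gamma> \<Longrightarrow> \<bar>P n x * ln (P n x)\<bar> \<le> \<bar>p x * ln (p x)\<bar> + C"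
    and QC: "\<And>n x. x \<in> space \<gamma> \<Longrightarrow> Q n x \<le> q x + C" "\<And>n x. x \<in> space \<gamma> \<Longrightarrow> \<bar>Q n x * ln (Q n x)\<bar> \<le> \<bar>q x * ln (q x)\<bar> + C"
    and Plim: "AE x in \<gamma>. (\<lambda>n. P n x) \<longlonglongrightarrow> p x" and Qlim: "AE x in \<gamma>. (\<lambda>n. Q n x) \<longlonglongrightarrow> q x"
    and dual: "\<And>n. dual_bound \<gamma> m c t f (\<lambda>x. P n x / (\<integral>x. P n x \<partial>\<gamma>)) (\<lambda>x. Q n x / (\<integral>x. Q n x \<partial>\<gamma>))"
  shows "dual_bound \<gamma> m c t f p q"
proof -
  interpret N: prob_space \<gamma> by fact
  interpret NN: pair_prob_space \<gamma> \<gamma> ..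
  have [measurable]: "p \<in> borel_measurable \<gamma>" "q \<in> borel_measurable \<gamma>" using p q by auto
  have P0: "0 < P n x" "0 < Q n x" if "x \<in> space \<gamma>" for n x
    using Pl(1)[of n] Pl(2)[OF that, of n] Ql[OF that, of n] by auto

  have single: "(\<lambda>n. \<integral>x. R n x \<partial>\<gamma>) \<longlonglongrightarrow> (\<integral>x. r x \<partial>\<gamma>)" "(\<lambda>n. \<integral>x. R n x * ln (R n x) \<partial>\<gamma>) \<longlonglongrightarrow> (\<integral>x. r x * ln (r x) \<partial>\<gamma>)"
     "\<And>n. integrable \<gamma> (R n)" "\<And>n. integrable \<gamma> (\<lambda>x. R n x * ln (R n x))" "\<And>n. 0 < (\<integral>x. R n x \<partial>\<gamma>)"
    if r: "integrable \<gamma> r" "integrable \<gamma> (\<lambda>x. r x * ln (r x))"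
      and R[measurable]: "\<And>n. R n \<in> borel_measurable \<gamma>" and l: "\<And>n x. x \<in> space \<gamma> \<Longrightarrow> l n \<le> R n x"
      and RC: "\<And>n x. x \<in> space \<gamma> \<Longrightarrow> R n x \<le> r x + C" "\<And>n x. x \<in> space \<gamma> \<Longrightarrow> \<bar>R n x * ln (R n x)\<bar> \<le> \<bar>r x * ln (r x)\<bar> + C"
      and Rlim: "AE x in \<gamma>. (\<lambda>n. R n x) \<longlonglongrightarrow> r x"
    for R :: "nat \<Rightarrow> 'a \<Rightarrow> real" and r
  proof -
    have [measurable]: "r \<in> borel_measurable \<gamma>" using r by auto
    have R0: "0 < R n x" if "x \<in> space \<gamma>" for n x using Pl(1)[of n] l[OF that, of n] by auto
    have b1: "AE x in \<gamma>. norm (R n x) \<le> r x + C" for n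
      using R0 RC(1) by (intro AE_I2) (simp add: less_imp_le)
    have b2: "AE x in \<gamma>. norm (R n x * ln (R n x)) \<le> \<bar>r x * ln (r x)\<bar> + C" for n
      using RC(2) by (intro AE_I2) simp
    have i1: "integrable \<gamma> (\<lambda>x. r x + C)" and i2: "integrable \<gamma> (\<lambda>x. \<bar>r x * ln (r x)\<bar> + C)" using r by auto
    have lim2: "AE x in \<gamma>. (\<lambda>n. R n x * ln (R n x)) \<longlonglongrightarrow> r x * ln (r x)"
      using Rlim AE_space by eventually_elim (auto intro: tendsto_x_ln_x R0)
    show "(\<lambda>n. \<integral>x. R n x \<partial>\<gamma>) \<longlonglongrightarrow> (\<integral>x. r x \<partial>\<gamma>)"
      by (rule integral_dominated_convergence[OF _ _ i1 Rlim b1]) auto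
    show int: "integrable \<gamma> (R n)" for n
      by (rule integrable_dominated_convergence2[OF _ _ i1 Rlim b1]) auto
    show "(\<lambda>n. \<integral>x. R n x * ln (R n x) \<partial>\<gamma>) \<longlonglongrightarrow> (\<integral>x. r x * ln (r x) \<partial>\<gamma>)"
      by (rule integral_dominated_convergence[OF _ _ i2 lim2 b2]) auto
    show "integrable \<gamma> (\<lambda>x. R n x * ln (R n x))" for n
      by (rule integrable_dominated_convergence2[OF _ _ i2 lim2 b2]) auto
    show "0 < (\<integral>x. R n x \<partial>\<gamma>)" for n
      using N.integral_ge_const[OF int[of n], of "l n"] l[of _ n] Pl(1)[of n] by (auto intro: less_le_trans)
  qed
  note sP = single[OF p(1,2) P Pl(2) PC Plim] and sQ = single[OF q(1,2) Q Ql QC Qlim]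

  have limPQ: "AE z in \<gamma> \<Otimes>\<^sub>M \<gamma>. (\<lambda>n. P n (fst z)) \<longlonglongrightarrow> p (fst z) \<and> (\<lambda>n. Q n (snd z)) \<longlonglongrightarrow> q (snd z)"
  proof (rule NN.AE_pair_measure)
    show "AE x in \<gamma>. AE y in \<gamma>. (\<lambda>n. P n (fst (x, y))) \<longlonglongrightarrow> p (fst (x, y)) \<and> (\<lambda>n. Q n (snd (x, y))) \<longlonglongrightarrow> q (snd (x, y))"
      using Plim by eventually_elim (use Qlim in auto)
  qed measurable
  have double: "(\<lambda>n. \<integral>z. F z * (P n (fst z) * Q n (snd z)) \<partial>(\<gamma> \<Otimes>\<^sub>M \<gamma>)) \<longlonglongrightarrow> (\<integral>z. F z * (p (fst z) * q (snd z)) \<partial>(\<gamma> \<Otimes>\<^sub>M \<gamma>))"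
    if F: "integrable (\<gamma> \<Otimes>\<^sub>M \<gamma>) (\<lambda>z. F z * ((p (fst z) + C) * (q (snd z) + C)))" and [measurable]: "F \<in> borel_measurable (\<gamma> \<Otimes>\<^sub>M \<gamma>)"
    for F
  proof (rule integral_dominated_convergence)
    show "integrable (\<gamma> \<Otimes>\<^sub>M \<gamma>) (\<lambda>z. \<bar>F z * ((p (fst z) + C) * (q (snd z) + C))\<bar>)" using F by simp
    show "AE z in \<gamma> \<Otimes>\<^sub>M \<gamma>. (\<lambda>n. F z * (P n (fst z) * Q n (snd z))) \<longlonglongrightarrow> F z * (p (fst z) * q (snd z))"
      using limPQ by eventually_elim (auto intro!: tendsto_intros)
    fix n
    show "AE z in \<gamma> \<Otimes>\<^sub>M \<gamma>. norm (F z * (P n (fst z) * Q n (snd z))) \<le> \<bar>F z * ((p (fst z) + C) * (q (snd z) + C))\<bar>"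
    proof (rule AE_I2)
      fix z assume "z \<in> space (\<gamma> \<Otimes>\<^sub>M \<gamma>)"
      then have z: "fst z \<in> space \<gamma>" "snd z \<in> space \<gamma>" by (auto simp: space_pair_measure)
      have "P n (fst z) * Q n (snd z) \<le> (p (fst z) + C) * (q (snd z) + C)"
        using PC(1)[OF z(1), of n] QC(1)[OF z(2), of n] P0(1)[OF z(1), of n] P0(2)[OF z(2), of n]
        by (intro mult_mono) auto
      moreover have "0 < P n (fst z) * Q n (snd z)" using P0 z by simp
      ultimately have "\<bar>P n (fst z) * Q n (snd z)\<bar> \<le> \<bar>(p (fst z) + C) * (q (snd z) + C)\<bar>" by linarith
      then show "norm (F z * (P n (fst z) * Q n (snd z))) \<le> \<bar>F z * ((p (fst z) + C) * (q (snd z) + C))\<bar>"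
        unfolding real_norm_def abs_mult[of "F z"] by (rule mult_left_mono) simp
    qed
  qed measurable
  have intf: "integrable (\<gamma> \<Otimes>\<^sub>M \<gamma>) (\<lambda>z. f (m z) * ((p (fst z) + C) * (q (snd z) + C)))"
  proof (rule integrable_bounded_mult(2))
    show "integrable (\<gamma> \<Otimes>\<^sub>M \<gamma>) (\<lambda>z. (p (fst z) + C) * (q (snd z) + C))"
      using p q NN.integral_pair_mult(1)[of "\<lambda>x. p x + C" "\<lambda>x. q x + C"] by simp
    show "\<bar>f (m z)\<bar> \<le> B" if "z \<in> space (\<gamma> \<Otimes>\<^sub>M \<gamma>)" for z
      using fB measurable_space[OF m that] by simp
  qed measurable
  let ?ZP = "\<lambda>n. \<integral>x. P n x \<partial>\<gamma>" and ?ZQ = "\<lambda>n. \<integral>x. Q n x \<partial>\<gamma>"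
  have ZP: "?ZP \<longlonglongrightarrow> 1" and ZQ: "?ZQ \<longlonglongrightarrow> 1" using sP(1) sQ(1) p q by simp_all
  have scale: "(\<integral>z. F z * (P n (fst z) / ?ZP n * (Q n (snd z) / ?ZQ n)) \<partial>(\<gamma> \<Otimes>\<^sub>M \<gamma>))
    = (\<integral>z. F z * (P n (fst z) * Q n (snd z)) \<partial>(\<gamma> \<Otimes>\<^sub>M \<gamma>)) / (?ZP n * ?ZQ n)" for F n
    by (simp flip: integral_divide_zero)
  have "(\<lambda>n. \<integral>z. f (m z) * (P n (fst z) / ?ZP n * (Q n (snd z) / ?ZQ n)) \<partial>(\<gamma> \<Otimes>\<^sub>M \<gamma>)) \<longlonglongrightarrow>
     (\<integral>z. f (m z) * (p (fst z) * q (snd z)) \<partial>(\<gamma> \<Otimes>\<^sub>M \<gamma>)) / (1 * 1)"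
    unfolding scale by (intro tendsto_intros double intf ZP ZQ) auto
  moreover have "(\<lambda>n. \<integral>z. c z * (P n (fst z) / ?ZP n * (Q n (snd z) / ?ZQ n)) \<partial>(\<gamma> \<Otimes>\<^sub>M \<gamma>)) \<longlonglongrightarrow>
     (\<integral>z. c z * (p (fst z) * q (snd z)) \<partial>(\<gamma> \<Otimes>\<^sub>M \<gamma>)) / (1 * 1)"
    unfolding scale by (intro tendsto_intros double c ZP ZQ) auto
  moreover have "(\<lambda>n. \<integral>x. (P n x / ?ZP n) * ln (P n x / ?ZP n) \<partial>\<gamma>) \<longlonglongrightarrow> (\<integral>x. p x * ln (p x) \<partial>\<gamma>) / 1 - ln 1"
    by (subst normalised_entropy[OF sP(3,4) P0(1) sP(5)], assumption, assumption)
       (intro tendsto_intros sP(2) ZP, simp_all)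
  moreover have "(\<lambda>n. \<integral>x. (Q n x / ?ZQ n) * ln (Q n x / ?ZQ n) \<partial>\<gamma>) \<longlonglongrightarrow> (\<integral>x. q x * ln (q x) \<partial>\<gamma>) / 1 - ln 1"
    by (subst normalised_entropy[OF sQ(3,4) P0(2) sQ(5)], assumption, assumption)
       (intro tendsto_intros sQ(2) ZQ, simp_all)
  ultimately show ?thesis
    unfolding dual_bound_def
    by (intro LIMSEQ_le[OF _ tendsto_add[OF tendsto_add[OF tendsto_add[OF tendsto_const tendsto_mult[OF tendsto_const]] tendsto_mult[OF tendsto_const]]]])
       (use dual in \<open>auto simp: dual_bound_def\<close>)
qed

text \<open>
  The dual inequality on a class of densities and test functions that is closed under conditioning on a
  coordinate, as the induction on the dimension requires.
\<close>

definition entropy_stable :: "'a measure \<Rightarrow> ('a \<times> 'a \<Rightarrow> 'a) \<Rightarrow> ('a \<times> 'a \<Rightarrow> real) \<Rightarrow> real \<Rightarrow> bool" where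
  "entropy_stable \<gamma> m c t \<longleftrightarrow> (\<forall>f p q. f \<in> borel_measurable \<gamma> \<longrightarrow> (\<exists>B. \<forall>x\<in>space \<gamma>. \<bar>f x\<bar> \<le> B) \<longrightarrow>
     bounded_density \<gamma> p \<longrightarrow> bounded_density \<gamma> q \<longrightarrow> dual_bound \<gamma> m c t f p q)"

text \<open>
  A measurable density is an almost everywhere limit of continuous functions, and clamping these to the
  bounds of the density does not destroy the convergence.
\<close>

lemma gaussian_entropy_stable:
  assumes s: "0 < s" and a: "0 < a" and b: "0 < b" and ab: "a\<^sup>2 + b\<^sup>2 = 1"
  shows "entropy_stable (normal_law s) (\<lambda>z. a * fst z + b * snd z) (\<lambda>z. a * b / s\<^sup>2 * (fst z * snd z)) (a\<^sup>2)"
  unfolding entropy_stable_def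
proof (intro allI impI)
  let ?N = "normal_law s"
  fix f p q :: "real \<Rightarrow> real"
  assume "f \<in> borel_measurable ?N" "\<exists>B. \<forall>x\<in>space ?N. \<bar>f x\<bar> \<le> B"
    and pq: "bounded_density ?N p" "bounded_density ?N q"
  then obtain B where [measurable]: "f \<in> borel_measurable borel" and B: "\<And>x. \<bar>f x\<bar> \<le> B" by auto
  interpret N: prob_space ?N using s by (rule prob_space_normal_density)
  interpret NN: pair_prob_space ?N ?N ..
  have [measurable]: "p \<in> borel_measurable borel" "q \<in> borel_measurable borel"
    using pq by (auto simp: bounded_density_def)
  obtain l u where lu: "0 < l" "\<And>x. l \<le> p x" "\<And>x. p x \<le> u" "\<And>x. l \<le> q x" "\<And>x. q x \<le> u"
  proof -
    obtain l1 u1 where 1: "0 < l1" "\<And>x. l1 \<le> p x" "\<And>x. p x \<le> u1"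
      using pq(1) by (auto simp: bounded_density_def)
    obtain l2 u2 where 2: "0 < l2" "\<And>x. l2 \<le> q x" "\<And>x. q x \<le> u2"
      using pq(2) by (auto simp: bounded_density_def)
    show thesis using 1 2 by (intro that[of "min l1 l2" "max u1 u2"]) (auto simp: min_le_iff_disj le_max_iff_disj)
  qed
  have lu0: "l \<le> u" using lu(2,3)[of 0] by linarith
  define C where "C = u + u * (\<bar>ln l\<bar> + \<bar>ln u\<bar>)"
  have xlnx: "\<bar>x * ln x\<bar> \<le> C" "x \<le> C" if "l \<le> x" "x \<le> u" for x
  proof -
    have "ln l \<le> ln x" "ln x \<le> ln u" using that lu(1) by auto
    then have "\<bar>ln x\<bar> \<le> \<bar>ln l\<bar> + \<bar>ln u\<bar>" by linarith
    then have "\<bar>x\<bar> * \<bar>ln x\<bar> \<le> u * (\<bar>ln l\<bar> + \<bar>ln u\<bar>)" using that lu(1) by (intro mult_mono) auto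
    moreover have "0 \<le> u * (\<bar>ln l\<bar> + \<bar>ln u\<bar>)" using lu0 lu(1) by (intro mult_nonneg_nonneg) auto
    ultimately show "\<bar>x * ln x\<bar> \<le> C" "x \<le> C"
      using that lu(1) lu0 unfolding C_def abs_mult by linarith+
  qed
  have C0: "0 \<le> C" using xlnx(2)[of l] lu(1) lu0 by linarith
  have approx: "\<exists>g. (\<forall>n. continuous_on UNIV (g n) \<and> (\<forall>x. l \<le> g n x \<and> g n x \<le> u)) \<and> (AE x in ?N. (\<lambda>n. g n x) \<longlonglongrightarrow> r x)"
    if [measurable]: "r \<in> borel_measurable borel" and r: "\<And>x. l \<le> r x" "\<And>x. r x \<le> u" for r :: "real \<Rightarrow> real"
  proof -
    have "r measurable_on UNIV"
      by (rule lebesgue_measurable_imp_measurable_on) (auto intro: measurable_completion)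
    then obtain A g where A: "negligible A" and g: "\<And>n. continuous_on UNIV (g n)" and lim: "\<And>x. x \<notin> A \<Longrightarrow> (\<lambda>n. g n x) \<longlonglongrightarrow> r x"
      unfolding measurable_on_def by auto
    have "AE x in lebesgue. x \<notin> A" using A by (intro AE_not_in) (simp add: negligible_iff_null_sets)
    then have "AE x in lborel. x \<notin> A" by (simp add: AE_completion_iff)
    then have "AE x in ?N. x \<notin> A" by (auto simp: AE_density elim: eventually_mono)
    then have "AE x in ?N. (\<lambda>n. max l (min u (g n x))) \<longlonglongrightarrow> r x"
    proof eventually_elim
      fix x assume "x \<notin> A"
      then have "(\<lambda>n. max l (min u (g n x))) \<longlonglongrightarrow> max l (min u (r x))" by (intro tendsto_intros lim)
      then show "(\<lambda>n. max l (min u (g n x))) \<longlonglongrightarrow> r x" using r[of x] by simp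
    qed
    moreover have "continuous_on UNIV (\<lambda>x. max l (min u (g n x)))" for n
      using g by (intro continuous_intros) auto
    ultimately show ?thesis using lu0 by (intro exI[of _ "\<lambda>n x. max l (min u (g n x))"]) auto
  qed
  obtain P where "(\<forall>n. continuous_on UNIV (P n) \<and> (\<forall>x. l \<le> P n x \<and> P n x \<le> u)) \<and> (AE x in ?N. (\<lambda>n. P n x) \<longlonglongrightarrow> p x)"
    using approx[of p, OF _ lu(2,3)] by auto
  then have P: "\<And>n. continuous_on UNIV (P n)" "\<And>n x. l \<le> P n x" "\<And>n x. P n x \<le> u" "AE x in ?N. (\<lambda>n. P n x) \<longlonglongrightarrow> p x"
    by auto
  obtain Q where "(\<forall>n. continuous_on UNIV (Q n) \<and> (\<forall>x. l \<le> Q n x \<and> Q n x \<le> u)) \<and> (AE x in ?N. (\<lambda>n. Q n x) \<longlonglongrightarrow> q x)"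
    using approx[of q, OF _ lu(4,5)] by auto
  then have Q: "\<And>n. continuous_on UNIV (Q n)" "\<And>n x. l \<le> Q n x" "\<And>n x. Q n x \<le> u" "AE x in ?N. (\<lambda>n. Q n x) \<longlonglongrightarrow> q x"
    by auto
  have [measurable]: "P n \<in> borel_measurable borel" "Q n \<in> borel_measurable borel" for n
    using P(1) Q(1) by (auto intro: borel_measurable_continuous_onI)
  have normalised: "bounded_density ?N (\<lambda>x. R x / (\<integral>x. R x \<partial>?N))" "continuous_on UNIV (\<lambda>x. R x / (\<integral>x. R x \<partial>?N))"
    if "R \<in> borel_measurable borel" and R: "continuous_on UNIV R" "\<And>x. l \<le> R x" "\<And>x. R x \<le> u" for R
  proof -
    note * = N.bounded_density_normalise[of R l u]
    show "bounded_density ?N (\<lambda>x. R x / (\<integral>x. R x \<partial>?N))"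
      using that lu(1) by (intro *(2)) auto
    show "continuous_on UNIV (\<lambda>x. R x / (\<integral>x. R x \<partial>?N))"
      using that lu(1) *(1) by (intro continuous_intros) auto
  qed
  have absp: "\<bar>p x\<bar> \<le> u" "\<bar>q x\<bar> \<le> u" for x using lu(1) lu(2-5)[of x] by auto
  show "dual_bound ?N (\<lambda>z. a * fst z + b * snd z) (\<lambda>z. a * b / s\<^sup>2 * (fst z * snd z)) (a\<^sup>2) f p q"
  proof (rule dual_bound_limit[where P=P and Q=Q and l="\<lambda>_. l" and C=C and B=B])
    have "integrable ?N (\<lambda>x. x)" using integrable_normal_moment_nz_1[of s 0] s by (simp add: integrable_density)
    note xy = NN.integral_pair_mult(1)[OF this this]
    have "integrable (?N \<Otimes>\<^sub>M ?N) (\<lambda>z. (a * b / s\<^sup>2 * (fst z * snd z)) * ((p (fst z) + C) * (q (snd z) + C)))"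
    proof (rule integrable_bounded_mult(1))
      show "\<bar>(p (fst z) + C) * (q (snd z) + C)\<bar> \<le> (u + C) * (u + C)" for z
        using absp[of "fst z"] absp[of "snd z"] C0 unfolding abs_mult by (intro mult_mono) auto
    qed (use xy in auto)
    then show "integrable (?N \<Otimes>\<^sub>M ?N) (\<lambda>z. (a * b / s\<^sup>2 * (fst z * snd z)) * ((p (fst z) + C) * (q (snd z) + C)))" .
    show "P n x \<le> p x + C" "Q n x \<le> q x + C" for n x
      using xlnx(2)[OF P(2,3)[of n x]] xlnx(2)[OF Q(2,3)[of n x]] lu(1) lu(2,4)[of x] by auto
    show "\<bar>P n x * ln (P n x)\<bar> \<le> \<bar>p x * ln (p x)\<bar> + C" "\<bar>Q n x * ln (Q n x)\<bar> \<le> \<bar>q x * ln (q x)\<bar> + C" for n x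
      using xlnx(1)[OF P(2,3)[of n x]] xlnx(1)[OF Q(2,3)[of n x]] by auto
    show "dual_bound ?N (\<lambda>z. a * fst z + b * snd z) (\<lambda>z. a * b / s\<^sup>2 * (fst z * snd z)) (a\<^sup>2) f 
       (\<lambda>x. P n x / (\<integral>x. P n x \<partial>?N)) (\<lambda>x. Q n x / (\<integral>x. Q n x \<partial>?N))" for n
      using P Q B by (intro gaussian_dual_bound_continuous s a b ab normalised) auto
    show "integrable ?N p" "integrable ?N q" using absp by (auto intro!: N.integrable_const_bound[where B=u])
    show "integrable ?N (\<lambda>x. p x * ln (p x))" "integrable ?N (\<lambda>x. q x * ln (q x))"
      using xlnx(1) lu by (auto intro!: N.integrable_const_bound[where B=C])
    show "(\<integral>x. p x \<partial>?N) = 1" "(\<integral>x. q x \<partial>?N) = 1" using pq by (auto simp: bounded_density_def)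
    show "0 \<le> p x" "0 \<le> q x" for x using lu(1) lu(2,4)[of x] by auto
  qed (use P Q B lu(1) N.prob_space_axioms in auto)
qed

text \<open>
  Densities and test functions are pulled back along \<open>\<Psi>\<close>, which preserves all integrals involved. This
  moves the inequality to other representations of the same space.
\<close>

lemma entropy_stable_distr:
  assumes "prob_space \<gamma>" and \<Psi>[measurable]: "\<Psi> \<in> measurable \<gamma> \<gamma>'" and img: "distr \<gamma> \<gamma>' \<Psi> = \<gamma>'"
    and m[measurable]: "m \<in> measurable (\<gamma> \<Otimes>\<^sub>M \<gamma>) \<gamma>" and m'[measurable]: "m' \<in> measurable (\<gamma>' \<Otimes>\<^sub>M \<gamma>') \<gamma>'"
    and c'[measurable]: "c' \<in> borel_measurable (\<gamma>' \<Otimes>\<^sub>M \<gamma>')"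
    and hom: "\<And>z. z \<in> space (\<gamma> \<Otimes>\<^sub>M \<gamma>) \<Longrightarrow> m' (\<Psi> (fst z), \<Psi> (snd z)) = \<Psi> (m z)"
      "\<And>z. z \<in> space (\<gamma> \<Otimes>\<^sub>M \<gamma>) \<Longrightarrow> c' (\<Psi> (fst z), \<Psi> (snd z)) = c z"
    and st: "entropy_stable \<gamma> m c t"
  shows "entropy_stable \<gamma>' m' c' t"
  unfolding entropy_stable_def
proof (intro allI impI)
  interpret N: prob_space \<gamma> by fact
  have "prob_space (distr \<gamma> \<gamma>' \<Psi>)" by (rule N.prob_space_distr) measurable
  then interpret N': prob_space \<gamma>' by (simp only: img)
  fix f p q :: "'b \<Rightarrow> real"
  assume f[measurable]: "f \<in> borel_measurable \<gamma>'" and fB: "\<exists>B. \<forall>x\<in>space \<gamma>'. \<bar>f x\<bar> \<le> B"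
    and pq: "bounded_density \<gamma>' p" "bounded_density \<gamma>' q"
  have [measurable]: "p \<in> borel_measurable \<gamma>'" "q \<in> borel_measurable \<gamma>'" using pq by (auto simp: bounded_density_def)
  have hom_pair: "m' (\<Psi> a, \<Psi> b) = \<Psi> (m (a, b))" "c' (\<Psi> a, \<Psi> b) = c (a, b)"
    if "(a, b) \<in> space (\<gamma> \<Otimes>\<^sub>M \<gamma>)" for a b
    using hom[OF that] by simp_all
  have sp: "\<Psi> x \<in> space \<gamma>'" if "x \<in> space \<gamma>" for x using measurable_space[OF \<Psi> that] .
  have pull: "(\<integral>x. g (\<Psi> x) \<partial>\<gamma>) = (\<integral>x. g x \<partial>\<gamma>')" if [measurable]: "g \<in> borel_measurable \<gamma>'" for g :: "'b \<Rightarrow> real"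
    using integral_distr[OF \<Psi> that] by (simp add: img)
  have img2: "distr (\<gamma> \<Otimes>\<^sub>M \<gamma>) (\<gamma>' \<Otimes>\<^sub>M \<gamma>') (\<lambda>(x, y). (\<Psi> x, \<Psi> y)) = \<gamma>' \<Otimes>\<^sub>M \<gamma>'"
    using pair_measure_distr[OF \<Psi> \<Psi>] by (simp add: img N'.sigma_finite_measure_axioms)
  have pull2: "(\<integral>z. g (\<Psi> (fst z), \<Psi> (snd z)) \<partial>(\<gamma> \<Otimes>\<^sub>M \<gamma>)) = (\<integral>z. g z \<partial>(\<gamma>' \<Otimes>\<^sub>M \<gamma>'))"
    if [measurable]: "g \<in> borel_measurable (\<gamma>' \<Otimes>\<^sub>M \<gamma>')" for g :: "'b \<times> 'b \<Rightarrow> real"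
    using integral_distr[of "\<lambda>(x, y). (\<Psi> x, \<Psi> y)" "\<gamma> \<Otimes>\<^sub>M \<gamma>" "\<gamma>' \<Otimes>\<^sub>M \<gamma>'" g] unfolding img2 by (simp add: case_prod_beta)
  have bd: "bounded_density \<gamma> (\<lambda>x. r (\<Psi> x))" if r: "bounded_density \<gamma>' r" for r
  proof -
    have [measurable]: "r \<in> borel_measurable \<gamma>'" using r by (simp add: bounded_density_def)
    show ?thesis using r sp pull[of r] unfolding bounded_density_def by (auto; blast)
  qed
  have "dual_bound \<gamma> m c t (\<lambda>x. f (\<Psi> x)) (\<lambda>x. p (\<Psi> x)) (\<lambda>x. q (\<Psi> x))"
  proof -
    have "\<exists>B. \<forall>x\<in>space \<gamma>. \<bar>f (\<Psi> x)\<bar> \<le> B" using fB sp by blast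
    moreover have "(\<lambda>x. f (\<Psi> x)) \<in> borel_measurable \<gamma>" by measurable
    ultimately show ?thesis using st bd[OF pq(1)] bd[OF pq(2)] unfolding entropy_stable_def by blast
  qed
  moreover have "(\<integral>z. f (\<Psi> (m z)) * (p (\<Psi> (fst z)) * q (\<Psi> (snd z))) \<partial>(\<gamma> \<Otimes>\<^sub>M \<gamma>)) = (\<integral>z. f (m' z) * (p (fst z) * q (snd z)) \<partial>(\<gamma>' \<Otimes>\<^sub>M \<gamma>'))"
    by (subst pull2[symmetric]) (auto simp: hom_pair intro!: Bochner_Integration.integral_cong)
  moreover have "(\<integral>z. c z * (p (\<Psi> (fst z)) * q (\<Psi> (snd z))) \<partial>(\<gamma> \<Otimes>\<^sub>M \<gamma>)) = (\<integral>z. c' z * (p (fst z) * q (snd z)) \<partial>(\<gamma>' \<Otimes>\<^sub>M \<gamma>'))"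
    by (subst pull2[symmetric]) (auto simp: hom_pair intro!: Bochner_Integration.integral_cong)
  ultimately show "dual_bound \<gamma>' m' c' t f p q"
    unfolding dual_bound_def using pull[of "\<lambda>x. exp (f x)"] pull[of "\<lambda>x. p x * ln (p x)"] pull[of "\<lambda>x. q x * ln (q x)"] by simp
qed

section \<open>Tensorisation\<close>

text \<open>
  Two points of a product space amount to a pair of first coordinates and a pair of second coordinates.
\<close>

lemma distr_pair_interchange:
  assumes "prob_space A" "prob_space B"
  shows "distr ((A \<Otimes>\<^sub>M A) \<Otimes>\<^sub>M (B \<Otimes>\<^sub>M B)) ((A \<Otimes>\<^sub>M B) \<Otimes>\<^sub>M (A \<Otimes>\<^sub>M B))
     (\<lambda>z. ((fst (fst z), fst (snd z)), (snd (fst z), snd (snd z)))) = (A \<Otimes>\<^sub>M B) \<Otimes>\<^sub>M (A \<Otimes>\<^sub>M B)"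
    (is "distr ?S ?T ?\<sigma> = ?T")
proof (rule measure_eqI)
  interpret A: prob_space A by fact
  interpret B: prob_space B by fact
  interpret AA: pair_prob_space A A ..
  interpret BB: pair_prob_space B B ..
  interpret AB: pair_prob_space A B ..
  interpret ABAB: pair_prob_space "A \<Otimes>\<^sub>M B" "A \<Otimes>\<^sub>M B" ..
  fix X assume "X \<in> sets (distr ?S ?T ?\<sigma>)"
  then have [measurable]: "X \<in> sets ?T" by simp
  have [measurable]: "?\<sigma> \<in> measurable ?S ?T" by measurable
  have "(\<integral>\<^sup>+z. indicator X z \<partial>distr ?S ?T ?\<sigma>) = (\<integral>\<^sup>+z. indicator X (?\<sigma> z) \<partial>?S)"
    by (rule nn_integral_distr) measurable
  then have "emeasure (distr ?S ?T ?\<sigma>) X = (\<integral>\<^sup>+z. indicator X (?\<sigma> z) \<partial>?S)" by simp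
  also have "\<dots> = (\<integral>\<^sup>+x. \<integral>\<^sup>+y. \<integral>\<^sup>+x'. \<integral>\<^sup>+y'. indicator X ((x, x'), (y, y')) \<partial>B \<partial>B \<partial>A \<partial>A)"
    by (simp add: BB.nn_integral_fst[symmetric] A.nn_integral_fst[symmetric] B.nn_integral_fst[symmetric] cong: nn_integral_cong_simp)
  also have "\<dots> = (\<integral>\<^sup>+x. \<integral>\<^sup>+x'. \<integral>\<^sup>+y. \<integral>\<^sup>+y'. indicator X ((x, x'), (y, y')) \<partial>B \<partial>A \<partial>B \<partial>A)"
  proof (rule nn_integral_cong)
    fix x assume [measurable]: "x \<in> space A"
    show "(\<integral>\<^sup>+y. \<integral>\<^sup>+x'. \<integral>\<^sup>+y'. indicator X ((x, x'), (y, y')) \<partial>B \<partial>B \<partial>A) = (\<integral>\<^sup>+x'. \<integral>\<^sup>+y. \<integral>\<^sup>+y'. indicator X ((x, x'), (y, y')) \<partial>B \<partial>A \<partial>B)"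
      by (rule AB.Fubini'[symmetric]) measurable
  qed
  also have "\<dots> = (\<integral>\<^sup>+z. indicator X z \<partial>?T)"
    by (simp add: AB.nn_integral_fst[symmetric] A.nn_integral_fst[symmetric] B.nn_integral_fst[symmetric] del: nn_integral_indicator cong: nn_integral_cong_simp)
  finally show "emeasure (distr ?S ?T ?\<sigma>) X = emeasure ?T X" by simp
qed simp

text \<open>
  Integrating a coordinate out turns a bounded test function \<open>f\<close> into \<open>ln (\<integral> exp f)\<close>, which has the same bound
  and is therefore admissible again.
\<close>

lemma (in prob_space) ln_integral_exp_bounded:
  fixes f :: "'a \<Rightarrow> real"
  assumes [measurable]: "f \<in> borel_measurable M" and B: "\<And>x. x \<in> space M \<Longrightarrow> \<bar>f x\<bar> \<le> B"
  shows "integrable M (\<lambda>x. exp (f x))" "\<bar>ln (\<integral>x. exp (f x) \<partial>M)\<bar> \<le> B" "0 < (\<integral>x. exp (f x) \<partial>M)"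
proof -
  have b: "exp (- B) \<le> exp (f x) \<and> exp (f x) \<le> exp B" if "x \<in> space M" for x
    using B[OF that] by auto
  show int: "integrable M (\<lambda>x. exp (f x))"
    using b by (intro integrable_const_bound[where B="exp B"] AE_I2) auto
  have 1: "exp (- B) \<le> (\<integral>x. exp (f x) \<partial>M)" using b by (intro integral_ge_const int AE_I2) auto
  have 2: "(\<integral>x. exp (f x) \<partial>M) \<le> exp B" using b by (intro integral_le_const int AE_I2) auto
  show 3: "0 < (\<integral>x. exp (f x) \<partial>M)" using 1 exp_gt_zero[of "- B"] by linarith
  have "- B \<le> ln (\<integral>x. exp (f x) \<partial>M)" using 1 3 by (simp add: ln_ge_iff)
  moreover have "ln (\<integral>x. exp (f x) \<partial>M) \<le> B" using 2 3 by (metis exp_le_cancel_iff exp_ln)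
  ultimately show "\<bar>ln (\<integral>x. exp (f x) \<partial>M)\<bar> \<le> B" by simp
qed

text \<open>
  The marginal density of the first coordinate and the conditional densities of the second one. The last
  conclusion is the chain rule: the mean entropy of the conditional laws is the joint entropy minus the
  marginal one.
\<close>

lemma bounded_density_disintegrate:
  fixes p :: "'a \<times> 'b \<Rightarrow> real"
  assumes "prob_space A" "prob_space B" and p: "bounded_density (A \<Otimes>\<^sub>M B) p"
  defines "p1 \<equiv> \<lambda>x. \<integral>y. p (x, y) \<partial>B"
  shows "bounded_density A p1"
    and "\<And>x. x \<in> space A \<Longrightarrow> 0 < p1 x"
    and "\<And>x. x \<in> space A \<Longrightarrow> bounded_density B (\<lambda>y. p (x, y) / p1 x)"
    and "\<And>x. x \<in> space A \<Longrightarrow> integrable B (\<lambda>y. p (x, y))"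
    and "integrable A (\<lambda>x. p1 x * (\<integral>y. (p (x, y) / p1 x) * ln (p (x, y) / p1 x) \<partial>B))" 
    and "(\<integral>x. p1 x * (\<integral>y. (p (x, y) / p1 x) * ln (p (x, y) / p1 x) \<partial>B) \<partial>A)
         = (\<integral>z. p z * ln (p z) \<partial>(A \<Otimes>\<^sub>M B)) - (\<integral>x. p1 x * ln (p1 x) \<partial>A)"
proof -
  interpret A: prob_space A by fact
  interpret B: prob_space B by fact
  interpret AB: pair_prob_space A B ..
  obtain l u where l: "0 < l" and lu: "\<And>z. z \<in> space (A \<Otimes>\<^sub>M B) \<Longrightarrow> l \<le> p z" "\<And>z. z \<in> space (A \<Otimes>\<^sub>M B) \<Longrightarrow> p z \<le> u"
    and [measurable]: "p \<in> borel_measurable (A \<Otimes>\<^sub>M B)" and one: "(\<integral>z. p z \<partial>(A \<Otimes>\<^sub>M B)) = 1"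
    using p by (auto simp: bounded_density_def)
  have sp: "(x, y) \<in> space (A \<Otimes>\<^sub>M B)" if "x \<in> space A" "y \<in> space B" for x y
    using that by (simp add: space_pair_measure)
  obtain z0 where "z0 \<in> space (A \<Otimes>\<^sub>M B)" using AB.P.not_empty by auto
  then have lu0: "l \<le> u" using lu[of z0] by linarith
  have lnb: "\<bar>ln r\<bar> \<le> \<bar>ln l\<bar> + \<bar>ln u\<bar>" "\<bar>r * ln r\<bar> \<le> u * (\<bar>ln l\<bar> + \<bar>ln u\<bar>)" if "l \<le> r" "r \<le> u" for r
  proof -
    have "ln l \<le> ln r" "ln r \<le> ln u" using that l by auto
    then show "\<bar>ln r\<bar> \<le> \<bar>ln l\<bar> + \<bar>ln u\<bar>" by linarith
    then show "\<bar>r * ln r\<bar> \<le> u * (\<bar>ln l\<bar> + \<bar>ln u\<bar>)" using that l unfolding abs_mult by (intro mult_mono) auto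
  qed
  have ip: "integrable (A \<Otimes>\<^sub>M B) p"
  proof (rule AB.P.integrable_const_bound[where B=u])
    have "norm (p z) \<le> u" if "z \<in> space (A \<Otimes>\<^sub>M B)" for z using lu[OF that] l by simp
    then show "AE z in A \<Otimes>\<^sub>M B. norm (p z) \<le> u" by (rule AE_I2)
  qed simp
  have ipl: "integrable (A \<Otimes>\<^sub>M B) (\<lambda>z. p z * ln (p z))"
    using lnb lu by (intro AB.P.integrable_const_bound[where B="u * (\<bar>ln l\<bar> + \<bar>ln u\<bar>)"] AE_I2) auto
  have ipx: "integrable B (\<lambda>y. p (x, y))" and iplx: "integrable B (\<lambda>y. p (x, y) * ln (p (x, y)))" if "x \<in> space A" for x
  proof -
    note [measurable] = that
    show "integrable B (\<lambda>y. p (x, y))"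
    proof (rule B.integrable_const_bound[where B=u])
      have "norm (p (x, y)) \<le> u" if "y \<in> space B" for y using lu[OF sp[OF \<open>x \<in> space A\<close> that]] l by simp
      then show "AE y in B. norm (p (x, y)) \<le> u" by (rule AE_I2)
    qed measurable
    show "integrable B (\<lambda>y. p (x, y) * ln (p (x, y)))"
    proof (rule B.integrable_const_bound[where B="u * (\<bar>ln l\<bar> + \<bar>ln u\<bar>)"])
      have "norm (p (x, y) * ln (p (x, y))) \<le> u * (\<bar>ln l\<bar> + \<bar>ln u\<bar>)" if "y \<in> space B" for y
        using lnb(2)[OF lu[OF sp[OF \<open>x \<in> space A\<close> that]]] by simp
      then show "AE y in B. norm (p (x, y) * ln (p (x, y))) \<le> u * (\<bar>ln l\<bar> + \<bar>ln u\<bar>)" by (rule AE_I2)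
    qed measurable
  qed
  have p1: "l \<le> p1 x" "p1 x \<le> u" if "x \<in> space A" for x
    unfolding p1_def using lu sp that
    by (auto intro!: B.integral_ge_const B.integral_le_const ipx AE_I2)
  show p1pos: "0 < p1 x" if "x \<in> space A" for x using p1(1)[OF that] l by linarith
  have [measurable]: "p1 \<in> borel_measurable A" unfolding p1_def by measurable
  have "(\<integral>x. p1 x \<partial>A) = 1" unfolding p1_def using AB.integral_fst'[OF ip] one by simp
  then show "bounded_density A p1" using p1 l by (auto simp: bounded_density_def)
  show "bounded_density B (\<lambda>y. p (x, y) / p1 x)" if x: "x \<in> space A" for x
    unfolding bounded_density_def
  proof (intro conjI exI ballI)
    note [measurable] = x
    show "(\<lambda>y. p (x, y) / p1 x) \<in> borel_measurable B" by measurable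
    show "0 < l / p1 x" using l p1pos[OF x] by simp
    show "l / p1 x \<le> p (x, y) / p1 x" "p (x, y) / p1 x \<le> u / p1 x" if "y \<in> space B" for y
      using p1pos[OF x] lu sp[OF x that] by (auto intro!: divide_right_mono)
    show "(\<integral>y. p (x, y) / p1 x \<partial>B) = 1" using p1pos[OF x] by (simp add: p1_def)
  qed
  have ip1: "integrable A (\<lambda>x. p1 x * ln (p1 x))"
    using lnb p1 by (intro A.integrable_const_bound[where B="u * (\<bar>ln l\<bar> + \<bar>ln u\<bar>)"] AE_I2) auto
  have eq: "p1 x * (\<integral>y. (p (x, y) / p1 x) * ln (p (x, y) / p1 x) \<partial>B) = (\<integral>y. p (x, y) * ln (p (x, y)) \<partial>B) - p1 x * ln (p1 x)"
    if x: "x \<in> space A" for x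
  proof -
    have pos: "0 < p (x, y)" if "y \<in> space B" for y using lu(1)[OF sp[OF x that]] l by linarith
    have "p1 x * (\<integral>y. (p (x, y) / p1 x) * ln (p (x, y) / p1 x) \<partial>B) = p1 x * ((\<integral>y. p (x, y) * ln (p (x, y)) \<partial>B) / p1 x - ln (p1 x))"
      using normalised_entropy[OF ipx[OF x] iplx[OF x] pos] p1pos[OF x] by (simp add: p1_def)
    also have "\<dots> = (\<integral>y. p (x, y) * ln (p (x, y)) \<partial>B) - p1 x * ln (p1 x)"
      using p1pos[OF x] by (simp add: right_diff_distrib)
    finally show ?thesis .
  qed
  have i: "integrable A (\<lambda>x. (\<integral>y. p (x, y) * ln (p (x, y)) \<partial>B) - p1 x * ln (p1 x))"
    using AB.integrable_fst'[OF ipl] ip1 by simp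
  show "integrable A (\<lambda>x. p1 x * (\<integral>y. (p (x, y) / p1 x) * ln (p (x, y) / p1 x) \<partial>B))"
    using i by (subst Bochner_Integration.integrable_cong[OF refl eq]) 
  have "(\<integral>x. p1 x * (\<integral>y. (p (x, y) / p1 x) * ln (p (x, y) / p1 x) \<partial>B) \<partial>A) = (\<integral>x. (\<integral>y. p (x, y) * ln (p (x, y)) \<partial>B) - p1 x * ln (p1 x) \<partial>A)"
    by (rule Bochner_Integration.integral_cong[OF refl eq])
  then show "(\<integral>x. p1 x * (\<integral>y. (p (x, y) / p1 x) * ln (p (x, y) / p1 x) \<partial>B) \<partial>A)
         = (\<integral>z. p z * ln (p z) \<partial>(A \<Otimes>\<^sub>M B)) - (\<integral>x. p1 x * ln (p1 x) \<partial>A)"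
    using AB.integrable_fst'[OF ipl] AB.integral_fst'[OF ipl] ip1 by simp
  show "integrable B (\<lambda>y. p (x, y))" if "x \<in> space A" for x using ipx(1)[OF that] .
qed

text \<open>
  Condition on the first coordinates \<open>x\<close>, \<open>y\<close> of the two points. The inequality on \<open>B\<close>, for the conditional
  densities and the test function \<open>f (mA (x, y), _)\<close>, bounds the conditional mean of \<open>f\<close> by \<open>f1 (mA (x, y))\<close> plus
  conditional entropies, where \<open>f1\<close> arises from \<open>f\<close> by taking \<open>ln (\<integral> exp f)\<close> in the second coordinate.
  Averaging over \<open>x\<close> and \<open>y\<close> leaves the mean of \<open>f1\<close>, which the inequality on \<open>A\<close> bounds in terms of the marginal
  densities. The chain rule adds up the entropies, and \<open>\<integral> exp f1 = \<integral> exp f\<close>.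
\<close>

theorem entropy_stable_pair:
  assumes "prob_space A" "prob_space B"
    and mA[measurable]: "mA \<in> measurable (A \<Otimes>\<^sub>M A) A" and mB[measurable]: "mB \<in> measurable (B \<Otimes>\<^sub>M B) B"
    and cA: "integrable (A \<Otimes>\<^sub>M A) cA" and cB: "integrable (B \<Otimes>\<^sub>M B) cB"
    and stA: "entropy_stable A mA cA t" and stB: "entropy_stable B mB cB t"
  shows "entropy_stable (A \<Otimes>\<^sub>M B)
     (\<lambda>z. (mA (fst (fst z), fst (snd z)), mB (snd (fst z), snd (snd z))))
     (\<lambda>z. cA (fst (fst z), fst (snd z)) + cB (snd (fst z), snd (snd z))) t"
  unfolding entropy_stable_def
proof (intro allI impI)
  interpret A: prob_space A by fact
  interpret B: prob_space B by fact
  interpret AA: pair_prob_space A A ..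
  interpret BB: pair_prob_space B B ..
  interpret AB: pair_prob_space A B ..
  let ?Z = "A \<Otimes>\<^sub>M A" and ?W = "B \<Otimes>\<^sub>M B"
  interpret ZW: pair_prob_space ?Z ?W ..
  interpret ABAB: pair_prob_space "A \<Otimes>\<^sub>M B" "A \<Otimes>\<^sub>M B" ..
  have [measurable]: "cA \<in> borel_measurable ?Z" "cB \<in> borel_measurable ?W" using cA cB by auto
  fix f p q :: "'a \<times> 'b \<Rightarrow> real"
  assume f[measurable]: "f \<in> borel_measurable (A \<Otimes>\<^sub>M B)" and "\<exists>D. \<forall>x\<in>space (A \<Otimes>\<^sub>M B). \<bar>f x\<bar> \<le> D"
    and p: "bounded_density (A \<Otimes>\<^sub>M B) p" and q: "bounded_density (A \<Otimes>\<^sub>M B) q"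
  then obtain D where D: "\<And>z. z \<in> space (A \<Otimes>\<^sub>M B) \<Longrightarrow> \<bar>f z\<bar> \<le> D" by auto
  have [measurable]: "p \<in> borel_measurable (A \<Otimes>\<^sub>M B)" "q \<in> borel_measurable (A \<Otimes>\<^sub>M B)"
    using p q by (auto simp: bounded_density_def)
  have sp: "(x, y) \<in> space (A \<Otimes>\<^sub>M B)" if "x \<in> space A" "y \<in> space B" for x y
    using that by (simp add: space_pair_measure)
  define p1 where "p1 x = (\<integral>y. p (x, y) \<partial>B)" for x
  define q1 where "q1 x = (\<integral>y. q (x, y) \<partial>B)" for x
  define f1 where "f1 x = ln (\<integral>y. exp (f (x, y)) \<partial>B)" for x
  define hp where "hp x = (\<integral>y. (p (x, y) / p1 x) * ln (p (x, y) / p1 x) \<partial>B)" for x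
  define hq where "hq x = (\<integral>y. (q (x, y) / q1 x) * ln (q (x, y) / q1 x) \<partial>B)" for x
  note dp = bounded_density_disintegrate[OF assms(1,2) p, folded p1_def, folded hp_def]
  note dq = bounded_density_disintegrate[OF assms(1,2) q, folded q1_def, folded hq_def]
  have [measurable]: "p1 \<in> borel_measurable A" "q1 \<in> borel_measurable A" "f1 \<in> borel_measurable A"
    "hp \<in> borel_measurable A" "hq \<in> borel_measurable A"
    unfolding p1_def[abs_def] q1_def[abs_def] f1_def[abs_def] hp_def[abs_def] hq_def[abs_def] by measurable
  have fx: "(\<lambda>y. f (x, y)) \<in> borel_measurable B" "\<And>y. y \<in> space B \<Longrightarrow> \<bar>f (x, y)\<bar> \<le> D" if "x \<in> space A" for x
    using that D sp by auto
  have f1D: "\<bar>f1 x\<bar> \<le> D" if "x \<in> space A" for x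
    unfolding f1_def using B.ln_integral_exp_bounded(2)[OF fx[OF that]] .
  have expf1: "(\<integral>x. exp (f1 x) \<partial>A) = (\<integral>z. exp (f z) \<partial>(A \<Otimes>\<^sub>M B))"
  proof -
    have "(\<integral>x. exp (f1 x) \<partial>A) = (\<integral>x. \<integral>y. exp (f (x, y)) \<partial>B \<partial>A)"
      using B.ln_integral_exp_bounded(3)[OF fx] unfolding f1_def by (intro Bochner_Integration.integral_cong) auto
    also have "\<dots> = (\<integral>z. exp (f z) \<partial>(A \<Otimes>\<^sub>M B))"
      using AB.integral_fst'[OF AB.P.ln_integral_exp_bounded(1)[OF f D]] by simp
    finally show ?thesis .
  qed

  obtain u where u: "\<And>z. z \<in> space (A \<Otimes>\<^sub>M B) \<Longrightarrow> 0 < p z \<and> p z \<le> u" using p unfolding bounded_density_def by force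
  obtain v where v: "\<And>z. z \<in> space (A \<Otimes>\<^sub>M B) \<Longrightarrow> 0 < q z \<and> q z \<le> v" using q unfolding bounded_density_def by force
  \<comment> \<open>The joint density of two points after the interchange of coordinates: \<open>((x, y), (x', y'))\<close> stands for the
    points \<open>(x, x')\<close> and \<open>(y, y')\<close>.\<close>
  define r where "r zw = p (fst (fst zw), fst (snd zw)) * q (snd (fst zw), snd (snd zw))" for zw :: "('a \<times> 'a) \<times> ('b \<times> 'b)"
  have [measurable]: "r \<in> borel_measurable (?Z \<Otimes>\<^sub>M ?W)" unfolding r_def[abs_def] by measurable
  have rb: "\<bar>r zw\<bar> \<le> u * v" if "zw \<in> space (?Z \<Otimes>\<^sub>M ?W)" for zw
  proof -
    have "(fst (fst zw), fst (snd zw)) \<in> space (A \<Otimes>\<^sub>M B)" "(snd (fst zw), snd (snd zw)) \<in> space (A \<Otimes>\<^sub>M B)"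
      using that by (auto simp: space_pair_measure)
    from u[OF this(1)] v[OF this(2)] show ?thesis unfolding r_def by (auto simp: abs_mult intro!: mult_mono)
  qed
  have int_r: "integrable (?Z \<Otimes>\<^sub>M ?W) (\<lambda>zw. g zw * r zw)" if "integrable (?Z \<Otimes>\<^sub>M ?W) g" for g
    using that rb by (intro integrable_bounded_mult(1)) auto
  have change: "(\<integral>z. F z * (p (fst z) * q (snd z)) \<partial>((A \<Otimes>\<^sub>M B) \<Otimes>\<^sub>M (A \<Otimes>\<^sub>M B))) =
     (\<integral>zw. F ((fst (fst zw), fst (snd zw)), (snd (fst zw), snd (snd zw))) * r zw \<partial>(?Z \<Otimes>\<^sub>M ?W))"
    if [measurable]: "F \<in> borel_measurable ((A \<Otimes>\<^sub>M B) \<Otimes>\<^sub>M (A \<Otimes>\<^sub>M B))" for F :: "_ \<Rightarrow> real"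
    by (subst distr_pair_interchange[OF assms(1,2), symmetric], subst integral_distr) (auto simp: r_def)

  define J where "J z = (\<integral>w. f (mA z, mB w) * r (z, w) \<partial>?W)" for z
  define L where "L z = (\<integral>w. cB w * r (z, w) \<partial>?W)" for z
  have intF: "integrable (?Z \<Otimes>\<^sub>M ?W) (\<lambda>zw. f (mA (fst zw), mB (snd zw)) * r zw)"
  proof (rule int_r, rule ZW.P.integrable_const_bound[where B=D])
    have "norm (f (mA (fst zw), mB (snd zw))) \<le> D" if "zw \<in> space (?Z \<Otimes>\<^sub>M ?W)" for zw
      using that D[OF sp[OF measurable_space[OF mA] measurable_space[OF mB]], of "fst zw" "snd zw"]
      by (auto simp: space_pair_measure)
    then show "AE zw in ?Z \<Otimes>\<^sub>M ?W. norm (f (mA (fst zw), mB (snd zw))) \<le> D" by (rule AE_I2)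
  qed measurable
  have intcA: "integrable (?Z \<Otimes>\<^sub>M ?W) (\<lambda>zw. cA (fst zw) * r zw)"
    using ZW.integral_pair_mult(1)[OF cA, of "\<lambda>_. 1"] by (intro int_r) simp
  have intcB: "integrable (?Z \<Otimes>\<^sub>M ?W) (\<lambda>zw. cB (snd zw) * r zw)"
    using ZW.integral_pair_mult(1)[OF _ cB, of "\<lambda>_. 1"] by (intro int_r) simp
  have J: "integrable ?Z J" "(\<integral>z. J z \<partial>?Z) = (\<integral>zw. f (mA (fst zw), mB (snd zw)) * r zw \<partial>(?Z \<Otimes>\<^sub>M ?W))"
    using ZW.integrable_fst'[OF intF] ZW.integral_fst'[OF intF] by (simp_all add: J_def[abs_def])
  have L: "integrable ?Z L" "(\<integral>z. L z \<partial>?Z) = (\<integral>zw. cB (snd zw) * r zw \<partial>(?Z \<Otimes>\<^sub>M ?W))"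
    using ZW.integrable_fst'[OF intcB] ZW.integral_fst'[OF intcB] by (simp_all add: L_def[abs_def])
  have intcross: "(\<integral>z. cA z * (p1 (fst z) * q1 (snd z)) \<partial>?Z) = (\<integral>zw. cA (fst zw) * r zw \<partial>(?Z \<Otimes>\<^sub>M ?W))"
  proof -
    have "(\<integral>w. r (z, w) \<partial>?W) = p1 (fst z) * q1 (snd z)" if "z \<in> space ?Z" for z
    proof -
      have z: "fst z \<in> space A" "snd z \<in> space A" using that by (auto simp: space_pair_measure)
      have "integrable B (\<lambda>y. p (fst z, y))" "integrable B (\<lambda>y. q (snd z, y))"
        using dp(4)[OF z(1)] dq(4)[OF z(2)] by auto
      from BB.integral_pair_mult(2)[OF this] show ?thesis by (simp add: r_def p1_def q1_def)
    qed
    then have "(\<integral>z. cA z * (p1 (fst z) * q1 (snd z)) \<partial>?Z) = (\<integral>z. \<integral>w. cA (fst (z, w)) * r (z, w) \<partial>?W \<partial>?Z)"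
      by (intro Bochner_Integration.integral_cong) auto
    then show ?thesis using ZW.integral_fst'[OF intcA] by simp
  qed

  \<comment> \<open>The inequality on \<open>B\<close> for the conditional densities, multiplied by the marginal densities.\<close>
  have cond: "J z \<le> f1 (mA z) * (p1 (fst z) * q1 (snd z)) + t * ((p1 (fst z) * hp (fst z)) * q1 (snd z))
      + (1 - t) * (p1 (fst z) * (q1 (snd z) * hq (snd z))) + L z" if z: "z \<in> space ?Z" for z
  proof -
    have z12: "fst z \<in> space A" "snd z \<in> space A" "mA z \<in> space A"
      using z measurable_space[OF mA z] by (auto simp: space_pair_measure)
    let ?P = "\<lambda>y. p (fst z, y) / p1 (fst z)" and ?Q = "\<lambda>y. q (snd z, y) / q1 (snd z)"
    have pos: "0 < p1 (fst z) * q1 (snd z)" using dp(2) dq(2) z12 by simp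
    have sc: "(\<integral>w. g w * (?P (fst w) * ?Q (snd w)) \<partial>?W) = (\<integral>w. g w * r (z, w) \<partial>?W) / (p1 (fst z) * q1 (snd z))" for g
      by (simp add: r_def flip: integral_divide_zero)
    have "dual_bound B mB cB t (\<lambda>y. f (mA z, y)) ?P ?Q"
      using stB fx[OF z12(3)] dp(3)[OF z12(1)] dq(3)[OF z12(2)] unfolding entropy_stable_def by blast
    then have "J z / (p1 (fst z) * q1 (snd z)) \<le> f1 (mA z) + t * hp (fst z) + (1 - t) * hq (snd z) + L z / (p1 (fst z) * q1 (snd z))"
      unfolding dual_bound_def sc J_def L_def f1_def hp_def hq_def .
    then have "J z \<le> (f1 (mA z) + t * hp (fst z) + (1 - t) * hq (snd z) + L z / (p1 (fst z) * q1 (snd z))) * (p1 (fst z) * q1 (snd z))"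
      using pos by (simp only: pos_divide_le_eq)
    also have "\<dots> = f1 (mA z) * (p1 (fst z) * q1 (snd z)) + t * ((p1 (fst z) * hp (fst z)) * q1 (snd z))
      + (1 - t) * (p1 (fst z) * (q1 (snd z) * hq (snd z))) + L z"
    proof -
      have "L z / (p1 (fst z) * q1 (snd z)) * (p1 (fst z) * q1 (snd z)) = L z"
        using pos by (metis nonzero_eq_divide_eq less_irrefl)
      then show ?thesis by (simp only: distrib_right) (simp only: mult_ac)
    qed
    finally show ?thesis .
  qed
  have ip1: "integrable A p1" "(\<integral>x. p1 x \<partial>A) = 1" and iq1: "integrable A q1" "(\<integral>x. q1 x \<partial>A) = 1"
    using dp(1) dq(1) unfolding bounded_density_def by (metis not_integrable_integral_eq zero_neq_one)+
  note i1 = AA.integral_pair_mult[OF ip1(1) iq1(1)]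
    and i2 = AA.integral_pair_mult[OF dp(5) iq1(1)] and i3 = AA.integral_pair_mult[OF ip1(1) dq(5)]
  have i0: "integrable ?Z (\<lambda>z. f1 (mA z) * (p1 (fst z) * q1 (snd z)))"
  proof (rule integrable_bounded_mult(2)[OF i1(1)])
    show "\<bar>f1 (mA z)\<bar> \<le> D" if "z \<in> space ?Z" for z using f1D measurable_space[OF mA that] by simp
  qed measurable
  have "(\<integral>z. J z \<partial>?Z) \<le> (\<integral>z. f1 (mA z) * (p1 (fst z) * q1 (snd z)) + t * ((p1 (fst z) * hp (fst z)) * q1 (snd z))
      + (1 - t) * (p1 (fst z) * (q1 (snd z) * hq (snd z))) + L z \<partial>?Z)"
    by (rule integral_mono[OF J(1) _ cond])
       (intro Bochner_Integration.integrable_add integrable_mult_right i0 i2(1) i3(1) L(1))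
  also have "\<dots> = (\<integral>z. f1 (mA z) * (p1 (fst z) * q1 (snd z)) \<partial>?Z) + t * (\<integral>x. p1 x * hp x \<partial>A) + (1 - t) * (\<integral>x. q1 x * hq x \<partial>A) + (\<integral>z. L z \<partial>?Z)"
    using i0 i2 i3 L(1) ip1(2) iq1(2) by simp
  also have "(\<integral>z. f1 (mA z) * (p1 (fst z) * q1 (snd z)) \<partial>?Z) \<le> ln (\<integral>z. exp (f z) \<partial>(A \<Otimes>\<^sub>M B)) + t * (\<integral>x. p1 x * ln (p1 x) \<partial>A)
     + (1 - t) * (\<integral>x. q1 x * ln (q1 x) \<partial>A) + (\<integral>zw. cA (fst zw) * r zw \<partial>(?Z \<Otimes>\<^sub>M ?W))"
  proof -
    have "\<exists>D. \<forall>x\<in>space A. \<bar>f1 x\<bar> \<le> D" "f1 \<in> borel_measurable A" using f1D by auto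
    then have "dual_bound A mA cA t f1 p1 q1" using stA dp(1) dq(1) unfolding entropy_stable_def by blast
    then show ?thesis unfolding dual_bound_def expf1 intcross .
  qed
  finally have main: "(\<integral>z. J z \<partial>?Z) \<le> ln (\<integral>z. exp (f z) \<partial>(A \<Otimes>\<^sub>M B)) + t * (\<integral>z. p z * ln (p z) \<partial>(A \<Otimes>\<^sub>M B)) + (1 - t) * (\<integral>z. q z * ln (q z) \<partial>(A \<Otimes>\<^sub>M B))
      + ((\<integral>zw. cA (fst zw) * r zw \<partial>(?Z \<Otimes>\<^sub>M ?W)) + (\<integral>zw. cB (snd zw) * r zw \<partial>(?Z \<Otimes>\<^sub>M ?W)))"
    unfolding dp(6) dq(6) L(2) by (simp add: right_diff_distrib)
  have c: "(\<integral>zw. cA (fst zw) * r zw \<partial>(?Z \<Otimes>\<^sub>M ?W)) + (\<integral>zw. cB (snd zw) * r zw \<partial>(?Z \<Otimes>\<^sub>M ?W)) 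
     = (\<integral>zw. (cA (fst zw) + cB (snd zw)) * r zw \<partial>(?Z \<Otimes>\<^sub>M ?W))"
    using intcA intcB by (simp add: distrib_right)
  show "dual_bound (A \<Otimes>\<^sub>M B) (\<lambda>z. (mA (fst (fst z), fst (snd z)), mB (snd (fst z), snd (snd z))))
     (\<lambda>z. cA (fst (fst z), fst (snd z)) + cB (snd (fst z), snd (snd z))) t f p q"
    unfolding dual_bound_def
    using main unfolding J(2) c by (subst (1 2) change) simp_all
qed

section \<open>Gaussian laws on Euclidean space\<close>

abbreviation coord_sum :: "('e::euclidean_space \<Rightarrow> real) \<Rightarrow> 'e" where
  "coord_sum f \<equiv> \<Sum>b\<in>Basis. f b *\<^sub>R b"

lemma density_lborel_prod:
  fixes g :: "real \<Rightarrow> real"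
  assumes [measurable]: "g \<in> borel_measurable borel" and g0: "\<And>x. 0 \<le> g x" and prob: "prob_space (density lborel g)"
  shows "distr (\<Pi>\<^sub>M b\<in>Basis. density lborel g) borel coord_sum = density (lborel :: 'e::euclidean_space measure) (\<lambda>x. \<Prod>b\<in>Basis. g (x \<bullet> b))"
proof -
  interpret P: product_prob_space "\<lambda>_. density lborel g" "Basis :: 'e set"
    using prob by (simp add: product_prob_space_def product_sigma_finite_def prob_space_imp_sigma_finite product_prob_space_axioms_def)
  interpret L: product_sigma_finite "\<lambda>_::'e. lborel :: real measure"
    by standard
  have "density (\<Pi>\<^sub>M b\<in>(Basis::'e set). lborel) (\<lambda>x. ennreal (\<Prod>b\<in>Basis. g (x b))) = (\<Pi>\<^sub>M b\<in>Basis. density lborel g)"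
  proof (rule P.PiM_eqI)
    show "sets (density (\<Pi>\<^sub>M b\<in>(Basis::'e set). lborel) (\<lambda>x. ennreal (\<Prod>b\<in>Basis. g (x b)))) = sets (\<Pi>\<^sub>M b\<in>(Basis::'e set). density lborel g)"
      by (simp cong: sets_PiM_cong)
    fix X :: "'e \<Rightarrow> real set" assume X: "\<And>b. b \<in> Basis \<Longrightarrow> X b \<in> sets (density lborel g)"
    then have [measurable]: "\<And>b. b \<in> Basis \<Longrightarrow> X b \<in> sets borel" by simp
    have "emeasure (density (\<Pi>\<^sub>M b\<in>(Basis::'e set). lborel) (\<lambda>x. ennreal (\<Prod>b\<in>Basis. g (x b)))) (Pi\<^sub>E Basis X)
       = (\<integral>\<^sup>+x. ennreal (\<Prod>b\<in>Basis. g (x b)) * indicator (Pi\<^sub>E Basis X) x \<partial>(\<Pi>\<^sub>M b\<in>(Basis::'e set). lborel))"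
      by (rule emeasure_density) (auto intro!: sets_PiM_I_finite)
    also have "\<dots> = (\<integral>\<^sup>+x. (\<Prod>b\<in>Basis. ennreal (g (x b)) * indicator (X b) (x b)) \<partial>(\<Pi>\<^sub>M b\<in>(Basis::'e set). lborel))"
    proof (rule nn_integral_cong)
      fix x assume "x \<in> space (\<Pi>\<^sub>M b\<in>(Basis::'e set). (lborel :: real measure))"
      then have "indicator (Pi\<^sub>E Basis X) x = (\<Prod>b\<in>Basis. indicator (X b) (x b) :: ennreal)"
        by (auto simp: space_PiM PiE_iff indicator_def prod_zero_iff split: if_splits)
      then show "ennreal (\<Prod>b\<in>Basis. g (x b)) * indicator (Pi\<^sub>E Basis X) x = (\<Prod>b\<in>Basis. ennreal (g (x b)) * indicator (X b) (x b))"
        using g0 by (simp add: prod_ennreal prod.distrib)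
    qed
    also have "\<dots> = (\<Prod>b\<in>Basis. (\<integral>\<^sup>+x. ennreal (g x) * indicator (X b) x \<partial>lborel))"
      by (rule L.product_nn_integral_prod) auto
    also have "\<dots> = (\<Prod>b\<in>Basis. emeasure (density lborel g) (X b))"
      by (intro prod.cong refl) (simp add: emeasure_density)
    finally show "emeasure (density (\<Pi>\<^sub>M b\<in>(Basis::'e set). lborel) (\<lambda>x. ennreal (\<Prod>b\<in>Basis. g (x b)))) (Pi\<^sub>E Basis X)
       = (\<Prod>b\<in>Basis. emeasure (density lborel g) (X b))" .
  qed simp
  then have "distr (\<Pi>\<^sub>M b\<in>Basis. density lborel g) borel (coord_sum :: _ \<Rightarrow> 'e) = 
     distr (density (\<Pi>\<^sub>M b\<in>(Basis::'e set). lborel) (\<lambda>x. ennreal (\<Prod>b\<in>Basis. g (x b)))) borel coord_sum" by simp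
  also have "\<dots> = distr (density (\<Pi>\<^sub>M b\<in>(Basis::'e set). lborel) (\<lambda>x. ennreal (\<Prod>b\<in>Basis. g (coord_sum x \<bullet> b)))) borel coord_sum"
    by simp
  also have "\<dots> = density (distr (\<Pi>\<^sub>M b\<in>(Basis::'e set). lborel) borel coord_sum) (\<lambda>x. ennreal (\<Prod>b\<in>Basis. g (x \<bullet> b)))"
    by (rule density_distr[symmetric]) measurable
  finally show ?thesis unfolding lborel_eq[symmetric] .
qed

lemma gaussian_density_prod:
  fixes x :: "real ^ 'n"
  assumes s: "0 < s"
  shows "(2 * pi * s\<^sup>2) powr (- real CARD('n) / 2) * exp (- (norm x)\<^sup>2 / (2 * s\<^sup>2)) = (\<Prod>b\<in>Basis. normal_density 0 s (x \<bullet> b))"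
proof -
  have "(\<Prod>b\<in>Basis. normal_density 0 s (x \<bullet> b)) = (1 / sqrt (2 * pi * s\<^sup>2)) ^ CARD('n) * exp (\<Sum>b\<in>Basis. - (x \<bullet> b)\<^sup>2 / (2 * s\<^sup>2))"
    
    unfolding normal_density_def prod.distrib exp_sum[OF finite_Basis] prod_constant by simp
  also have "(\<Sum>b\<in>Basis. - (x \<bullet> b)\<^sup>2 / (2 * s\<^sup>2)) = - (norm x)\<^sup>2 / (2 * s\<^sup>2)"
  proof -
    have "(norm x)\<^sup>2 = (\<Sum>b\<in>Basis. (x \<bullet> b)\<^sup>2)"
      unfolding power2_norm_eq_inner by (subst euclidean_inner) (simp only: power2_eq_square)
    then show ?thesis by (simp only: sum_divide_distrib[symmetric] sum_negf)
  qed
  also have "(1 / sqrt (2 * pi * s\<^sup>2)) ^ CARD('n) = (2 * pi * s\<^sup>2) powr (- real CARD('n) / 2)"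
  proof -
    have "1 / sqrt (2 * pi * s\<^sup>2) = (2 * pi * s\<^sup>2) powr (- (1/2))"
      using s by (simp add: powr_minus_divide powr_half_sqrt)
    then show ?thesis using s by (simp add: powr_power)
  qed
  finally show ?thesis ..
qed

lemma gaussian_eq_distr:
  assumes s: "0 < s"
  shows "gaussian (s\<^sup>2) = distr (\<Pi>\<^sub>M b\<in>Basis. normal_law s) borel (coord_sum :: _ \<Rightarrow> real ^ 'n)"
  unfolding gaussian_def gaussian_density_prod[OF s]
  using prob_space_normal_density[OF s] by (intro density_lborel_prod[symmetric]) auto

text \<open>
  Induction on the set of coordinates, each of which is adjoined by tensorisation with the line. Functions on
  a finite index set are used because the dimension varies in the induction.
\<close>

lemma gaussian_prod_entropy_stable:
  fixes I :: "'i set"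
  assumes "finite I" and s: "0 < s" and a: "0 < a" and b: "0 < b" and ab: "a\<^sup>2 + b\<^sup>2 = 1"
  shows "entropy_stable (\<Pi>\<^sub>M i\<in>I. normal_law s) (\<lambda>z. \<lambda>i\<in>I. a * fst z i + b * snd z i) 
     (\<lambda>z. a * b / s\<^sup>2 * (\<Sum>i\<in>I. fst z i * snd z i)) (a\<^sup>2)"
  using \<open>finite I\<close>
proof induction
  case empty
  let ?E = "\<Pi>\<^sub>M i\<in>({}::'i set). normal_law s"
  interpret E: prob_space ?E by (intro prob_space_PiM) auto
  interpret EE: pair_prob_space ?E ?E ..
  have int: "(\<integral>x. g x \<partial>?E) = g (\<lambda>_. undefined)" for g :: "_ \<Rightarrow> real"
  proof -
    have "(\<integral>x. g x \<partial>?E) = (\<integral>x. g (\<lambda>_. undefined) \<partial>?E)"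
      by (rule Bochner_Integration.integral_cong) (auto simp: space_PiM_empty)
    then show ?thesis using E.prob_space by simp
  qed
  have int2: "(\<integral>z. g z \<partial>(?E \<Otimes>\<^sub>M ?E)) = g (\<lambda>_. undefined, \<lambda>_. undefined)" for g :: "_ \<Rightarrow> real"
  proof -
    have "(\<integral>z. g z \<partial>(?E \<Otimes>\<^sub>M ?E)) = (\<integral>x. g (\<lambda>_. undefined, \<lambda>_. undefined) \<partial>(?E \<Otimes>\<^sub>M ?E))"
      by (rule Bochner_Integration.integral_cong) (auto simp: space_pair_measure space_PiM_empty)
    then show ?thesis using EE.P.prob_space by simp
  qed
  show ?case
    unfolding entropy_stable_def dual_bound_def bounded_density_def int int2 by (simp add: restrict_def)
next
  case (insert i I)
  let ?N = "normal_law s" and ?P = "\<Pi>\<^sub>M i\<in>I. normal_law s" and ?Q = "\<Pi>\<^sub>M i\<in>insert i I. normal_law s"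
  interpret N: prob_space ?N using s by (rule prob_space_normal_density)
  interpret P: prob_space ?P by (intro prob_space_PiM N.prob_space_axioms)
  interpret NP: pair_prob_space ?N ?P ..
  interpret NN: pair_prob_space ?N ?N ..
  interpret PP: pair_prob_space ?P ?P ..
  have intx: "integrable ?N (\<lambda>x. x)" using integrable_normal_moment_nz_1[of s 0] s by (simp add: integrable_density)
  have intc: "integrable ?P (\<lambda>x. x j)" if "j \<in> I" for j
  proof -
    have "integrable (distr ?P ?N (\<lambda>x. x j)) (\<lambda>x. x)"
      using intx that N.prob_space_axioms by (subst distr_PiM_component) auto
    then show ?thesis using that by (subst (asm) integrable_distr_eq) auto
  qed
  have cB: "integrable (?P \<Otimes>\<^sub>M ?P) (\<lambda>z. a * b / s\<^sup>2 * (\<Sum>i\<in>I. fst z i * snd z i))"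
    using PP.integral_pair_mult(1)[OF intc intc] by (intro integrable_mult_right Bochner_Integration.integrable_sum) auto
  have cA: "integrable (?N \<Otimes>\<^sub>M ?N) (\<lambda>z. a * b / s\<^sup>2 * (fst z * snd z))"
    using NN.integral_pair_mult(1)[OF intx intx] by auto
  have mA: "(\<lambda>z. a * fst z + b * snd z) \<in> measurable (?N \<Otimes>\<^sub>M ?N) ?N"
    by (auto cong: measurable_cong_sets)
  have mB: "(\<lambda>z. \<lambda>i\<in>I. a * fst z i + b * snd z i) \<in> measurable (?P \<Otimes>\<^sub>M ?P) ?P"
    by (intro measurable_restrict) (auto cong: measurable_cong_sets)
  have st: "entropy_stable (?N \<Otimes>\<^sub>M ?P)
     (\<lambda>z. (a * fst (fst z) + b * fst (snd z), \<lambda>i\<in>I. a * snd (fst z) i + b * snd (snd z) i))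
     (\<lambda>z. a * b / s\<^sup>2 * (fst (fst z) * fst (snd z)) + a * b / s\<^sup>2 * (\<Sum>i\<in>I. snd (fst z) i * snd (snd z) i)) (a\<^sup>2)"
    using entropy_stable_pair[OF N.prob_space_axioms P.prob_space_axioms mA mB cA cB gaussian_entropy_stable[OF s a b ab] insert.IH]
    unfolding fst_conv snd_conv .
  show ?case
  proof (rule entropy_stable_distr[OF _ _ _ _ _ _ _ _ st])
    show "prob_space (?N \<Otimes>\<^sub>M ?P)" by (rule NP.P.prob_space_axioms)
    show "(\<lambda>(x, X). X(i := x)) \<in> measurable (?N \<Otimes>\<^sub>M ?P) ?Q" by measurable
    show "distr (?N \<Otimes>\<^sub>M ?P) ?Q (\<lambda>(x, X). X(i := x)) = ?Q"
      by (rule distr_pair_PiM_eq_PiM) (rule N.prob_space_axioms)+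
    show "(\<lambda>z. (a * fst (fst z) + b * fst (snd z), \<lambda>i\<in>I. a * snd (fst z) i + b * snd (snd z) i)) \<in> measurable ((?N \<Otimes>\<^sub>M ?P) \<Otimes>\<^sub>M (?N \<Otimes>\<^sub>M ?P)) (?N \<Otimes>\<^sub>M ?P)"
      by (intro measurable_Pair measurable_restrict) (auto cong: measurable_cong_sets)
    show "(\<lambda>z. \<lambda>j\<in>insert i I. a * fst z j + b * snd z j) \<in> measurable (?Q \<Otimes>\<^sub>M ?Q) ?Q"
      by (intro measurable_restrict) (auto cong: measurable_cong_sets)
    show "(\<lambda>z. a * b / s\<^sup>2 * (\<Sum>j\<in>insert i I. fst z j * snd z j)) \<in> borel_measurable (?Q \<Otimes>\<^sub>M ?Q)"
      by measurable
  next
    fix z assume "z \<in> space ((?N \<Otimes>\<^sub>M ?P) \<Otimes>\<^sub>M (?N \<Otimes>\<^sub>M ?P))"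
    obtain x X y Y where z: "z = ((x, X), (y, Y))" by (metis surj_pair)
    show "(\<lambda>j\<in>insert i I. a * fst ((case fst z of (x, X) \<Rightarrow> X(i := x)), (case snd z of (x, X) \<Rightarrow> X(i := x))) j
       + b * snd ((case fst z of (x, X) \<Rightarrow> X(i := x)), (case snd z of (x, X) \<Rightarrow> X(i := x))) j) =
      (case (a * fst (fst z) + b * fst (snd z), \<lambda>i\<in>I. a * snd (fst z) i + b * snd (snd z) i) of (x, X) \<Rightarrow> X(i := x))"
      by (auto simp: z fun_eq_iff)
    have "(\<Sum>j\<in>I. (X(i := x)) j * (Y(i := y)) j) = (\<Sum>j\<in>I. X j * Y j)"
      using insert.hyps by (intro sum.cong) auto
    then show "a * b / s\<^sup>2 * (\<Sum>j\<in>insert i I. fst ((case fst z of (x, X) \<Rightarrow> X(i := x)), (case snd z of (x, X) \<Rightarrow> X(i := x))) j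
         * snd ((case fst z of (x, X) \<Rightarrow> X(i := x)), (case snd z of (x, X) \<Rightarrow> X(i := x))) j) =
      a * b / s\<^sup>2 * (fst (fst z) * fst (snd z)) + a * b / s\<^sup>2 * (\<Sum>i\<in>I. snd (fst z) i * snd (snd z) i)"
      using insert.hyps by (simp add: z distrib_left)
  qed
qed

theorem gaussian_vec_entropy_stable:
  assumes s: "0 < s" and a: "0 < a" and b: "0 < b" and ab: "a\<^sup>2 + b\<^sup>2 = 1"
  shows "entropy_stable (gaussian (s\<^sup>2) :: (real ^ 'n) measure) (\<lambda>z. a *\<^sub>R fst z + b *\<^sub>R snd z)
     (\<lambda>z. a * b / s\<^sup>2 * (fst z \<bullet> snd z)) (a\<^sup>2)"
proof (rule entropy_stable_distr[OF _ _ _ _ _ _ _ _ gaussian_prod_entropy_stable[OF finite_Basis s a b ab]])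
  let ?P = "\<Pi>\<^sub>M i\<in>(Basis :: (real ^ 'n) set). normal_law s" and ?G = "gaussian (s\<^sup>2) :: (real ^ 'n) measure"
  have [measurable_cong]: "sets ?G = sets borel" by (simp add: gaussian_def)
  show "prob_space ?P" by (intro prob_space_PiM prob_space_normal_density s)
  have cs: "coord_sum \<in> measurable ?P (borel :: (real ^ 'n) measure)"
    by (intro borel_measurable_sum borel_measurable_scaleR) (auto cong: measurable_cong_sets)
  then show "coord_sum \<in> measurable ?P ?G" by (simp cong: measurable_cong_sets add: gaussian_def)
  show "distr ?P ?G coord_sum = ?G"
  proof -
    have "distr ?P ?G coord_sum = distr ?P borel coord_sum" by (rule distr_cong) (simp_all add: gaussian_def)
    then show ?thesis by (simp only: gaussian_eq_distr[OF s])
  qed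
  show "(\<lambda>z. \<lambda>i\<in>Basis. a * fst z i + b * snd z i) \<in> measurable (?P \<Otimes>\<^sub>M ?P) ?P"
    by (intro measurable_restrict) (auto cong: measurable_cong_sets)
  show "(\<lambda>z. a *\<^sub>R fst z + b *\<^sub>R snd z) \<in> measurable (?G \<Otimes>\<^sub>M ?G) ?G"
    "(\<lambda>z. a * b / s\<^sup>2 * (fst z \<bullet> snd z)) \<in> borel_measurable (?G \<Otimes>\<^sub>M ?G)"
    by measurable
  fix z :: "(real ^ 'n \<Rightarrow> real) \<times> (real ^ 'n \<Rightarrow> real)"
  show "a *\<^sub>R fst (coord_sum (fst z) :: real ^ 'n, coord_sum (snd z) :: real ^ 'n) + b *\<^sub>R snd (coord_sum (fst z) :: real ^ 'n, coord_sum (snd z) :: real ^ 'n)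
     = coord_sum (\<lambda>i\<in>Basis. a * fst z i + b * snd z i)"
    by (simp add: scaleR_right.sum sum.distrib[symmetric] scaleR_left_distrib)
  show "a * b / s\<^sup>2 * (fst (coord_sum (fst z) :: real ^ 'n, coord_sum (snd z) :: real ^ 'n) \<bullet> snd (coord_sum (fst z) :: real ^ 'n, coord_sum (snd z) :: real ^ 'n)) =
      a * b / s\<^sup>2 * (\<Sum>i\<in>Basis. fst z i * snd z i)"
    unfolding fst_conv snd_conv by (subst euclidean_inner) simp
qed

section \<open>The Gibbs variational principle\<close>

lemma x_ln_x_ge: "- 1 \<le> x * ln x" if "0 \<le> x" for x :: real
proof (cases "x = 0")
  case False
  then have x: "0 < x" using that by simp
  then have "ln (1 / x) \<le> 1 / x - 1" by (intro ln_le_minus_one) simp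
  then have "x * ln (1 / x) \<le> x * (1 / x - 1)" using x by (intro mult_left_mono) auto
  then show ?thesis using x by (simp add: ln_div right_diff_distrib)
qed simp

text \<open>
  The Fenchel-Young inequality for \<open>t ln t - t\<close> and its conjugate, the exponential.
\<close>

lemma x_ln_x_Young: "x * b \<le> x * ln x - x + exp b" if "0 \<le> x" for x b :: real
proof (cases "x = 0")
  case False
  then have x: "0 < x" using that by simp
  have "1 + (b - ln x) \<le> exp (b - ln x)" by (rule exp_ge_add_one_self)
  also have "\<dots> = exp b / x" using x by (simp add: exp_diff)
  finally have "x * (1 + (b - ln x)) \<le> x * (exp b / x)" using x by (intro mult_left_mono) auto
  then show ?thesis using x by (simp add: algebra_simps)
qed simp

text \<open>
  Truncation to \<open>[1 / (n + 1), n + 1]\<close>. It makes a density bounded from both sides and its logarithm a bounded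
  test function.
\<close>

definition clip :: "nat \<Rightarrow> real \<Rightarrow> real" where
  "clip n y = max (1 / real (Suc n)) (min (real (Suc n)) y)"

lemma clip_measurable[measurable]: "clip n \<in> borel_measurable borel"
  unfolding clip_def[abs_def] by measurable

lemma clip_bounds: "1 / real (Suc n) \<le> clip n y" "clip n y \<le> real (Suc n)"
  by (auto simp: clip_def field_simps)

lemma clip_le: "0 \<le> y \<Longrightarrow> clip n y \<le> y + 1"
proof -
  assume "0 \<le> y"
  moreover have "1 / real (Suc n) \<le> 1" by simp
  ultimately show ?thesis unfolding clip_def by linarith
qed

lemma clip_tendsto: assumes "0 \<le> y" shows "(\<lambda>n. clip n y) \<longlonglongrightarrow> y"
proof -
  obtain m :: nat where m: "y \<le> real m" using real_arch_simple by blast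
  have "(\<lambda>n. max (1 / real (Suc n)) y) \<longlonglongrightarrow> max 0 y"
    by (intro tendsto_max tendsto_const) real_asymp
  moreover have "\<forall>\<^sub>F n in sequentially. max (1 / real (Suc n)) y = clip n y"
    using m by (intro eventually_sequentiallyI[of m]) (auto simp: clip_def min_def)
  ultimately show ?thesis using assms by (simp add: tendsto_cong)
qed

lemma abs_clip_ln_clip_le:
  assumes "0 \<le> y" shows "\<bar>clip n y * ln (clip n y)\<bar> \<le> \<bar>y * ln y\<bar> + 1"
proof -
  have pos: "0 < clip n y" using clip_bounds(1)[of n y] by (auto intro: less_le_trans[rotated])
  consider "clip n y = y" | "clip n y = 1 / real (Suc n)" | "clip n y = real (Suc n)" "real (Suc n) \<le> y"
    unfolding clip_def by linarith
  then show ?thesis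
  proof cases
    case 2
    then have "clip n y \<le> 1" by simp
    then have "clip n y * ln (clip n y) \<le> 0" using pos by (intro mult_nonneg_nonpos) auto
    then show ?thesis using x_ln_x_ge[of "clip n y"] pos by linarith
  next
    case 3
    then have "0 \<le> clip n y * ln (clip n y)" by (simp del: of_nat_Suc)
    moreover have "clip n y * ln (clip n y) \<le> y * ln y"
      using 3 pos by (intro mult_mono) (auto simp del: of_nat_Suc)
    ultimately show ?thesis by linarith
  qed simp
qed

lemma (in prob_space) density_of_absolutely_continuous:
  assumes "finite_measure N" "absolutely_continuous M N" "sets N = sets M"
  obtains r :: "'a \<Rightarrow> real" where "r \<in> borel_measurable M" "\<And>x. 0 \<le> r x" "N = density M r"
proof -
  obtain D where D: "D \<in> borel_measurable M" "AE x in M. RN_deriv M N x = ennreal (D x)" "\<And>x. 0 \<le> D x"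
    using real_RN_deriv[OF assms] by metis
  have "N = density M (RN_deriv M N)" using density_RN_deriv[OF assms(2,3)] by simp
  also have "\<dots> = density M D" using D by (intro density_cong) auto
  finally show ?thesis using that D by blast
qed

text \<open>
  If \<open>A\<close> is a null set of \<open>M\<close>, the test functions \<open>t * indicator A\<close> with large \<open>t\<close> force \<open>A\<close> to be a null set of
  \<open>N\<close>. So \<open>N\<close> has a density \<open>r\<close>. The optimal test function would be \<open>ln r\<close>, which is unbounded; Fatou's lemma
  passes to the limit in the truncations \<open>ln (clip n r)\<close>.
\<close>

lemma (in prob_space) entropy_le_if_dual:
  assumes "prob_space N" and sets[measurable_cong]: "sets N = sets M"
    and dual: "\<And>f D. f \<in> borel_measurable M \<Longrightarrow> (\<And>x. x \<in> space M \<Longrightarrow> \<bar>f x\<bar> \<le> D) \<Longrightarrow>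
      (\<integral>x. f x \<partial>N) \<le> ln (\<integral>x. exp (f x) \<partial>M) + B"
  obtains r :: "'a \<Rightarrow> real" where "r \<in> borel_measurable M" "\<And>x. 0 \<le> r x" "N = density M r"
    "integrable M (\<lambda>x. r x * ln (r x))" "(\<integral>x. r x * ln (r x) \<partial>M) \<le> B"
proof -
  interpret N: prob_space N by fact
  have ac: "absolutely_continuous M N"
    unfolding absolutely_continuous_def
  proof
    fix A assume A: "A \<in> null_sets M"
    then have [measurable]: "A \<in> sets M" by auto
    have bound: "t * N.prob A \<le> B" if "0 \<le> t" for t
    proof -
      have "(\<integral>x. t * indicator A x \<partial>N) \<le> ln (\<integral>x. exp (t * indicator A x) \<partial>M) + B"
        using that by (intro dual[of _ t]) (auto simp: indicator_def)
      also have "(\<integral>x. exp (t * indicator A x) \<partial>M) = (\<integral>x. 1 \<partial>M)"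
      proof (rule integral_cong_AE)
        show "AE x in M. exp (t * indicator A x) = 1" using AE_not_in[OF A] by eventually_elim simp
      qed measurable
      finally show ?thesis by (simp add: prob_space sets)
    qed
    have "N.prob A = 0"
    proof (rule ccontr)
      assume "N.prob A \<noteq> 0"
      then have pos: "0 < N.prob A" by (simp add: zero_less_measure_iff)
      have "(\<bar>B\<bar> + 1) / N.prob A * N.prob A \<le> B" using pos by (intro bound) auto
      then show False using pos by simp
    qed
    then show "A \<in> null_sets N" using sets by (auto simp: null_sets_def N.emeasure_eq_measure)
  qed
  obtain r :: "'a \<Rightarrow> real" where r[measurable]: "r \<in> borel_measurable M" and r0: "\<And>x. 0 \<le> r x" and N: "N = density M r"
    by (rule density_of_absolutely_continuous[OF N.finite_measure_axioms ac sets]) (rule that)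
  have B0: "0 \<le> B" using dual[of "\<lambda>_. 0" 0] by (simp add: prob_space)
  have "(\<integral>\<^sup>+x. r x \<partial>M) = 1"
    using N.emeasure_space_1 unfolding N by (simp add: emeasure_density)
  then have ir: "integrable M r" and r1: "(\<integral>x. r x \<partial>M) = 1"
    using r0 by (auto intro!: integrableI_nonneg simp: integral_eq_nn_integral)
  define k where "k n x = clip n (r x)" for n x
  have [measurable]: "k n \<in> borel_measurable M" for n unfolding k_def[abs_def] by measurable
  have kb: "1 / real (Suc n) \<le> k n x" "k n x \<le> real (Suc n)" for n x
    unfolding k_def by (rule clip_bounds)+
  have k0: "0 < k n x" for n x using kb(1)[of n x] by (auto intro: less_le_trans[rotated])
  have lnk: "\<bar>ln (k n x)\<bar> \<le> ln (real (Suc n))" for n x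
  proof -
    have "ln (1 / real (Suc n)) \<le> ln (k n x)" "ln (k n x) \<le> ln (real (Suc n))"
      using kb[of n x] k0[of n x] by (auto simp del: of_nat_Suc)
    then show ?thesis by (simp add: ln_div del: of_nat_Suc)
  qed
  have irk: "integrable M (\<lambda>x. r x * ln (k n x))" for n
    using lnk by (intro integrable_bounded_mult(1)[OF ir, where B="ln (real (Suc n))"]) auto
  \<comment> \<open>A lower bound independent of \<open>n\<close>, as needed for Fatou's lemma.\<close>
  have low: "- 1 \<le> r x * ln (k n x)" for n x
  proof (cases "r x < 1")
    case True
    have "r x * ln (r x) \<le> r x * ln (k n x)"
    proof (cases "r x = 0")
      case False
      then have "0 < r x" using r0[of x] by simp
      moreover have "r x \<le> k n x" using True by (simp add: k_def clip_def)
      ultimately show ?thesis by (intro mult_left_mono) auto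
    qed simp
    then show ?thesis using x_ln_x_ge[OF r0[of x]] by linarith
  next
    case False
    then have "1 \<le> k n x" by (auto simp: k_def clip_def le_max_iff_disj)
    then have "0 \<le> r x * ln (k n x)" using r0 by (intro mult_nonneg_nonneg ln_ge_zero) auto
    then show ?thesis by simp
  qed
  have step: "(\<integral>\<^sup>+x. ennreal (r x * ln (k n x) + 1) \<partial>M) \<le> ennreal (B + ln (1 + 1 / real (Suc n)) + 1)" for n
  proof -
    have "(\<integral>x. ln (k n x) \<partial>N) \<le> ln (\<integral>x. exp (ln (k n x)) \<partial>M) + B"
      using lnk by (intro dual[of _ "ln (real (Suc n))"]) auto
    also have "(\<integral>x. ln (k n x) \<partial>N) = (\<integral>x. r x * ln (k n x) \<partial>M)"
      unfolding N using r0 by (subst integral_density) auto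
    also have "ln (\<integral>x. exp (ln (k n x)) \<partial>M) \<le> ln (1 + 1 / real (Suc n))"
    proof -
      have ik: "integrable M (k n)" using kb k0 by (intro integrable_const_bound[where B="real (Suc n)"]) (auto simp: less_imp_le)
      have "(\<integral>x. k n x \<partial>M) \<le> (\<integral>x. r x + 1 / real (Suc n) \<partial>M)"
      proof (rule integral_mono)
        show "k n x \<le> r x + 1 / real (Suc n)" for x
        proof -
          have "0 < 1 / real (Suc n)" by simp
          then show ?thesis using r0[of x] unfolding k_def clip_def by linarith
        qed
      qed (use ik ir in auto)
      moreover have "1 / real (Suc n) \<le> (\<integral>x. k n x \<partial>M)" using kb by (intro integral_ge_const ik) auto
      then have "0 < (\<integral>x. k n x \<partial>M)" by (auto intro: less_le_trans[rotated])
      ultimately show ?thesis using k0 ir r1 by (simp add: prob_space)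
    qed
    finally have "(\<integral>x. r x * ln (k n x) \<partial>M) + 1 \<le> B + ln (1 + 1 / real (Suc n)) + 1" by simp
    moreover have "(\<integral>\<^sup>+x. ennreal (r x * ln (k n x) + 1) \<partial>M) = ennreal ((\<integral>x. r x * ln (k n x) \<partial>M) + 1)"
    proof (subst nn_integral_eq_integral)
      show "AE x in M. 0 \<le> r x * ln (k n x) + 1" proof (rule AE_I2)
        show "0 \<le> r x * ln (k n x) + 1" for x using low[of x n] by linarith
      qed
    qed (use irk[of n] in \<open>auto simp: prob_space\<close>)
    ultimately show ?thesis by (simp add: ennreal_leI)
  qed
  have conv: "(\<lambda>n. r x * ln (k n x) + 1) \<longlonglongrightarrow> r x * ln (r x) + 1" for x
  proof (cases "r x = 0")
    case False
    then show ?thesis using clip_tendsto[OF r0[of x]] unfolding k_def by (intro tendsto_intros) auto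
  qed simp
  have "(\<integral>\<^sup>+x. ennreal (r x * ln (r x) + 1) \<partial>M) = (\<integral>\<^sup>+x. liminf (\<lambda>n. ennreal (r x * ln (k n x) + 1)) \<partial>M)"
    by (intro nn_integral_cong) (simp add: lim_imp_Liminf[OF _ tendsto_ennrealI[OF conv]])
  also have "\<dots> \<le> liminf (\<lambda>n. \<integral>\<^sup>+x. ennreal (r x * ln (k n x) + 1) \<partial>M)"
    by (rule nn_integral_liminf) measurable
  also have "\<dots> \<le> liminf (\<lambda>n. ennreal (B + ln (1 + 1 / real (Suc n)) + 1))"
    using step by (intro Liminf_mono) auto
  also have "\<dots> = ennreal (B + 1)"
  proof (rule lim_imp_Liminf)
    have "(\<lambda>n. B + ln (1 + 1 / real (Suc n)) + 1) \<longlonglongrightarrow> B + 1" by real_asymp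
    then show "(\<lambda>n. ennreal (B + ln (1 + 1 / real (Suc n)) + 1)) \<longlonglongrightarrow> ennreal (B + 1)" by (rule tendsto_ennrealI)
  qed simp
  finally have fin: "(\<integral>\<^sup>+x. ennreal (r x * ln (r x) + 1) \<partial>M) \<le> ennreal (B + 1)" .
  have pos: "0 \<le> r x * ln (r x) + 1" for x using x_ln_x_ge[OF r0[of x]] by simp
  have i1: "integrable M (\<lambda>x. r x * ln (r x) + 1)"
    using pos fin by (intro integrableI_nonneg) (auto intro: le_less_trans)
  then have "integrable M (\<lambda>x. (r x * ln (r x) + 1) - 1)" by (intro Bochner_Integration.integrable_diff) auto
  then have i2: "integrable M (\<lambda>x. r x * ln (r x))" by simp
  have "(\<integral>x. r x * ln (r x) + 1 \<partial>M) \<le> B + 1"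
  proof -
    have "ennreal (\<integral>x. r x * ln (r x) + 1 \<partial>M) \<le> ennreal (B + 1)"
      using fin pos nn_integral_eq_integral[OF i1] by simp
    then show ?thesis using B0 by (subst (asm) ennreal_le_iff) auto
  qed
  then have "(\<integral>x. r x * ln (r x) \<partial>M) \<le> B" using i2 by (simp add: prob_space)
  then show ?thesis using that r r0 N i2 by blast
qed

lemma ext_integral_integrable: "integrable M f \<Longrightarrow> ext_integral M f = ereal (\<integral>x. f x \<partial>M)"
proof -
  assume f: "integrable M f"
  have "enn2ereal x = ereal (enn2real x)" if "x \<noteq> \<infinity>" for x
    using that by (cases x) (auto simp: enn2ereal_ennreal)
  then show ?thesis using f
    by (simp add: ext_integral_def real_lebesgue_integral_def real_integrable_def)
qed

section \<open>Relative entropy with respect to a Gaussian law\<close>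

definition gauss_pdf :: "real \<Rightarrow> real ^ 'n \<Rightarrow> real" where
  "gauss_pdf v x = (2 * pi * v) powr (- real CARD('n) / 2) * exp (- (norm x)\<^sup>2 / (2 * v))"

lemma gaussian_pdf: "gaussian v = density lborel (\<lambda>x. ennreal (gauss_pdf v x))"
  by (simp add: gaussian_def gauss_pdf_def)

lemma sets_gaussian[simp, measurable_cong]: "sets (gaussian v) = sets borel"
  by (simp add: gaussian_def)

lemma space_gaussian[simp]: "space (gaussian v) = UNIV"
  by (simp add: gaussian_def)

lemma gauss_pdf_measurable[measurable]: "gauss_pdf v \<in> borel_measurable borel"
  unfolding gauss_pdf_def[abs_def] by measurable

lemma gauss_pdf_pos: "0 < v \<Longrightarrow> 0 < gauss_pdf v x"
  by (simp add: gauss_pdf_def)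

lemma gauss_pdf_nonneg[simp]: "0 \<le> gauss_pdf v x"
  by (simp add: gauss_pdf_def)

lemma ln_gauss_pdf:
  fixes x :: "real ^ 'n"
  assumes "0 < v"
  shows "ln (gauss_pdf v x) = - real CARD('n) / 2 * ln (2 * pi * v) - (norm x)\<^sup>2 / (2 * v)"
  using assms by (simp add: gauss_pdf_def ln_mult ln_powr)

lemma prob_space_gaussian:
  assumes "0 < v" shows "prob_space (gaussian v :: (real ^ 'n) measure)"
proof -
  let ?P = "\<Pi>\<^sub>M i\<in>(Basis :: (real ^ 'n) set). normal_law (sqrt v)"
  have s: "0 < sqrt v" using assms by simp
  interpret P: prob_space ?P by (intro prob_space_PiM prob_space_normal_density s)
  have "coord_sum \<in> measurable ?P (borel :: (real ^ 'n) measure)"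
    by (intro borel_measurable_sum borel_measurable_scaleR) (auto cong: measurable_cong_sets)
  then show ?thesis using gaussian_eq_distr[OF s, where 'n='n] assms P.prob_space_distr[of coord_sum borel] by simp
qed

text \<open>
  Multiplied by this exponential, the Gaussian density of variance \<open>v\<close> becomes a multiple of the Gaussian
  density of variance \<open>2 v\<close>.
\<close>

lemma integrable_gaussian_exp:
  assumes v: "0 < v"
  shows "integrable (gaussian v) (\<lambda>x::real ^ 'n. exp ((norm x)\<^sup>2 / (4 * v)))"
proof -
  let ?c = "2 powr (real CARD('n) / 2)"
  interpret G2: prob_space "gaussian (2 * v) :: (real ^ 'n) measure" using v by (intro prob_space_gaussian) simp
  have eq: "exp ((norm x)\<^sup>2 / (4 * v)) * gauss_pdf v x = ?c * gauss_pdf (2 * v) x" for x :: "real ^ 'n"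
  proof -
    have "(norm x)\<^sup>2 / (4 * v) + - (norm x)\<^sup>2 / (2 * v) = - (norm x)\<^sup>2 / (2 * (2 * v))"
      using v by (simp add: field_simps)
    then have A: "exp ((norm x)\<^sup>2 / (4 * v)) * exp (- (norm x)\<^sup>2 / (2 * v)) = exp (- (norm x)\<^sup>2 / (2 * (2 * v)))"
      by (simp only: exp_add[symmetric])
    have B: "(2 * pi * v) powr (- real CARD('n) / 2) = ?c * (2 * pi * (2 * v)) powr (- real CARD('n) / 2)"
    proof -
      have "(2 * pi * (2 * v)) = 2 * (2 * pi * v)" by simp
      then have "(2 * pi * (2 * v)) powr (- real CARD('n) / 2) = 2 powr (- real CARD('n) / 2) * (2 * pi * v) powr (- real CARD('n) / 2)"
        using v by (simp only: powr_mult)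
      moreover have "?c * 2 powr (- real CARD('n) / 2) = 1" by (simp flip: powr_add)
      ultimately show ?thesis by (simp only: mult.assoc[symmetric])
    qed
    show ?thesis unfolding gauss_pdf_def A[symmetric] B by (simp only: mult_ac)
  qed
  have "integrable (gaussian (2 * v) :: (real ^ 'n) measure) (\<lambda>_. ?c)" by simp
  then have "integrable lborel (\<lambda>x::real ^ 'n. gauss_pdf (2 * v) x * ?c)"
    using v unfolding gaussian_pdf by (subst (asm) integrable_density) (auto intro: less_imp_le gauss_pdf_pos)
  then have "integrable lborel (\<lambda>x::real ^ 'n. gauss_pdf v x * exp ((norm x)\<^sup>2 / (4 * v)))"
    using eq by (simp add: mult.commute)
  then show ?thesis
    using v unfolding gaussian_pdf by (subst integrable_density) (auto intro: less_imp_le gauss_pdf_pos)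
qed

text \<open>
  Finite entropy implies a finite second moment, by the Fenchel-Young inequality with
  \<open>b = (norm x)\<^sup>2 / (4 v)\<close>.
\<close>

lemma integrable_gaussian_norm_sq:
  assumes v: "0 < v" and [measurable]: "p \<in> borel_measurable borel" and p0: "\<And>x. 0 \<le> p x"
    and p: "integrable (gaussian v) p" "integrable (gaussian v) (\<lambda>x. p x * ln (p x))"
  shows "integrable (gaussian v) (\<lambda>x::real ^ 'n. p x * (norm x)\<^sup>2)"
proof -
  have "integrable (gaussian v) (\<lambda>x::real ^ 'n. 4 * v * (p x * ln (p x) - p x + exp ((norm x)\<^sup>2 / (4 * v))))"
    by (intro integrable_mult_right Bochner_Integration.integrable_add Bochner_Integration.integrable_diff
        p integrable_gaussian_exp v)
  then show ?thesis
  proof (rule Bochner_Integration.integrable_bound)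
    show "AE x in gaussian v. norm (p x * (norm x)\<^sup>2) \<le> norm (4 * v * (p x * ln (p x) - p x + exp ((norm x)\<^sup>2 / (4 * v))))"
    proof (rule AE_I2)
      fix x :: "real ^ 'n"
      have "4 * v * (p x * ((norm x)\<^sup>2 / (4 * v))) \<le> 4 * v * (p x * ln (p x) - p x + exp ((norm x)\<^sup>2 / (4 * v)))"
        using v by (intro mult_left_mono x_ln_x_Young p0) simp
      moreover have "4 * v * (p x * ((norm x)\<^sup>2 / (4 * v))) = p x * (norm x)\<^sup>2" using v by simp
      moreover have "0 \<le> p x * (norm x)\<^sup>2" using p0 by simp
      ultimately show "norm (p x * (norm x)\<^sup>2) \<le> norm (4 * v * (p x * ln (p x) - p x + exp ((norm x)\<^sup>2 / (4 * v))))"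
        unfolding real_norm_def by linarith
    qed
  qed measurable
qed

text \<open>
  The relative entropy is defined through Lebesgue densities, as a difference of two integrals. The second
  moment is finite, so both integrals are, and their difference is the entropy of the density with respect
  to the Gaussian law.
\<close>

lemma rel_entropy_gaussian_density:
  fixes p :: "real ^ 'n \<Rightarrow> real"
  assumes v: "0 < v" and [measurable]: "p \<in> borel_measurable borel" and p0: "\<And>x. 0 \<le> p x"
    and prob: "prob_space (density (gaussian v) p)" and pln: "integrable (gaussian v) (\<lambda>x. p x * ln (p x))"
  shows "rel_entropy (density (gaussian v) p) (gaussian v) = ereal (\<integral>x. p x * ln (p x) \<partial>gaussian v)"
proof -
  let ?G = "gaussian v :: (real ^ 'n) measure" and ?h = "gauss_pdf v :: real ^ 'n \<Rightarrow> real"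
  interpret M: prob_space "density ?G p" by fact
  have h0: "0 < ?h x" for x using v by (rule gauss_pdf_pos)
  have "(\<integral>\<^sup>+x. ennreal (p x) \<partial>?G) = 1" using M.emeasure_space_1 by (simp add: emeasure_density)
  then have p: "integrable ?G p" using p0 by (intro integrableI_nonneg) auto
  have G: "integrable ?G f \<longleftrightarrow> integrable lborel (\<lambda>x. ?h x * f x)" "(\<integral>x. f x \<partial>?G) = (\<integral>x. ?h x * f x \<partial>lborel)"
    if "f \<in> borel_measurable borel" for f :: "real ^ 'n \<Rightarrow> real"
    unfolding gaussian_pdf using that h0 by (auto simp: integrable_density integral_density less_imp_le)
  have M: "density ?G p = density lborel (\<lambda>x. ennreal (p x * ?h x))"
    unfolding gaussian_pdf using p0 h0
    by (subst density_density_eq) (auto simp: ennreal_mult less_imp_le mult.commute)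
  have cross: "integrable lborel (\<lambda>x. p x * ?h x * ln (?h x))"
  proof -
    have "integrable ?G (\<lambda>x. - real CARD('n) / 2 * ln (2 * pi * v) * p x - (p x * (norm x)\<^sup>2) / (2 * v))"
      using p integrable_gaussian_norm_sq[OF v _ p0 p pln] by simp
    then have "integrable lborel (\<lambda>x. ?h x * (- real CARD('n) / 2 * ln (2 * pi * v) * p x - (p x * (norm x)\<^sup>2) / (2 * v)))"
      by (subst (asm) G) auto
    also have "(\<lambda>x. ?h x * (- real CARD('n) / 2 * ln (2 * pi * v) * p x - (p x * (norm x)\<^sup>2) / (2 * v))) = (\<lambda>x. p x * ?h x * ln (?h x))"
      unfolding ln_gauss_pdf[OF v] by (simp add: fun_eq_iff algebra_simps)
    finally show ?thesis .
  qed
  have split: "p x * ?h x * ln (p x * ?h x) = ?h x * (p x * ln (p x)) + p x * ?h x * ln (?h x)" for x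
  proof (cases "p x = 0")
    case False
    then have "0 < p x" using p0[of x] by simp
    then show ?thesis using h0[of x] by (simp add: ln_mult algebra_simps)
  qed simp
  have plnl: "integrable lborel (\<lambda>x. ?h x * (p x * ln (p x)))" using pln by (subst (asm) G) auto
  have gg: "integrable lborel (\<lambda>x. p x * ?h x * ln (p x * ?h x))" unfolding split using plnl cross by simp
  have "rel_entropy (density ?G p) ?G = ext_integral lborel (\<lambda>x. p x * ?h x * ln (p x * ?h x)) - ext_integral lborel (\<lambda>x. p x * ?h x * ln (?h x))"
    unfolding M unfolding gaussian_pdf using p0 h0 by (intro rel_entropy_density) (auto simp: less_imp_le)
  also have "\<dots> = ereal ((\<integral>x. ?h x * (p x * ln (p x)) + p x * ?h x * ln (?h x) \<partial>lborel) - (\<integral>x. p x * ?h x * ln (?h x) \<partial>lborel))"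
    using gg cross by (simp add: ext_integral_integrable split)
  also have "\<dots> = ereal (\<integral>x. p x * ln (p x) \<partial>?G)" using plnl cross by (subst G) auto
  finally show ?thesis .
qed

text \<open>
  A value below \<open>\<infinity>\<close> excludes all the infinite cases in the definition, one after the other: absolute
  continuity fails, the cross term is infinite, or the integral of \<open>g ln g\<close> is infinite.
\<close>

lemma rel_entropy_gaussian_finite:
  fixes M :: "(real ^ 'n) measure"
  assumes v: "0 < v" and "prob_space M" and sets: "sets M = sets borel" and fin: "rel_entropy M (gaussian v) < \<infinity>"
  obtains p :: "real ^ 'n \<Rightarrow> real" where "p \<in> borel_measurable borel" "\<And>x. 0 \<le> p x" "M = density (gaussian v) p"
    "integrable (gaussian v) (\<lambda>x. p x * ln (p x))" "rel_entropy M (gaussian v) = ereal (\<integral>x. p x * ln (p x) \<partial>gaussian v)"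
proof -
  let ?G = "gaussian v :: (real ^ 'n) measure" and ?h = "gauss_pdf v :: real ^ 'n \<Rightarrow> real"
  interpret M: prob_space M by fact
  interpret G: prob_space ?G using v by (rule prob_space_gaussian)
  have h0: "0 < ?h x" for x using v by (rule gauss_pdf_pos)
  have "absolutely_continuous ?G M"
    using fin unfolding rel_entropy_def by (auto split: if_splits)
  then obtain p :: "real ^ 'n \<Rightarrow> real" where "p \<in> borel_measurable ?G" and p0: "\<And>x. 0 \<le> p x" and Mp: "M = density ?G p"
    using G.density_of_absolutely_continuous[OF M.finite_measure_axioms] sets by (metis sets_gaussian)
  then have [measurable]: "p \<in> borel_measurable borel" by simp
  have "(\<integral>\<^sup>+x. ennreal (p x) \<partial>?G) = 1" using M.emeasure_space_1 by (simp add: emeasure_density Mp)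
  then have p1: "(\<integral>\<^sup>+x. ennreal (p x * ?h x) \<partial>lborel) = 1"
    using p0 h0 unfolding gaussian_pdf by (simp add: nn_integral_density ennreal_mult less_imp_le mult.commute)
  have M: "M = density lborel (\<lambda>x. ennreal (p x * ?h x))"
    unfolding Mp gaussian_pdf using p0 h0
    by (subst density_density_eq) (auto simp: ennreal_mult less_imp_le mult.commute)
  let ?X = "\<lambda>x. p x * ?h x * ln (p x * ?h x)" and ?Y = "\<lambda>x. p x * ?h x * ln (?h x)"
  define c where "c = \<bar>- real CARD('n) / 2 * ln (2 * pi * v)\<bar>"
  have rel: "rel_entropy M ?G = ext_integral lborel ?X - ext_integral lborel ?Y"
    unfolding M unfolding gaussian_pdf using p0 h0 by (intro rel_entropy_density) (auto simp: less_imp_le)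
  have "(\<integral>\<^sup>+x. ennreal (?Y x) \<partial>lborel) \<le> (\<integral>\<^sup>+x. ennreal c * ennreal (p x * ?h x) \<partial>lborel)"
  proof (rule nn_integral_mono)
    fix x :: "real ^ 'n"
    have "ln (?h x) \<le> c" using v by (simp add: ln_gauss_pdf c_def) (smt (verit) divide_nonneg_pos zero_le_power2)
    then have "?Y x \<le> p x * ?h x * c" using p0[of x] h0[of x] by (intro mult_left_mono) auto
    then show "ennreal (?Y x) \<le> ennreal c * ennreal (p x * ?h x)"
      by (simp add: c_def mult.commute flip: ennreal_mult' ennreal_mult'') (simp add: ennreal_leI)
  qed
  also have "\<dots> = ennreal c" using p1 by (simp add: nn_integral_cmult)
  finally have Yp: "(\<integral>\<^sup>+x. ennreal (?Y x) \<partial>lborel) \<noteq> \<infinity>" by (auto simp: top_unique)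
  \<comment> \<open>An infinite cross term would make the entropy infinite whatever the other integral is, by the convention
    \<open>\<infinity> - \<infinity> = \<infinity>\<close>.\<close>
  have Yn: "(\<integral>\<^sup>+x. ennreal (- ?Y x) \<partial>lborel) \<noteq> \<infinity>"
  proof
    assume "(\<integral>\<^sup>+x. ennreal (- ?Y x) \<partial>lborel) = \<infinity>"
    then have "ext_integral lborel ?Y = - \<infinity>"
      using Yp by (cases "\<integral>\<^sup>+x. ennreal (?Y x) \<partial>lborel") (auto simp: ext_integral_def enn2ereal_ennreal)
    then show False using rel fin by simp
  qed
  have Y: "integrable lborel ?Y" using Yp Yn by (simp add: real_integrable_def)
  \<comment> \<open>The negative part of \<open>g ln g\<close> is finite because \<open>t ln t \<ge> - 1\<close>.\<close>
  have "integrable lborel (\<lambda>x. - ?Y x + ?h x)"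
    using Y G.integrable_const[of "1::real"] h0 unfolding gaussian_pdf
    by (subst (asm) integrable_density) (auto simp: less_imp_le)
  then have "(\<integral>\<^sup>+x. ennreal (- ?Y x + ?h x) \<partial>lborel) \<noteq> \<infinity>" by (simp add: real_integrable_def)
  moreover have "(\<integral>\<^sup>+x. ennreal (- ?X x) \<partial>lborel) \<le> (\<integral>\<^sup>+x. ennreal (- ?Y x + ?h x) \<partial>lborel)"
  proof (intro nn_integral_mono ennreal_leI)
    fix x :: "real ^ 'n"
    show "- ?X x \<le> - ?Y x + ?h x"
    proof (cases "p x = 0")
      case False
      then have "?X x = ?h x * (p x * ln (p x)) + ?Y x" using p0[of x] h0[of x] by (simp add: ln_mult algebra_simps)
      moreover have "?h x * (- 1) \<le> ?h x * (p x * ln (p x))" using x_ln_x_ge[OF p0[of x]] h0[of x] by (intro mult_left_mono) auto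
      ultimately show ?thesis by simp
    qed (use h0[of x] in simp)
  qed
  ultimately have Xn: "(\<integral>\<^sup>+x. ennreal (- ?X x) \<partial>lborel) \<noteq> \<infinity>" by (auto simp: top_unique)
  have Xp: "(\<integral>\<^sup>+x. ennreal (?X x) \<partial>lborel) \<noteq> \<infinity>"
  proof
    assume "(\<integral>\<^sup>+x. ennreal (?X x) \<partial>lborel) = \<infinity>"
    then have "ext_integral lborel ?X = \<infinity>"
      using Xn by (cases "\<integral>\<^sup>+x. ennreal (- ?X x) \<partial>lborel") (auto simp: ext_integral_def enn2ereal_ennreal)
    then show False using rel fin ext_integral_integrable[OF Y] by simp
  qed
  have X: "integrable lborel ?X" using Xp Xn by (simp add: real_integrable_def)
  have eq: "?X x - ?Y x = ?h x * (p x * ln (p x))" for x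
  proof (cases "p x = 0")
    case False
    then show ?thesis using p0[of x] h0[of x] by (simp add: ln_mult algebra_simps)
  qed simp
  have "integrable lborel (\<lambda>x. ?X x - ?Y x)" using X Y by simp
  then have int: "integrable ?G (\<lambda>x. p x * ln (p x))"
    unfolding eq gaussian_pdf using h0 by (subst integrable_density) (auto simp: less_imp_le)
  moreover have "rel_entropy M ?G = ereal (\<integral>x. p x * ln (p x) \<partial>?G)"
    using M.prob_space_axioms unfolding Mp by (intro rel_entropy_gaussian_density v p0 int) auto
  ultimately show ?thesis using p0 Mp by (intro that[of p]) simp_all
qed

section \<open>Entropy of a sum of independent vectors\<close>

lemma integrable_inner_pair:
  fixes M1 M2 :: "'e::euclidean_space measure"
  assumes "prob_space M1" "prob_space M2" and [measurable_cong]: "sets M1 = sets borel" "sets M2 = sets borel"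
    and [measurable]: "g \<in> borel_measurable borel" "h \<in> borel_measurable borel"
    and g: "integrable M1 (\<lambda>x. norm x * g x)" and h: "integrable M2 (\<lambda>x. norm x * h x)"
  shows "integrable (M1 \<Otimes>\<^sub>M M2) (\<lambda>z. (fst z \<bullet> snd z) * (g (fst z) * h (snd z)))"
proof -
  interpret M1: prob_space M1 by fact
  interpret M2: prob_space M2 by fact
  interpret P: pair_prob_space M1 M2 ..
  show ?thesis
  proof (rule Bochner_Integration.integrable_bound[OF P.integral_pair_mult(1)[OF g h]])
    have "\<bar>(x \<bullet> y) * (g x * h y)\<bar> \<le> \<bar>norm x * g x * (norm y * h y)\<bar>" for x y :: 'e
    proof -
      have "\<bar>x \<bullet> y\<bar> * (\<bar>g x\<bar> * \<bar>h y\<bar>) \<le> (norm x * norm y) * (\<bar>g x\<bar> * \<bar>h y\<bar>)"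
        by (intro mult_right_mono Cauchy_Schwarz_ineq2) auto
      then show ?thesis by (simp add: abs_mult mult_ac)
    qed
    then show "AE z in M1 \<Otimes>\<^sub>M M2. norm ((fst z \<bullet> snd z) * (g (fst z) * h (snd z))) \<le> norm (norm (fst z) * g (fst z) * (norm (snd z) * h (snd z)))"
      by simp
  qed measurable
qed

lemma integrable_gaussian_norm:
  assumes v: "0 < v" shows "integrable (gaussian v) (\<lambda>x::real ^ 'n. norm x)"
proof -
  interpret prob_space "gaussian v :: (real ^ 'n) measure" using v by (rule prob_space_gaussian)
  have "integrable (gaussian v) (\<lambda>x::real ^ 'n. 1 + 4 * v * exp ((norm x)\<^sup>2 / (4 * v)))"
    by (intro Bochner_Integration.integrable_add integrable_const integrable_mult_right integrable_gaussian_exp v)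
  then show ?thesis
  proof (rule Bochner_Integration.integrable_bound)
    have "norm (norm x) \<le> norm (1 + 4 * v * exp ((norm x)\<^sup>2 / (4 * v)))" for x :: "real ^ 'n"
    proof -
      have "(norm x)\<^sup>2 / (4 * v) \<le> exp ((norm x)\<^sup>2 / (4 * v))" using exp_ge_add_one_self[of "(norm x)\<^sup>2 / (4 * v)"] by linarith
      then have "4 * v * ((norm x)\<^sup>2 / (4 * v)) \<le> 4 * v * exp ((norm x)\<^sup>2 / (4 * v))" using v by (intro mult_left_mono) auto
      then have "(norm x)\<^sup>2 \<le> 4 * v * exp ((norm x)\<^sup>2 / (4 * v))" using v by simp
      moreover have "norm x \<le> 1 + (norm x)\<^sup>2"
        using zero_le_power2[of "norm x - 1"] norm_ge_zero[of x]
        by (simp add: power2_eq_square algebra_simps del: norm_ge_zero)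
      ultimately show ?thesis by simp
    qed
    then show "AE x in gaussian v. norm (norm (x::real ^ 'n)) \<le> norm (1 + 4 * v * exp ((norm x)\<^sup>2 / (4 * v)))" by simp
  qed measurable
qed

text \<open>
  The Shannon-Stam inequality. Truncation extends the dual inequality from bounded densities to
  the densities of \<open>M1\<close> and \<open>M2\<close>, and the variational principle turns it back into a bound on the entropy
  of the combination.
\<close>

theorem rel_entropy_combination_le:
  fixes M1 M2 :: "(real ^ 'n) measure"
  assumes v: "0 < v" and a: "0 < a" and b: "0 < b" and ab: "a\<^sup>2 + b\<^sup>2 = 1"
    and M1: "prob_space M1" "sets M1 = sets borel" "has_bochner_integral M1 (\<lambda>x. x) 0"
    and M2: "prob_space M2" "sets M2 = sets borel" "has_bochner_integral M2 (\<lambda>x. x) 0"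
    and d: "rel_entropy M1 (gaussian v) \<le> ereal d1" "rel_entropy M2 (gaussian v) \<le> ereal d2"
  shows "rel_entropy (distr (M1 \<Otimes>\<^sub>M M2) borel (\<lambda>z. a *\<^sub>R fst z + b *\<^sub>R snd z)) (gaussian v) \<le> ereal (a\<^sup>2 * d1 + b\<^sup>2 * d2)"
proof -
  let ?G = "gaussian v :: (real ^ 'n) measure"
  let ?m = "\<lambda>z. a *\<^sub>R fst z + b *\<^sub>R snd z :: real ^ 'n" and ?c = "\<lambda>z::(real ^ 'n) \<times> (real ^ 'n). a * b / v * (fst z \<bullet> snd z)"
  interpret M1: prob_space M1 by fact
  interpret M2: prob_space M2 by fact
  interpret P: pair_prob_space M1 M2 ..
  interpret G: prob_space ?G using v by (rule prob_space_gaussian)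
  interpret GG: pair_prob_space ?G ?G ..
  note [measurable_cong] = M1(2) M2(2)
  have fin: "rel_entropy M1 ?G < \<infinity>" "rel_entropy M2 ?G < \<infinity>" using d by (auto intro: le_less_trans)
  obtain p :: "real ^ 'n \<Rightarrow> real" where p[measurable]: "p \<in> borel_measurable borel" and p0: "\<And>x. 0 \<le> p x" and Mp: "M1 = density ?G p"
    and pl: "integrable ?G (\<lambda>x. p x * ln (p x))" and ep: "rel_entropy M1 ?G = ereal (\<integral>x. p x * ln (p x) \<partial>?G)"
    by (rule rel_entropy_gaussian_finite[OF v M1(1,2) fin(1)]) (rule that)
  obtain q :: "real ^ 'n \<Rightarrow> real" where q[measurable]: "q \<in> borel_measurable borel" and q0: "\<And>x. 0 \<le> q x" and Mq: "M2 = density ?G q"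
    and ql: "integrable ?G (\<lambda>x. q x * ln (q x))" and eq: "rel_entropy M2 ?G = ereal (\<integral>x. q x * ln (q x) \<partial>?G)"
    by (rule rel_entropy_gaussian_finite[OF v M2(1,2) fin(2)]) (rule that)
  have p1: "integrable ?G p" "(\<integral>x. p x \<partial>?G) = 1"
  proof -
    have "(\<integral>\<^sup>+x. p x \<partial>?G) = 1" using M1.emeasure_space_1 unfolding Mp by (simp add: emeasure_density)
    then show "integrable ?G p" "(\<integral>x. p x \<partial>?G) = 1" using p0 by (auto intro!: integrableI_nonneg simp: integral_eq_nn_integral)
  qed
  have q1: "integrable ?G q" "(\<integral>x. q x \<partial>?G) = 1"
  proof -
    have "(\<integral>\<^sup>+x. q x \<partial>?G) = 1" using M2.emeasure_space_1 unfolding Mq by (simp add: emeasure_density)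
    then show "integrable ?G q" "(\<integral>x. q x \<partial>?G) = 1" using q0 by (auto intro!: integrableI_nonneg simp: integral_eq_nn_integral)
  qed
  have pair: "M1 \<Otimes>\<^sub>M M2 = density (?G \<Otimes>\<^sub>M ?G) (\<lambda>z. ennreal (p (fst z) * q (snd z)))"
  proof -
    have "M1 \<Otimes>\<^sub>M M2 = density (?G \<Otimes>\<^sub>M ?G) (\<lambda>(x, y). ennreal (p x) * ennreal (q y))"
      unfolding Mp Mq using M2.sigma_finite_measure_axioms unfolding Mq
      by (intro pair_measure_density G.sigma_finite_measure_axioms) auto
    also have "(\<lambda>(x, y). ennreal (p x) * ennreal (q y)) = (\<lambda>z. ennreal (p (fst z) * q (snd z)))"
      using p0 q0 by (auto simp: ennreal_mult)
    finally show ?thesis .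
  qed
  have pair_int: "(\<integral>z. F z \<partial>(M1 \<Otimes>\<^sub>M M2)) = (\<integral>z. F z * (p (fst z) * q (snd z)) \<partial>(?G \<Otimes>\<^sub>M ?G))"
    if [measurable]: "F \<in> borel_measurable (borel \<Otimes>\<^sub>M borel)" for F :: "_ \<Rightarrow> real"
    unfolding pair using p0 q0 by (subst integral_density) (auto simp: mult.commute)

  have normM: "integrable M1 (\<lambda>x. norm x * 1)" "integrable M2 (\<lambda>x. norm x * 1)"
    using M1(3) M2(3) by (auto simp: has_bochner_integral_iff)
  \<comment> \<open>This is where the laws have to be centred.\<close>
  have cross: "(\<integral>z. ?c z * (p (fst z) * q (snd z)) \<partial>(?G \<Otimes>\<^sub>M ?G)) = 0"
  proof -
    have int: "integrable (M1 \<Otimes>\<^sub>M M2) (\<lambda>z. fst z \<bullet> snd z)"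
      using integrable_inner_pair[OF M1(1) M2(1) M1(2) M2(2) _ _ normM] by simp
    have "(\<integral>z. fst z \<bullet> snd z \<partial>(M1 \<Otimes>\<^sub>M M2)) = (\<integral>x. \<integral>y. x \<bullet> y \<partial>M2 \<partial>M1)"
      using P.integral_fst'[OF int] by simp
    also have "\<dots> = 0" using M2(3) by (simp add: has_bochner_integral_iff)
    finally have "(\<integral>z. ?c z \<partial>(M1 \<Otimes>\<^sub>M M2)) = 0" by simp
    then show ?thesis by (subst (asm) pair_int) auto
  qed
  have normG: "integrable ?G (\<lambda>x. norm x * (p x + 1))" "integrable ?G (\<lambda>x. norm x * (q x + 1))"
  proof -
    have "integrable ?G (\<lambda>x. p x *\<^sub>R norm x)" "integrable ?G (\<lambda>x. q x *\<^sub>R norm x)"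
      using normM p0 q0 unfolding Mp Mq by (auto simp: integrable_density)
    then show "integrable ?G (\<lambda>x. norm x * (p x + 1))" "integrable ?G (\<lambda>x. norm x * (q x + 1))"
      using integrable_gaussian_norm[OF v, where 'n='n] by (simp_all add: distrib_left mult.commute)
  qed
  have cint: "integrable (?G \<Otimes>\<^sub>M ?G) (\<lambda>z. ?c z * ((p (fst z) + 1) * (q (snd z) + 1)))"
    using integrable_inner_pair[OF G.prob_space_axioms G.prob_space_axioms sets_gaussian sets_gaussian _ _ normG]
    by (simp add: mult.assoc)

  have stable: "entropy_stable ?G ?m ?c (a\<^sup>2)"
    using gaussian_vec_entropy_stable[of "sqrt v" a b, where 'n='n] v a b ab by simp
  have dual: "dual_bound ?G ?m ?c (a\<^sup>2) f p q"
    if [measurable]: "f \<in> borel_measurable ?G" and fB: "\<And>x. x \<in> space ?G \<Longrightarrow> \<bar>f x\<bar> \<le> B" for f B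
  proof (rule dual_bound_limit[where P="\<lambda>n x. clip n (p x)" and Q="\<lambda>n x. clip n (q x)" and l="\<lambda>n. 1 / real (Suc n)" and C=1 and B=B])
    show "dual_bound ?G ?m ?c (a\<^sup>2) f (\<lambda>x. clip n (p x) / (\<integral>x. clip n (p x) \<partial>?G)) (\<lambda>x. clip n (q x) / (\<integral>x. clip n (q x) \<partial>?G))" for n
    proof -
      have "bounded_density ?G (\<lambda>x. clip n (p x) / (\<integral>x. clip n (p x) \<partial>?G))"
        by (rule G.bounded_density_normalise(2)[where l="1 / real (Suc n)" and u="real (Suc n)"]) (simp_all add: clip_bounds del: of_nat_Suc)
      moreover have "bounded_density ?G (\<lambda>x. clip n (q x) / (\<integral>x. clip n (q x) \<partial>?G))"
        by (rule G.bounded_density_normalise(2)[where l="1 / real (Suc n)" and u="real (Suc n)"]) (simp_all add: clip_bounds del: of_nat_Suc)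
      moreover have "\<exists>B. \<forall>x\<in>space ?G. \<bar>f x\<bar> \<le> B" using fB by blast
      ultimately show ?thesis using stable that(1) unfolding entropy_stable_def by blast
    qed
    show "prob_space ?G" by (rule G.prob_space_axioms)
    show "AE x in ?G. (\<lambda>n. clip n (p x)) \<longlonglongrightarrow> p x" "AE x in ?G. (\<lambda>n. clip n (q x)) \<longlonglongrightarrow> q x"
      using p0 q0 by (auto intro: clip_tendsto)
    show "integrable (?G \<Otimes>\<^sub>M ?G) (\<lambda>z. ?c z * ((p (fst z) + 1) * (q (snd z) + 1)))" by (rule cint)
    show "1 / real (Suc n) \<le> clip n (p x)" "1 / real (Suc n) \<le> clip n (q x)" for n x by (rule clip_bounds)+
    show "clip n (p x) \<le> p x + 1" "clip n (q x) \<le> q x + 1" for n x by (rule clip_le p0 q0)+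
    show "\<bar>clip n (p x) * ln (clip n (p x))\<bar> \<le> \<bar>p x * ln (p x)\<bar> + 1"
      "\<bar>clip n (q x) * ln (clip n (q x))\<bar> \<le> \<bar>q x * ln (q x)\<bar> + 1" for n x
      by (rule abs_clip_ln_clip_le p0 q0)+
  qed (use fB p0 q0 p1 q1 pl ql in simp_all)

  let ?B = "a\<^sup>2 * (\<integral>x. p x * ln (p x) \<partial>?G) + (1 - a\<^sup>2) * (\<integral>x. q x * ln (q x) \<partial>?G)"
  let ?M = "distr (M1 \<Otimes>\<^sub>M M2) borel ?m"
  have prob: "prob_space ?M" by (rule P.P.prob_space_distr) measurable
  have setsM: "sets ?M = sets ?G" by simp
  have dualM: "(\<integral>x. f x \<partial>?M) \<le> ln (\<integral>x. exp (f x) \<partial>?G) + ?B"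
    if f[measurable]: "f \<in> borel_measurable ?G" and fB: "\<And>x. x \<in> space ?G \<Longrightarrow> \<bar>f x\<bar> \<le> D" for f D
  proof -
    have "(\<integral>x. f x \<partial>?M) = (\<integral>z. f (?m z) \<partial>(M1 \<Otimes>\<^sub>M M2))" by (rule integral_distr) measurable
    also have "\<dots> = (\<integral>z. f (?m z) * (p (fst z) * q (snd z)) \<partial>(?G \<Otimes>\<^sub>M ?G))" by (rule pair_int) measurable
    also have "\<dots> \<le> ln (\<integral>x. exp (f x) \<partial>?G) + ?B"
      using dual[OF f fB] unfolding dual_bound_def cross by simp
    finally show ?thesis .
  qed
  obtain r :: "real ^ 'n \<Rightarrow> real" where r: "r \<in> borel_measurable ?G" "\<And>x. 0 \<le> r x" "?M = density ?G r"
      "integrable ?G (\<lambda>x. r x * ln (r x))" "(\<integral>x. r x * ln (r x) \<partial>?G) \<le> ?B"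
  proof (rule G.entropy_le_if_dual[OF prob setsM, of ?B])
    show "(\<integral>x. f x \<partial>?M) \<le> ln (\<integral>x. exp (f x) \<partial>?G) + ?B"
      if "f \<in> borel_measurable ?G" "\<And>x. x \<in> space ?G \<Longrightarrow> \<bar>f x\<bar> \<le> D" for f D
      using that by (rule dualM)
  qed (rule that)
  have "rel_entropy ?M ?G = ereal (\<integral>x. r x * ln (r x) \<partial>?G)"
    using r prob unfolding r(3) by (intro rel_entropy_gaussian_density v) auto
  also have "\<dots> \<le> ereal ?B" using r(5) by simp
  also have "\<dots> \<le> ereal (a\<^sup>2 * d1 + b\<^sup>2 * d2)"
  proof -
    have "(\<integral>x. p x * ln (p x) \<partial>?G) \<le> d1" "(\<integral>x. q x * ln (q x) \<partial>?G) \<le> d2" using d ep eq by auto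
    moreover have "b\<^sup>2 = 1 - a\<^sup>2" using ab by simp
    moreover have "0 \<le> 1 - a\<^sup>2" using ab zero_le_power2[of b] by linarith
    ultimately show ?thesis
      by (simp only: ereal_less_eq) (intro add_mono mult_left_mono, simp_all)
  qed
  finally show ?thesis .
qed

section \<open>Contraction towards the equilibrium\<close>

lemma gaussian_scale:
  assumes v: "0 < v" and c: "0 < c"
  shows "distr (gaussian v) borel (\<lambda>x::real ^ 'n. c *\<^sub>R x) = gaussian (c\<^sup>2 * v)"
proof (rule measure_eqI)
  fix A assume "A \<in> sets (distr (gaussian v) borel (\<lambda>x::real ^ 'n. c *\<^sub>R x))"
  then have A[measurable]: "A \<in> sets borel" by simp
  have scale: "(1 / c) ^ CARD('n) * gauss_pdf v ((1 / c) *\<^sub>R x) = gauss_pdf (c\<^sup>2 * v) x" for x :: "real ^ 'n"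
  proof -
    have "(2 * pi * (c\<^sup>2 * v)) powr (- real CARD('n) / 2) = (c\<^sup>2 * (2 * pi * v)) powr (- real CARD('n) / 2)"
      by (simp add: mult_ac)
    also have "\<dots> = (c\<^sup>2) powr (- real CARD('n) / 2) * (2 * pi * v) powr (- real CARD('n) / 2)"
      by (rule powr_mult)
    also have "(c\<^sup>2) powr (- real CARD('n) / 2) = (1 / c) ^ CARD('n)"
    proof -
      have "(c\<^sup>2) powr (- real CARD('n) / 2) = c powr (2 * (- real CARD('n) / 2))"
        using c by (simp add: powr_powr flip: powr_numeral)
      also have "\<dots> = (1 / c) ^ CARD('n)" using c by (simp add: powr_minus_divide powr_realpow power_one_over)
      finally show ?thesis .
    qed
    finally have 1: "(2 * pi * (c\<^sup>2 * v)) powr (- real CARD('n) / 2) = (1 / c) ^ CARD('n) * (2 * pi * v) powr (- real CARD('n) / 2)" .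
    have 2: "- (norm ((1 / c) *\<^sub>R x))\<^sup>2 / (2 * v) = - (norm x)\<^sup>2 / (2 * (c\<^sup>2 * v))"
      using c v by (simp add: power_divide)
    show ?thesis unfolding gauss_pdf_def 1 2 by simp
  qed
  have "emeasure (distr (gaussian v) borel (\<lambda>x::real ^ 'n. c *\<^sub>R x)) A =
      (\<integral>\<^sup>+x. indicator A x \<partial>distr (gaussian v) borel (\<lambda>x::real ^ 'n. c *\<^sub>R x))"
    by simp
  also have "\<dots> = (\<integral>\<^sup>+x. ennreal (gauss_pdf v x) * indicator A (c *\<^sub>R x) \<partial>lborel)"
    unfolding gaussian_pdf by (simp add: nn_integral_distr nn_integral_density del: nn_integral_indicator)
  also have "\<dots> = (\<integral>\<^sup>+x. ennreal ((1 / c) ^ CARD('n)) * (ennreal (gauss_pdf v ((1 / c) *\<^sub>R x)) * indicator A x) \<partial>lborel)"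
    using c by (subst lborel_affine[of "1 / c" 0]) (simp_all add: nn_integral_density nn_integral_distr)
  also have "\<dots> = (\<integral>\<^sup>+x. ennreal (gauss_pdf (c\<^sup>2 * v) x) * indicator A x \<partial>lborel)"
    unfolding scale[symmetric] using c by (simp add: ennreal_mult mult.assoc)
  also have "\<dots> = emeasure (gaussian (c\<^sup>2 * v)) A"
    unfolding gaussian_pdf by (simp add: emeasure_density)
  finally show "emeasure (distr (gaussian v) borel (\<lambda>x::real ^ 'n. c *\<^sub>R x)) A = emeasure (gaussian (c\<^sup>2 * v)) A" .
qed simp

lemma gaussian_mean:
  assumes v: "0 < v" shows "has_bochner_integral (gaussian v) (\<lambda>x::real ^ 'n. x) 0"
proof -
  have int: "integrable (gaussian v) (\<lambda>x::real ^ 'n. x)"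
    by (rule Bochner_Integration.integrable_bound[OF integrable_gaussian_norm[OF v]]) auto
  have refl: "distr lborel borel uminus = (lborel :: (real ^ 'n) measure)"
    using lborel_affine[of "-1" "0 :: real ^ 'n"] by (simp add: density_1 flip: one_ennreal_def)
  have pdf: "gauss_pdf v (- x) = gauss_pdf v x" for x :: "real ^ 'n" by (simp add: gauss_pdf_def)
  have "(\<integral>x. (x :: real ^ 'n) \<partial>gaussian v) = (\<integral>x. gauss_pdf v (x :: real ^ 'n) *\<^sub>R x \<partial>lborel)"
    unfolding gaussian_pdf by (rule integral_density) auto
  also have "\<dots> = (\<integral>x. gauss_pdf v (x :: real ^ 'n) *\<^sub>R x \<partial>distr lborel borel uminus)"
    by (simp only: refl)
  also have "\<dots> = - (\<integral>x. gauss_pdf v (x :: real ^ 'n) *\<^sub>R x \<partial>lborel)"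
    by (simp add: integral_distr pdf)
  finally have "(\<integral>x. (x :: real ^ 'n) \<partial>gaussian v) = - (\<integral>x. (x :: real ^ 'n) \<partial>gaussian v)"
    unfolding gaussian_pdf by (subst (2) integral_density) auto
  then have "2 *\<^sub>R (\<integral>x. (x :: real ^ 'n) \<partial>gaussian v) = 0"
    by (metis add.right_inverse scaleR_2)
  then have "(\<integral>x. (x :: real ^ 'n) \<partial>gaussian v) = 0" by simp
  then show ?thesis using int by (simp add: has_bochner_integral_iff)
qed

lemma mean_combination:
  fixes M1 M2 :: "(real ^ 'n) measure"
  assumes M1: "prob_space M1" "sets M1 = sets borel" "has_bochner_integral M1 (\<lambda>x. x) 0"
    and M2: "prob_space M2" "sets M2 = sets borel" "has_bochner_integral M2 (\<lambda>x. x) 0"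
  shows "prob_space (distr (M1 \<Otimes>\<^sub>M M2) borel (\<lambda>z. a *\<^sub>R fst z + b *\<^sub>R snd z))"
    "has_bochner_integral (distr (M1 \<Otimes>\<^sub>M M2) borel (\<lambda>z. a *\<^sub>R fst z + b *\<^sub>R snd z)) (\<lambda>x. x) 0"
proof -
  interpret M1: prob_space M1 by fact
  interpret M2: prob_space M2 by fact
  interpret P: pair_prob_space M1 M2 ..
  note [measurable_cong] = M1(2) M2(2)
  show "prob_space (distr (M1 \<Otimes>\<^sub>M M2) borel (\<lambda>z. a *\<^sub>R fst z + b *\<^sub>R snd z))"
    by (rule P.P.prob_space_distr) measurable
  have i1: "integrable M1 (\<lambda>x. x)" "(\<integral>x. x \<partial>M1) = 0" and i2: "integrable M2 (\<lambda>x. x)" "(\<integral>x. x \<partial>M2) = 0"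
    using M1(3) M2(3) by (auto simp: has_bochner_integral_iff)
  have f: "integrable (M1 \<Otimes>\<^sub>M M2) (\<lambda>z. fst z)"
    by (rule P.Fubini_integrable) (use i1 M2.prob_space in auto)
  have s: "integrable (M1 \<Otimes>\<^sub>M M2) (\<lambda>z. snd z)"
    by (rule P.Fubini_integrable) (use i2 in auto)
  have "(\<integral>z. fst z \<partial>(M1 \<Otimes>\<^sub>M M2)) = 0" "(\<integral>z. snd z \<partial>(M1 \<Otimes>\<^sub>M M2)) = 0"
    using P.integral_fst'[OF f] P.integral_fst'[OF s] i1 i2 M2.prob_space by simp_all
  then have "has_bochner_integral (M1 \<Otimes>\<^sub>M M2) (\<lambda>z. a *\<^sub>R fst z + b *\<^sub>R snd z) 0"
    using f s by (simp add: has_bochner_integral_iff)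
  then show "has_bochner_integral (distr (M1 \<Otimes>\<^sub>M M2) borel (\<lambda>z. a *\<^sub>R fst z + b *\<^sub>R snd z)) (\<lambda>x. x) 0"
    by (subst has_bochner_integral_distr) auto
qed

lemma conv_power_Suc: "1 \<le> k \<Longrightarrow> conv_power (Suc k) M = (M \<star> conv_power k M)"
  by (cases k) (simp_all add: conv_power_def)

lemma sets_conv_power: "sets M = sets borel \<Longrightarrow> sets (conv_power k M) = sets borel"
  by (cases "k - 1") (simp_all add: conv_power_def)

lemma distr_scaled_convolution:
  fixes M N :: "(real ^ 'n) measure"
  assumes "prob_space M" "prob_space N" and [measurable_cong]: "sets M = sets borel" "sets N = sets borel"
    and r: "\<And>x y. h (x + y) = a *\<^sub>R (c *\<^sub>R x) + b *\<^sub>R (e *\<^sub>R y)" 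
    and [measurable]: "h \<in> borel_measurable borel"
  shows "distr (M \<star> N) borel h = distr (distr M borel (\<lambda>x. c *\<^sub>R x) \<Otimes>\<^sub>M distr N borel (\<lambda>x. e *\<^sub>R x)) borel (\<lambda>z. a *\<^sub>R fst z + b *\<^sub>R snd z)"
proof -
  interpret M: prob_space M by fact
  interpret N: prob_space N by fact
  have sf: "sigma_finite_measure (distr N borel (\<lambda>x. e *\<^sub>R x))"
    by (intro prob_space_imp_sigma_finite N.prob_space_distr) measurable
  have "distr M borel (\<lambda>x. c *\<^sub>R x) \<Otimes>\<^sub>M distr N borel (\<lambda>x. e *\<^sub>R x) = distr (M \<Otimes>\<^sub>M N) (borel \<Otimes>\<^sub>M borel) (\<lambda>(x, y). (c *\<^sub>R x, e *\<^sub>R y))"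
    using sf by (intro pair_measure_distr) measurable
  then have "distr (distr M borel (\<lambda>x. c *\<^sub>R x) \<Otimes>\<^sub>M distr N borel (\<lambda>x. e *\<^sub>R x)) borel (\<lambda>z. a *\<^sub>R fst z + b *\<^sub>R snd z)
     = distr (M \<Otimes>\<^sub>M N) borel (\<lambda>z. a *\<^sub>R (c *\<^sub>R fst z) + b *\<^sub>R (e *\<^sub>R snd z))"
    by (simp add: distr_distr comp_def case_prod_beta)
  also have "\<dots> = distr (M \<Otimes>\<^sub>M N) borel (\<lambda>z. h (fst z + snd z))" by (simp only: r)
  also have "\<dots> = distr (M \<star> N) borel h"
    unfolding convolution_def by (simp add: distr_distr comp_def case_prod_beta)
  finally show ?thesis ..
qed

text \<open>
  The weights \<open>1 / (k + 1)\<close> and \<open>k / (k + 1)\<close> of a new summand and of the previous normalised sum add up to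
  one, so a bound that holds for both passes to the next normalised sum. That sum stays centred, which the
  next step of the induction uses.
\<close>

lemma rel_entropy_normalised_sum_le:
  fixes M :: "(real ^ 'n) measure"
  assumes v: "0 < v" and M: "prob_space M" "sets M = sets borel" "has_bochner_integral M (\<lambda>x. x) 0"
    and d: "rel_entropy M (gaussian v) \<le> ereal d" and k: "1 \<le> k"
  defines "S \<equiv> \<lambda>k. distr (conv_power k M) borel (\<lambda>x. (1 / sqrt (real k)) *\<^sub>R x)"
  shows "prob_space (conv_power k M) \<and> has_bochner_integral (S k) (\<lambda>x. x) 0 \<and> rel_entropy (S k) (gaussian v) \<le> ereal d"
proof -
  have one: "(\<lambda>x::real ^ 'n. 1 *\<^sub>R x) = (\<lambda>x. x)" by (simp add: fun_eq_iff)
  have id: "distr M borel (\<lambda>x. 1 *\<^sub>R x) = M"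
    unfolding one using distr_id2[OF M(2)[symmetric]] by (simp add: id_def)
  show ?thesis using k
  proof (induction k rule: nat_induct_at_least)
    case base
    have "S 1 = distr M borel (\<lambda>x. (1 / sqrt (real 1)) *\<^sub>R x)"
      by (simp only: S_def conv_power_def diff_self_eq_0 funpow_0)
    also have "1 / sqrt (real 1) = 1" by simp
    finally have "S 1 = M" unfolding id .
    moreover have "conv_power 1 M = M" by (simp add: conv_power_def)
    ultimately show ?case using M d by simp
  next
    case (Suc k)
    let ?C = "conv_power k M"
    have C: "prob_space ?C" "sets ?C = sets borel" using Suc sets_conv_power[OF M(2)] by auto
    interpret C: prob_space ?C by fact
    interpret M: prob_space M by fact
    interpret P: pair_prob_space M ?C ..
    note [measurable_cong] = C(2) M(2)
    \<comment> \<open>The sum \<open>S (k + 1)\<close> is \<open>a\<close> times a new variable of law \<open>M\<close> plus \<open>b\<close> times \<open>S k\<close>.\<close>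
    define a where "a = 1 / sqrt (real (Suc k))"
    define b where "b = sqrt (real k) / sqrt (real (Suc k))"
    have k0: "0 < real k" using Suc by simp
    have ab: "0 < a" "0 < b" "a\<^sup>2 + b\<^sup>2 = 1"
      using k0 by (auto simp: a_def b_def power_divide add_divide_distrib[symmetric])
    have S: "S (Suc k) = distr (M \<Otimes>\<^sub>M S k) borel (\<lambda>z. a *\<^sub>R fst z + b *\<^sub>R snd z)"
      using k0 unfolding S_def conv_power_Suc[OF Suc(1)]
      by (subst distr_scaled_convolution[where a=a and b=b and c=1 and e="1 / sqrt (real k)"])
         (auto simp: M C a_def b_def id scaleR_add_right)
    have Sk: "prob_space (S k)" "sets (S k) = sets borel" unfolding S_def by (auto intro: C.prob_space_distr)
    have "prob_space (conv_power (Suc k) M)"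
      unfolding conv_power_Suc[OF Suc(1)] convolution_def by (rule P.P.prob_space_distr) measurable
    moreover have "has_bochner_integral (S (Suc k)) (\<lambda>x. x) 0"
      unfolding S using Suc.IH by (intro mean_combination M Sk) auto
    moreover have "rel_entropy (S (Suc k)) (gaussian v) \<le> ereal (a\<^sup>2 * d + b\<^sup>2 * d)"
      unfolding S using Suc.IH by (intro rel_entropy_combination_le v ab M Sk d) auto
    moreover have "a\<^sup>2 * d + b\<^sup>2 * d = d" using ab(3) by (metis distrib_right mult_1)
    ultimately show ?case by simp
  qed
qed

lemma rel_entropy_gaussian_self:
  assumes "0 < v" shows "rel_entropy (gaussian v :: (real ^ 'n) measure) (gaussian v) = 0"
proof -
  have "density (gaussian v :: (real ^ 'n) measure) (\<lambda>_. ennreal 1) = gaussian v" by (simp add: density_1)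
  then show ?thesis
    using rel_entropy_gaussian_density[OF assms, of "\<lambda>_::real ^ 'n. 1"] prob_space_gaussian[OF assms, where 'n='n] by simp
qed

lemma rel_entropy_gaussian_nonneg:
  fixes M :: "(real ^ 'n) measure"
  assumes v: "0 < v" and M: "prob_space M" "sets M = sets borel"
  shows "0 \<le> rel_entropy M (gaussian v)"
proof (cases "rel_entropy M (gaussian v) < \<infinity>")
  case True
  let ?G = "gaussian v :: (real ^ 'n) measure"
  interpret M: prob_space M by fact
  interpret G: prob_space ?G using v by (rule prob_space_gaussian)
  obtain p :: "real ^ 'n \<Rightarrow> real" where [measurable]: "p \<in> borel_measurable borel" and p0: "\<And>x. 0 \<le> p x" and Mp: "M = density ?G p"
    and pl: "integrable ?G (\<lambda>x. p x * ln (p x))" and ep: "rel_entropy M ?G = ereal (\<integral>x. p x * ln (p x) \<partial>?G)"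
    by (rule rel_entropy_gaussian_finite[OF v M True]) (rule that)
  have "(\<integral>\<^sup>+x. p x \<partial>?G) = 1" using M.emeasure_space_1 unfolding Mp by (simp add: emeasure_density)
  then have p1: "integrable ?G p" "(\<integral>x. p x \<partial>?G) = 1" using p0 by (auto intro!: integrableI_nonneg simp: integral_eq_nn_integral)
  have "(\<integral>x. p x - 1 \<partial>?G) \<le> (\<integral>x. p x * ln (p x) \<partial>?G)"
  proof (rule integral_mono)
    show "p x - 1 \<le> p x * ln (p x)" for x using x_ln_x_Young[OF p0[of x], of 0] by simp
  qed (use p1 pl in auto)
  then show ?thesis using p1 G.prob_space unfolding ep by simp
qed (auto simp: not_less)

text \<open>
  The Gaussian noise is a multiple of a variable in equilibrium, which has zero entropy. What remains is
  the entropy of the normalised sum with its weight \<open>1 / K\<close>.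
\<close>

lemma rel_entropy_T_op_le:
  fixes M :: "(real ^ 'n) measure"
  assumes \<sigma>: "0 < \<sigma>" and K: "2 \<le> K" and M: "prob_space M" "sets M = sets borel" "has_bochner_integral M (\<lambda>x. x) 0"
    and d: "rel_entropy M (rho_inf \<sigma> K) \<le> ereal d"
  shows "rel_entropy (T_op \<sigma> K M) (rho_inf \<sigma> K) \<le> ereal (d / real K)"
proof -
  define v where "v = real K / (real K - 1) * \<sigma>\<^sup>2"
  \<comment> \<open>The factor \<open>a\<close> takes the variance of the equilibrium to \<open>\<sigma>\<^sup>2\<close>.\<close>
  define a where "a = sqrt ((real K - 1) / real K)"
  define b where "b = 1 / sqrt (real K)"
  let ?C = "conv_power K M" and ?G = "gaussian v :: (real ^ 'n) measure"
  define S where "S = distr ?C borel (\<lambda>x. (1 / sqrt (real K)) *\<^sub>R x)"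
  have v: "0 < v" using \<sigma> K by (simp add: v_def)
  have ab: "0 < a" "0 < b" "a\<^sup>2 + b\<^sup>2 = 1" "b\<^sup>2 = 1 / real K"
    using K by (auto simp: a_def b_def power_divide add_divide_distrib[symmetric])
  have a2v: "a\<^sup>2 * v = \<sigma>\<^sup>2" using K by (simp add: a_def v_def)
  have d': "rel_entropy M ?G \<le> ereal d" using d by (simp add: rho_inf_def v_def)
  have C: "prob_space ?C" "sets ?C = sets borel" and S1: "has_bochner_integral S (\<lambda>x. x) 0" "rel_entropy S ?G \<le> ereal d"
    using rel_entropy_normalised_sum_le[OF v M d', of K] sets_conv_power[OF M(2)] K by (auto simp: S_def)
  interpret C: prob_space ?C by fact
  interpret G: prob_space ?G using v by (rule prob_space_gaussian)
  note [measurable_cong] = C(2)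
  have S2: "prob_space S" "sets S = sets borel" unfolding S_def by (auto intro: C.prob_space_distr)
  have bS: "distr S borel (\<lambda>x. b *\<^sub>R x) = scaling K ?C"
    using K unfolding S_def scaling_def b_def by (simp add: distr_distr comp_def inverse_eq_divide)
  have aG: "distr ?G borel (\<lambda>x. a *\<^sub>R x) = gaussian (\<sigma>\<^sup>2)" using gaussian_scale[OF v ab(1), where 'n='n] a2v by simp
  have "T_op \<sigma> K M = distr (?G \<Otimes>\<^sub>M S) borel (\<lambda>z. a *\<^sub>R fst z + b *\<^sub>R snd z)"
  proof -
    interpret S: prob_space S by fact
    note [measurable_cong] = S2(2)
    have sf: "sigma_finite_measure (distr S borel (\<lambda>x. b *\<^sub>R x))"
      by (intro prob_space_imp_sigma_finite S.prob_space_distr) measurable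
    have "distr ?G borel (\<lambda>x. a *\<^sub>R x) \<Otimes>\<^sub>M distr S borel (\<lambda>x. b *\<^sub>R x) = distr (?G \<Otimes>\<^sub>M S) (borel \<Otimes>\<^sub>M borel) (\<lambda>(x, y). (a *\<^sub>R x, b *\<^sub>R y))"
      using sf by (intro pair_measure_distr) measurable
    then show ?thesis unfolding T_op_def convolution_def aG[symmetric] bS[symmetric]
      by (simp add: distr_distr comp_def case_prod_beta)
  qed
  moreover have "rel_entropy (distr (?G \<Otimes>\<^sub>M S) borel (\<lambda>z. a *\<^sub>R fst z + b *\<^sub>R snd z)) ?G \<le> ereal (a\<^sup>2 * 0 + b\<^sup>2 * d)"
    by (intro rel_entropy_combination_le v ab G.prob_space_axioms sets_gaussian gaussian_mean S1 S2)
       (simp add: rel_entropy_gaussian_self[OF v])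
  ultimately show ?thesis using ab(4) by (simp add: rho_inf_def v_def)
qed

theorem theorem3:
  fixes \<sigma> :: real and K :: nat and \<rho> :: "nat \<Rightarrow> (real ^ 'n) measure"
  assumes "\<sigma> > 0" and "K \<ge> 2"
    and "\<And>n. prob_measure_on_Rn (\<rho> n)"
    and "\<And>n. \<rho> (Suc n) = T_op \<sigma> K (\<rho> n)"
    and "\<And>n. has_bochner_integral (\<rho> n) (\<lambda>x. x) 0"
  shows "(\<forall>n. rel_entropy (\<rho> (Suc n)) (rho_inf \<sigma> K)
              \<le> ereal (1 / real K) * rel_entropy (\<rho> n) (rho_inf \<sigma> K))
       \<and> ((\<exists>m. rel_entropy (\<rho> m) (rho_inf \<sigma> K) < \<infinity>) \<longrightarrow>
            (\<lambda>n. rel_entropy (\<rho> n) (rho_inf \<sigma> K)) \<longlonglongrightarrow> 0)"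
proof (intro conjI allI impI)
  have \<rho>: "prob_space (\<rho> n)" "sets (\<rho> n) = sets borel" for n
    using assms(3)[of n] by (simp_all add: prob_measure_on_Rn_def)
  have nonneg: "0 \<le> rel_entropy (\<rho> n) (rho_inf \<sigma> K)" for n
    unfolding rho_inf_def using assms(1,2) by (intro rel_entropy_gaussian_nonneg \<rho>) simp
  have step: "rel_entropy (\<rho> (Suc n)) (rho_inf \<sigma> K) \<le> ereal (d / real K)"
    if "rel_entropy (\<rho> n) (rho_inf \<sigma> K) \<le> ereal d" for n d
    unfolding assms(4) by (intro rel_entropy_T_op_le assms(1,2,5) \<rho> that)
  show "rel_entropy (\<rho> (Suc n)) (rho_inf \<sigma> K) \<le> ereal (1 / real K) * rel_entropy (\<rho> n) (rho_inf \<sigma> K)" for n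
  proof (cases "rel_entropy (\<rho> n) (rho_inf \<sigma> K)")
    case (real d)
    then show ?thesis using step[of n d] by simp
  next
    case PInf
    then show ?thesis using assms(2) by simp
  next
    case MInf
    then show ?thesis using nonneg[of n] by simp
  qed
  assume "\<exists>m. rel_entropy (\<rho> m) (rho_inf \<sigma> K) < \<infinity>"
  then obtain m where "rel_entropy (\<rho> m) (rho_inf \<sigma> K) < \<infinity>" by blast
  then obtain d where d: "rel_entropy (\<rho> m) (rho_inf \<sigma> K) = ereal d"
    using nonneg[of m] by (cases "rel_entropy (\<rho> m) (rho_inf \<sigma> K)") auto
  have bound: "rel_entropy (\<rho> (j + m)) (rho_inf \<sigma> K) \<le> ereal (d * (1 / real K) ^ j)" for j
  proof (induction j)
    case (Suc j)
    then show ?case using step[OF Suc] by (simp add: power_one_over mult.commute)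
  qed (simp add: d)
  have "(\<lambda>j. d * (1 / real K) ^ j) \<longlonglongrightarrow> d * 0"
    using assms(2) by (intro tendsto_mult tendsto_const LIMSEQ_power_zero) simp
  then have "(\<lambda>j. ereal (d * (1 / real K) ^ j)) \<longlonglongrightarrow> 0" by (simp add: zero_ereal_def)
  then have "(\<lambda>j. rel_entropy (\<rho> (j + m)) (rho_inf \<sigma> K)) \<longlonglongrightarrow> 0"
    by (rule tendsto_sandwich[OF _ _ tendsto_const, rotated 2]) (use nonneg bound in auto)
  then show "(\<lambda>n. rel_entropy (\<rho> n) (rho_inf \<sigma> K)) \<longlonglongrightarrow> 0"
    by (rule LIMSEQ_offset)
qed

end
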